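(* Let $f_1,\dots,f_c$ be a regular sequence in a local ring $S$, let $R=S/(f_1,\dots,f_c)$, and let $M$ be a pre-stable syzygy with respect to $f_1,\dots,f_c$, of complexity $\zeta$ (over $R$). Let $b_i^S(M)$ denote the $i$-th Betti number of $M$ as an $S$-module. Then $$b_0^S(M)\ge\zeta,\qquad b_1^S(M)\ge(c-\zeta+1)\,b_0^S(M)+\frac{\zeta(\zeta+1)}2-1.$$
   Context: All rings are commutative and Noetherian, all modules finitely generated. CI operators: for a complex $(\mathbf F,\delta)$ of free $R$-modules, lift it to free $S$-modules and maps $(\tilde{\mathbf F},\tilde\delta)$, write $\tilde\delta^2=\sum_jf_j\tilde t_j$, and put $t_j=R\otimes\tilde t_j:F_{i+2}\to F_i$; these are maps of complexes, well defined up to homotopy, called the CI operators. Pre-stable syzygies (recursive definition): an $R$-module $M$ is a pre-stable syzygy with respect to $f_1,\dots,f_c$ if either $c=0$ and $M=0$, or $c\ge1$ and (1) there is a minimal $R$-free resolution $(\mathbf F,\delta)$ of an $R$-module of finite projective dimension over $S$ with a surjective CI operator $t_c$ on $\mathbf F$ (all $F_{i+2}\to F_i$, $i\ge0$, surjective) and such that $M=\ker(\delta_1:F_1\to F_0)$; (2) if $\tilde\delta_1$ is a lifting of $\delta_1$ to $S/(f_1,\dots,f_{c-1})$, then $\ker\tilde\delta_1$ is a pre-stable syzygy with respect to $f_1,\dots,f_{c-1}$. The complexity of an $R$-module $N$ is $\inf\{q\ge0:\ \text{there is } w\in\mathbb R \text{ with } b_i^R(N)\le w\,i^{q-1}\text{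 for } i\gg0\}$. *)

theory Defs
  imports Complex_Main "HOL-Algebra.Algebra" "HOL-Library.Extended_Nat"
begin

locale noetherian_local_ring = cring R + noetherian_ring R for R (structure) +
  assumes unique_maximal: "\<exists>!I. maximalideal I R"

definition max_ideal :: "('r, 'x) ring_scheme \<Rightarrow> 'r set" where
  "max_ideal R = (THE I. maximalideal I R)"

text \<open>Sequences are indexed from 1: the ideal \<open>(f\<^sub>1, \<dots>, f\<^sub>p)\<close> and the quotient
  \<open>S/(f\<^sub>1, \<dots>, f\<^sub>p)\<close>. The quotients have the same type for all \<open>p\<close>;
  for \<open>p = 0\<close> the quotient is by the zero ideal.\<close>

definition seq_ideal :: "('a, 'x) ring_scheme \<Rightarrow> (nat \<Rightarrow> 'a) \<Rightarrow> nat \<Rightarrow> 'a set" where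
  "seq_ideal S f p = Idl\<^bsub>S\<^esub> (f ` {1..p})"

definition seq_quot :: "('a, 'x) ring_scheme \<Rightarrow> (nat \<Rightarrow> 'a) \<Rightarrow> nat \<Rightarrow> 'a set ring" where
  "seq_quot S f p = S Quot (seq_ideal S f p)"

definition quot_map :: "('a, 'x) ring_scheme \<Rightarrow> (nat \<Rightarrow> 'a) \<Rightarrow> nat \<Rightarrow> 'a \<Rightarrow> 'a set" where
  "quot_map S f p a = seq_ideal S f p +>\<^bsub>S\<^esub> a"

text \<open>The canonical map \<open>S/(f\<^sub>1, \<dots>, f\<^sub>p) \<rightarrow> S/(f\<^sub>1, \<dots>, f\<^sub>q)\<close> for \<open>p \<le> q\<close>:
  a coset of the smaller ideal is enlarged to the coset of the larger one containing it.\<close>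

definition quot_map_to :: "('a, 'x) ring_scheme \<Rightarrow> (nat \<Rightarrow> 'a) \<Rightarrow> nat \<Rightarrow> 'a set \<Rightarrow> 'a set" where
  "quot_map_to S f q A = set_add S (seq_ideal S f q) A"

definition regular_sequence :: "('a, 'x) ring_scheme \<Rightarrow> (nat \<Rightarrow> 'a) \<Rightarrow> nat \<Rightarrow> bool" where
  "regular_sequence S f c \<longleftrightarrow>
     (\<forall>p\<in>{1..c}. f p \<in> carrier S) \<and>
     (\<forall>p<c. \<forall>y\<in>carrier (seq_quot S f p).
        quot_map S f p (f (Suc p)) \<otimes>\<^bsub>seq_quot S f p\<^esub> y = \<zero>\<^bsub>seq_quot S f p\<^esub>
          \<longrightarrow> y = \<zero>\<^bsub>seq_quot S f p\<^esub>) \<and>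
     seq_ideal S f c \<noteq> carrier S"


definition mod_hom ::
  "('r, 'x) ring_scheme \<Rightarrow> ('r, 'm, 'y) module_scheme \<Rightarrow> ('r, 'n, 'z) module_scheme \<Rightarrow> ('m \<Rightarrow> 'n) set"
  where
  "mod_hom R M N =
     {h \<in> hom (add_monoid M) (add_monoid N).
        \<forall>a\<in>carrier R. \<forall>x\<in>carrier M. h (a \<odot>\<^bsub>M\<^esub> x) = a \<odot>\<^bsub>N\<^esub> h x}"

definition mod_iso ::
  "('r, 'x) ring_scheme \<Rightarrow> ('r, 'm, 'y) module_scheme \<Rightarrow> ('r, 'n, 'z) module_scheme \<Rightarrow> bool"
  where
  "mod_iso R M N \<longleftrightarrow>
     module R M \<and> module R N \<and> (\<exists>h\<in>mod_hom R M N. bij_betw h (carrier M) (carrier N))"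

definition hom_ker ::
  "('r, 'm, 'y) module_scheme \<Rightarrow> ('r, 'n, 'z) module_scheme \<Rightarrow> ('m \<Rightarrow> 'n) \<Rightarrow> 'm set" where
  "hom_ker M N h = {x \<in> carrier M. h x = \<zero>\<^bsub>N\<^esub>}"

definition restrict_scalars :: "('s \<Rightarrow> 'r) \<Rightarrow> ('r, 'm, 'y) module_scheme \<Rightarrow> ('s, 'm) module" where
  "restrict_scalars \<phi> M =
     \<lparr>carrier = carrier M, monoid.mult = monoid.mult M, one = one M, ring.zero = ring.zero M, add = add M,
      smult = (\<lambda>a x. \<phi> a \<odot>\<^bsub>M\<^esub> x)\<rparr>"

text \<open>The free module \<open>R\<^sup>n\<close>. The fields \<open>mult\<close> and \<open>one\<close> come from the record type and
  play no role in a module.\<close>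

definition free_mod :: "('r, 'x) ring_scheme \<Rightarrow> nat \<Rightarrow> ('r, nat \<Rightarrow> 'r) module" where
  "free_mod R n =
     \<lparr>carrier = {..<n} \<rightarrow>\<^sub>E carrier R, monoid.mult = undefined, one = undefined,
      ring.zero = (\<lambda>i\<in>{..<n}. \<zero>\<^bsub>R\<^esub>),
      add = (\<lambda>x y. \<lambda>i\<in>{..<n}. x i \<oplus>\<^bsub>R\<^esub> y i),
      smult = (\<lambda>a x. \<lambda>i\<in>{..<n}. a \<otimes>\<^bsub>R\<^esub> x i)\<rparr>"

text \<open>\<open>h\<close> is the base change along \<open>\<phi> : A \<rightarrow> B\<close> of \<open>g : A\<^sup>m \<rightarrow> A\<^sup>n\<close>. For surjective \<open>\<phi>\<close>,
  this says that \<open>g\<close> is a lifting of \<open>h : B\<^sup>m \<rightarrow> B\<^sup>n\<close> and that \<open>h = B \<otimes> g\<close>.\<close>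

definition base_change_map ::
  "('r, 'x) ring_scheme \<Rightarrow> ('s, 'y) ring_scheme \<Rightarrow> ('r \<Rightarrow> 's) \<Rightarrow> nat \<Rightarrow> nat
     \<Rightarrow> ((nat \<Rightarrow> 'r) \<Rightarrow> nat \<Rightarrow> 'r) \<Rightarrow> ((nat \<Rightarrow> 's) \<Rightarrow> nat \<Rightarrow> 's) \<Rightarrow> bool" where
  "base_change_map A B \<phi> m n g h \<longleftrightarrow>
     g \<in> mod_hom A (free_mod A m) (free_mod A n) \<and>
     h \<in> mod_hom B (free_mod B m) (free_mod B n) \<and>
     (\<forall>x\<in>carrier (free_mod A m). h (\<lambda>i\<in>{..<m}. \<phi> (x i)) = (\<lambda>i\<in>{..<n}. \<phi> (g x i)))"


text \<open>\<open>d i\<close> is the differential \<open>P\<^sub>i \<rightarrow> P\<^sub>i\<^sub>-\<^sub>1\<close> for \<open>i \<ge> 1\<close> (\<open>d 0\<close> is irrelevant), and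
  \<open>e : P\<^sub>0 \<rightarrow> L\<close> is the augmentation.\<close>

definition resolution ::
  "('r, 'x) ring_scheme \<Rightarrow> (nat \<Rightarrow> ('r, 'p) module) \<Rightarrow> (nat \<Rightarrow> 'p \<Rightarrow> 'p) \<Rightarrow> ('p \<Rightarrow> 'l)
     \<Rightarrow> ('r, 'l, 'y) module_scheme \<Rightarrow> bool" where
  "resolution R P d e L \<longleftrightarrow>
     module R L \<and> (\<forall>i. module R (P i)) \<and>
     (\<forall>i. d (Suc i) \<in> mod_hom R (P (Suc i)) (P i)) \<and>
     e \<in> mod_hom R (P 0) L \<and>
     e ` carrier (P 0) = carrier L \<and>
     hom_ker (P 0) L e = d 1 ` carrier (P 1) \<and>
     (\<forall>i. hom_ker (P (Suc i)) (P i) (d (Suc i)) = d (Suc (Suc i)) ` carrier (P (Suc (Suc i))))"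

definition minimal_free_resolution ::
  "('r, 'x) ring_scheme \<Rightarrow> (nat \<Rightarrow> nat) \<Rightarrow> (nat \<Rightarrow> (nat \<Rightarrow> 'r) \<Rightarrow> nat \<Rightarrow> 'r) \<Rightarrow> ((nat \<Rightarrow> 'r) \<Rightarrow> 'l)
     \<Rightarrow> ('r, 'l, 'y) module_scheme \<Rightarrow> bool" where
  "minimal_free_resolution R n d e L \<longleftrightarrow>
     resolution R (\<lambda>i. free_mod R (n i)) d e L \<and>
     (\<forall>i. \<forall>x\<in>carrier (free_mod R (n (Suc i))). \<forall>j<n i. d (Suc i) x j \<in> max_ideal R)"

text \<open>Finitely generated projective modules are the direct summands of the \<open>R\<^sup>n\<close>.\<close>

definition fg_projective :: "('r, 'x) ring_scheme \<Rightarrow> ('r, 'p, 'y) module_scheme \<Rightarrow> bool" where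
  "fg_projective R P \<longleftrightarrow>
     module R P \<and>
     (\<exists>n. \<exists>r\<in>mod_hom R (free_mod R n) P. \<exists>s\<in>mod_hom R P (free_mod R n).
        \<forall>x\<in>carrier P. r (s x) = x)"

text \<open>As every finitely generated projective module is isomorphic to a submodule of some
  \<open>R\<^sup>n\<close>, it is no restriction that the modules in the resolution live on the type of vectors.
  The infimum of the empty set is \<open>\<infinity>\<close>.\<close>

definition proj_dim :: "('r, 'x) ring_scheme \<Rightarrow> ('r, 'l, 'y) module_scheme \<Rightarrow> enat" where
  "proj_dim R L =
     Inf {enat m |m. \<exists>(P :: nat \<Rightarrow> ('r, nat \<Rightarrow> 'r) module) d e.
            resolution R P d e L \<and> (\<forall>i. fg_projective R (P i)) \<and>
            (\<forall>i>m. carrier (P i) = {\<zero>\<^bsub>P i\<^esub>})}"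

text \<open>Meant for finitely generated modules over Noetherian local rings, where the ranks in a
  minimal free resolution exist and are unique.\<close>

definition betti :: "('r, 'x) ring_scheme \<Rightarrow> ('r, 'l, 'y) module_scheme \<Rightarrow> nat \<Rightarrow> nat" where
  "betti R L i = (THE b. \<exists>n d e. minimal_free_resolution R n d e L \<and> n i = b)"

definition complexity :: "('r, 'x) ring_scheme \<Rightarrow> ('r, 'l, 'y) module_scheme \<Rightarrow> enat" where
  "complexity R L =
     Inf {enat q |q. \<exists>w::real. \<forall>\<^sub>F i in sequentially.
            real (betti R L i) \<le> w * real i powi (int q - 1)}"


text \<open>\<open>t j i : F\<^sub>i\<^sub>+\<^sub>2 \<rightarrow> F\<^sub>i\<close>, for \<open>1 \<le> j \<le> c\<close>, is a system of CI operators on the complex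
  of free modules \<open>F\<^sub>i = R\<^bsup>n i\<^esup>\<close> over \<open>R = S/(f\<^sub>1, \<dots>, f\<^sub>c)\<close>, arising from some lifting \<open>d'\<close>
  of the differential to \<open>S\<close> and some choice of the \<open>t'\<close>. They are independent of these
  choices up to homotopy.\<close>

definition ci_operators ::
  "('a, 'x) ring_scheme \<Rightarrow> (nat \<Rightarrow> 'a) \<Rightarrow> nat \<Rightarrow> (nat \<Rightarrow> nat)
     \<Rightarrow> (nat \<Rightarrow> (nat \<Rightarrow> 'a set) \<Rightarrow> nat \<Rightarrow> 'a set)
     \<Rightarrow> (nat \<Rightarrow> nat \<Rightarrow> (nat \<Rightarrow> 'a set) \<Rightarrow> nat \<Rightarrow> 'a set) \<Rightarrow> bool" where
  "ci_operators S f c n d t \<longleftrightarrow>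
     (\<exists>d' t'.
        (\<forall>i. base_change_map S (seq_quot S f c) (quot_map S f c) (n (Suc i)) (n i)
               (d' (Suc i)) (d (Suc i))) \<and>
        (\<forall>j\<in>{1..c}. \<forall>i. base_change_map S (seq_quot S f c) (quot_map S f c) (n (i + 2)) (n i)
               (t' j i) (t j i)) \<and>
        (\<forall>i. \<forall>x\<in>carrier (free_mod S (n (i + 2))).
           d' (i + 1) (d' (i + 2) x) =
             (\<Oplus>\<^bsub>free_mod S (n i)\<^esub>j\<in>{1..c}. f j \<odot>\<^bsub>free_mod S (n i)\<^esub> t' j i x)))"

text \<open>The recursion has to run over modules of one fixed type, which is no restriction up to
  isomorphism because pre-stable syzygies are submodules of free modules.
  Likewise, the module \<open>L\<close> resolved by \<open>F\<close> is isomorphic to the cokernel of \<open>d 1\<close>,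
  so that it can be taken on the type of sets of vectors.\<close>

primrec prestable_syzygy_vec ::
  "('a, 'x) ring_scheme \<Rightarrow> (nat \<Rightarrow> 'a) \<Rightarrow> nat \<Rightarrow> ('a set, nat \<Rightarrow> 'a set) module \<Rightarrow> bool" where
  "prestable_syzygy_vec S f 0 M \<longleftrightarrow>
     module (seq_quot S f 0) M \<and> carrier M = {\<zero>\<^bsub>M\<^esub>}"
| "prestable_syzygy_vec S f (Suc p) M \<longleftrightarrow>
     (let R = seq_quot S f (Suc p); R' = seq_quot S f p in
      \<exists>n d e (L :: ('a set, (nat \<Rightarrow> 'a set) set) module) t.
        minimal_free_resolution R n d e L \<and>
        proj_dim S (restrict_scalars (quot_map S f (Suc p)) L) < \<infinity> \<and>
        ci_operators S f (Suc p) n d t \<and>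
        (\<forall>i. t (Suc p) i ` carrier (free_mod R (n (i + 2))) = carrier (free_mod R (n i))) \<and>
        mod_iso R M ((free_mod R (n 1))
          \<lparr>carrier := hom_ker (free_mod R (n 1)) (free_mod R (n 0)) (d 1)\<rparr>) \<and>
        (\<forall>d\<^sub>1. base_change_map R' R (quot_map_to S f (Suc p)) (n 1) (n 0) d\<^sub>1 (d 1) \<longrightarrow>
           prestable_syzygy_vec S f p ((free_mod R' (n 1))
             \<lparr>carrier := hom_ker (free_mod R' (n 1)) (free_mod R' (n 0)) d\<^sub>1\<rparr>)))"

definition prestable_syzygy ::
  "('a, 'x) ring_scheme \<Rightarrow> (nat \<Rightarrow> 'a) \<Rightarrow> nat \<Rightarrow> ('a set, 'm, 'y) module_scheme \<Rightarrow> bool" where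
  "prestable_syzygy S f c M \<longleftrightarrow>
     (\<exists>K. prestable_syzygy_vec S f c K \<and> mod_iso (seq_quot S f c) M K)"

end

theory Submission
  imports Defs "HOL-Library.Function_Algebras" "Jordan_Normal_Form.Determinant"
begin

text \<open>
  Write \<open>R\<^sub>p = S/(f\<^sub>1, \<dots>, f\<^sub>p)\<close>, and let \<open>M\<^sub>p\<close> be a pre-stable syzygy over \<open>R\<^sub>p\<close>. The proof descends from
  \<open>M\<^sub>p\<close> to the syzygy \<open>M\<^sub>p\<^sub>-\<^sub>1\<close> over \<open>R\<^sub>p\<^sub>-\<^sub>1\<close> that the definition provides, and records how Betti numbers change.

  Let \<open>F\<close> be the minimal resolution over \<open>R\<^sub>p\<close> with \<open>M\<^sub>p = ker(F\<^sub>1 \<rightarrow> F\<^sub>0)\<close>, lifted to \<open>R\<^sub>p\<^sub>-\<^sub>1\<close>, where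
  \<open>\<delta>\<^sup>2 = f\<^sub>p t\<close>. As \<open>f\<^sub>p\<close> is regular, \<open>t\<close> commutes with \<open>\<delta>\<close>; as \<open>t\<close> is surjective, its kernel \<open>G\<close> consists of
  free modules of rank \<open>rank F\<^sub>i - rank F\<^sub>i\<^sub>-\<^sub>2\<close>, and \<open>\<delta>\<^sup>2 = 0\<close> on \<open>G\<close>. A diagram chase (\<open>lift_cycle\<close>) shows that
  \<open>G\<close> in degrees at least 2 is a minimal resolution of \<open>M\<^sub>p\<^sub>-\<^sub>1\<close>. With \<open>a = rank F\<^sub>0\<close> and \<open>e = rank F\<^sub>1\<close>, the Betti
  numbers \<open>\<beta>\<close> of \<open>M\<^sub>p\<close> and \<open>\<beta>'\<close> of \<open>M\<^sub>p\<^sub>-\<^sub>1\<close> over \<open>R\<^sub>p\<close> and \<open>R\<^sub>p\<^sub>-\<^sub>1\<close> therefore satisfy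
  \<open>\<beta>\<^sub>i = \<beta>'\<^sub>i + \<beta>\<^sub>i\<^sub>-\<^sub>2\<close>, where \<open>\<beta>\<^sub>-\<^sub>2 = a\<close> and \<open>\<beta>\<^sub>-\<^sub>1 = e\<close>. So each nonzero level raises the order of growth by one, and
  the complexity \<open>\<zeta>\<close> is the number of levels \<open>p\<close> with \<open>M\<^sub>p \<noteq> 0\<close>. Moreover \<open>\<delta>\<^sub>1\<close> composed with \<open>\<delta>\<^sub>2\<close> on a section of
  \<open>t\<close> is multiplication by \<open>f\<^sub>p\<close>, which forces \<open>a \<le> e\<close>, with equality only if \<open>\<delta>\<^sub>1\<close> is injective over \<open>R\<^sub>p\<^sub>-\<^sub>1\<close>, that is, if
  \<open>M\<^sub>p\<^sub>-\<^sub>1 = 0\<close>.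

  Over \<open>S\<close>, the module \<open>M\<^sub>p\<close> has \<open>a\<close> generators more than \<open>M\<^sub>p\<^sub>-\<^sub>1\<close>. Among its minimal relations there are those of
  \<open>M\<^sub>p\<^sub>-\<^sub>1\<close>, then \<open>e\<close> relations given by \<open>\<delta>\<^sub>3\<close> on a section of \<open>t\<close>, and the \<open>(p - 1) a\<close> products of
  \<open>f\<^sub>1, \<dots>, f\<^sub>p\<^sub>-\<^sub>1\<close> with the new generators. They are independent (\<open>independent_step\<close>): applying \<open>t\<close> to a dependence
  leaves a relation among \<open>f\<^sub>1, \<dots>, f\<^sub>p\<^sub>-\<^sub>1\<close>, and the coefficients of such a relation lie in the maximal ideal
  (\<open>relation_trivial\<close>). So \<open>b\<^sub>1\<^sup>S(M) \<ge> \<Sum>\<^sub>p (e\<^sub>p + (p - 1) a\<^sub>p)\<close> and \<open>b\<^sub>0\<^sup>S(M) = \<Sum>\<^sub>p a\<^sub>p\<close>; the inequalities between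
  \<open>a\<^sub>p\<close> and \<open>e\<^sub>p\<close> then give the claim (\<open>layers_bounds\<close>).

  All rings involved are quotients of \<open>S\<close>, and \<open>S\<close> itself is a quotient of a type of class \<open>comm_ring_1\<close>, the type
  \<open>uring\<close> below. Modules are presented by vectors over this type, and statements over \<open>R\<^sub>p\<close> become congruences modulo the
  preimage of \<open>(f\<^sub>1, \<dots>, f\<^sub>p)\<close>. In this way the lifting of maps from \<open>R\<^sub>p\<close> to \<open>R\<^sub>p\<^sub>-\<^sub>1\<close> and \<open>S\<close> is just a change of the
  modulus.
\<close>

section \<open>Vectors and linear maps over a commutative ring type\<close>

definition is_ideal :: "'r::comm_ring_1 set \<Rightarrow> bool" where
  "is_ideal I \<longleftrightarrow> 0 \<in> I \<and> (\<forall>x\<in>I. \<forall>y\<in>I. x + y \<in> I) \<and> (\<forall>c. \<forall>x\<in>I. c * x \<in> I)"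

lemma ideal_zero: "is_ideal I \<Longrightarrow> 0 \<in> I"
  and ideal_add: "is_ideal I \<Longrightarrow> x \<in> I \<Longrightarrow> y \<in> I \<Longrightarrow> x + y \<in> I"
  and ideal_mult_left: "is_ideal I \<Longrightarrow> x \<in> I \<Longrightarrow> c * x \<in> I"
  and ideal_mult_right: "is_ideal I \<Longrightarrow> x \<in> I \<Longrightarrow> x * c \<in> I"
  by (auto simp: is_ideal_def mult.commute)

lemma ideal_uminus: "is_ideal I \<Longrightarrow> x \<in> I \<Longrightarrow> - x \<in> I"
  using ideal_mult_left[of I x "-1"] by simp

lemma ideal_diff: "is_ideal I \<Longrightarrow> x \<in> I \<Longrightarrow> y \<in> I \<Longrightarrow> x - y \<in> I"
  using ideal_add[of I x "- y"] ideal_uminus by force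

lemma ideal_sum: "is_ideal I \<Longrightarrow> (\<And>i. i \<in> A \<Longrightarrow> g i \<in> I) \<Longrightarrow> sum g A \<in> I"
  by (induction A rule: infinite_finite_induct) (auto intro: ideal_zero ideal_add)

lemma ideal_prod_diff:
  assumes "is_ideal I" "\<And>i. i \<in> A \<Longrightarrow> a i - b i \<in> I"
  shows "prod a A - prod b A \<in> I"
  using assms(2)
proof (induction A rule: infinite_finite_induct)
  case (insert x F)
  have "prod a (insert x F) - prod b (insert x F)
      = (a x - b x) * prod a F + b x * (prod a F - prod b F)"
    using insert.hyps by (simp add: algebra_simps)
  then show ?case
    using insert assms(1) by (metis ideal_add ideal_mult_left ideal_mult_right insertCI)
qed (use assms(1) in \<open>auto intro: ideal_zero\<close>)

definition scl :: "'r::comm_ring_1 \<Rightarrow> (nat \<Rightarrow> 'r) \<Rightarrow> nat \<Rightarrow> 'r"  (infixr "\<star>" 75) where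
  "c \<star> x = (\<lambda>i. c * x i)"

lemma scl_apply [simp]: "(c \<star> x) i = c * x i"
  by (simp add: scl_def)

lemma
  fixes x y :: "nat \<Rightarrow> 'r::comm_ring_1"
  shows scl_add: "c \<star> (x + y) = c \<star> x + c \<star> y" and scl_add_left: "(a + b) \<star> x = a \<star> x + b \<star> x"
    and scl_scl: "a \<star> b \<star> x = (a * b) \<star> x" and scl_one: "1 \<star> x = x"
    and scl_zero_left: "0 \<star> x = 0" and scl_zero: "c \<star> 0 = (0 :: nat \<Rightarrow> 'r)"
    and scl_diff: "c \<star> (x - y) = c \<star> x - c \<star> y" and scl_diff_left: "(a - b) \<star> x = a \<star> x - b \<star> x"
    and scl_minus_left: "(- c) \<star> x = - (c \<star> x)"
  by (auto simp: fun_eq_iff algebra_simps)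

lemma sum_vec_apply: "(\<Sum>j\<in>A. (g j :: nat \<Rightarrow> 'r::comm_ring_1)) i = (\<Sum>j\<in>A. g j i)"
  by (induction A rule: infinite_finite_induct) auto

lemma scl_sum: "c \<star> (\<Sum>j\<in>A. g j) = (\<Sum>j\<in>A. c \<star> (g j :: nat \<Rightarrow> 'r::comm_ring_1))"
  by (auto simp: fun_eq_iff sum_distrib_left sum_vec_apply)

definition stdvec :: "nat \<Rightarrow> nat \<Rightarrow> 'r::comm_ring_1" where
  "stdvec j = (\<lambda>i. if i = j then 1 else 0)"

text \<open>Vectors are functions on all natural numbers, of which only the first \<open>n\<close> entries count. The rank of the
  codomain does not occur here: it enters where values are compared.\<close>

definition lin :: "nat \<Rightarrow> ((nat \<Rightarrow> 'r::comm_ring_1) \<Rightarrow> nat \<Rightarrow> 'r) \<Rightarrow> bool" where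
  "lin n F \<longleftrightarrow> (\<forall>x y. F (x + y) = F x + F y) \<and> (\<forall>c x. F (c \<star> x) = c \<star> F x) \<and>
     (\<forall>x. (\<forall>i<n. x i = 0) \<longrightarrow> F x = 0)"

lemma lin_add: "lin n F \<Longrightarrow> F (x + y) = F x + F y"
  and lin_scl: "lin n F \<Longrightarrow> F (c \<star> x) = c \<star> F x"
  and lin_vanish: "lin n F \<Longrightarrow> (\<And>i. i < n \<Longrightarrow> x i = 0) \<Longrightarrow> F x = 0"
  by (auto simp: lin_def)

lemma lin_zero: "lin n F \<Longrightarrow> F 0 = 0"
  by (rule lin_vanish) auto

lemma lin_minus: "lin n F \<Longrightarrow> F (- x) = - F x"
  using lin_scl[of n F "-1" x] by (simp add: scl_minus_left scl_one)

lemma lin_diff: "lin n F \<Longrightarrow> F (x - y) = F x - F y"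
  using lin_add[of n F x "- y"] lin_minus[of n F y] by simp

lemma lin_sum: "lin n F \<Longrightarrow> F (\<Sum>j\<in>A. g j) = (\<Sum>j\<in>A. F (g j))"
  by (induction A rule: infinite_finite_induct) (auto simp: lin_zero lin_add)

lemma lin_eq: "lin n F \<Longrightarrow> (\<And>i. i < n \<Longrightarrow> x i = y i) \<Longrightarrow> F x = F y"
  using lin_vanish[of n F "x - y"] lin_diff[of n F x y] by simp

lemma sum_stdvec:
  assumes "j < n"
  shows "(\<Sum>l<n. stdvec j l \<star> v l) = v j"
proof
  fix i
  have "(\<Sum>l<n. stdvec j l \<star> v l) i = (\<Sum>l<n. if l = j then v l i else 0)"
    unfolding sum_vec_apply by (intro sum.cong) (auto simp: stdvec_def)
  then show "(\<Sum>l<n. stdvec j l \<star> v l) i = v j i" using assms by simp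
qed

lemma lin_expand:
  assumes "lin n F"
  shows "F x = (\<Sum>j<n. x j \<star> F (stdvec j))"
proof -
  have "F x = F (\<Sum>j<n. x j \<star> stdvec j)"
    by (rule lin_eq[OF assms]) (simp add: stdvec_def sum_vec_apply if_distrib cong: if_cong)
  then show ?thesis
    by (simp add: lin_sum[OF assms] lin_scl[OF assms])
qed

lemma linI_expand: "lin n (\<lambda>x. \<Sum>j<n. x j \<star> v j)"
  unfolding lin_def by (auto simp: scl_add_left sum.distrib scl_sum scl_scl scl_zero_left)

lemma lin_id_trunc: "lin n (\<lambda>x i. if i < n then x i else 0)"
  unfolding lin_def by (auto simp: fun_eq_iff)

lemma lin_mono: "lin n F \<Longrightarrow> n \<le> m \<Longrightarrow> lin m F"
  unfolding lin_def by auto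

lemma lin_plus: "lin n F \<Longrightarrow> lin n G \<Longrightarrow> lin n (\<lambda>x. F x + G x)"
  unfolding lin_def by (auto simp: scl_add algebra_simps)

lemma lin_minus_map: "lin n F \<Longrightarrow> lin n G \<Longrightarrow> lin n (\<lambda>x. F x - G x)"
  unfolding lin_def by (auto simp: scl_diff algebra_simps)

lemma lin_comp: "lin n F \<Longrightarrow> lin m G \<Longrightarrow> lin n (\<lambda>x. G (F x))"
  using lin_zero[of m G] unfolding lin_def by auto

lemma lin_scl_map: "lin n F \<Longrightarrow> lin n (\<lambda>x. c \<star> F x)"
  unfolding lin_def by (auto simp: scl_add scl_scl mult.commute scl_zero)

lemma lin_const_zero: "lin n (\<lambda>x. 0)"
  unfolding lin_def by (auto simp: scl_zero)

lemma lin_sum_map: "(\<And>j. j \<in> A \<Longrightarrow> lin n (F j)) \<Longrightarrow> lin n (\<lambda>x. \<Sum>j\<in>A. F j x)"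
proof (induction A rule: infinite_finite_induct)
  case (insert a A)
  have "(\<lambda>x. \<Sum>j\<in>insert a A. F j x) = (\<lambda>x. F a x + (\<Sum>j\<in>A. F j x))"
    using insert.hyps by (intro ext) (subst sum.insert, auto)
  then show ?case using insert lin_plus[of n "F a" "\<lambda>x. \<Sum>j\<in>A. F j x"] by (metis insertCI)
qed (simp_all add: lin_const_zero)

text \<open>Congruence of vectors of length \<open>n\<close> modulo \<open>I\<close>. With the ideal property built in, congruences can be
  chained without side conditions.\<close>

definition eqmod :: "nat \<Rightarrow> 'r::comm_ring_1 set \<Rightarrow> (nat \<Rightarrow> 'r) \<Rightarrow> (nat \<Rightarrow> 'r) \<Rightarrow> bool" where
  "eqmod n I x y \<longleftrightarrow> is_ideal I \<and> (\<forall>i<n. x i - y i \<in> I)"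

lemma eqmod_refl [intro, simp]: "is_ideal I \<Longrightarrow> eqmod n I x x"
  by (auto simp: eqmod_def ideal_zero)

lemma eqmod_sym: "eqmod n I x y \<Longrightarrow> eqmod n I y x"
  unfolding eqmod_def by (metis ideal_uminus minus_diff_eq)

lemma eqmod_trans [trans]: "eqmod n I x y \<Longrightarrow> eqmod n I y z \<Longrightarrow> eqmod n I x z"
proof -
  assume a: "eqmod n I x y" "eqmod n I y z"
  have "x i - z i = (x i - y i) + (y i - z i)" for i by simp
  then show ?thesis using a unfolding eqmod_def by (metis ideal_add)
qed

lemma eqmod_add: "eqmod n I x y \<Longrightarrow> eqmod n I x' y' \<Longrightarrow> eqmod n I (x + x') (y + y')"
  unfolding eqmod_def using ideal_add by (fastforce simp: add_diff_add)

lemma eqmod_scl: "eqmod n I x y \<Longrightarrow> eqmod n I (c \<star> x) (c \<star> y)"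
  unfolding eqmod_def by (auto simp: right_diff_distrib[symmetric] intro: ideal_mult_left)

lemma eqmod_minus: "eqmod n I x y \<Longrightarrow> eqmod n I (- x) (- y)"
  using eqmod_scl[of n I x y "-1"] by (simp add: scl_minus_left scl_one)

lemma eqmod_diff: "eqmod n I x y \<Longrightarrow> eqmod n I x' y' \<Longrightarrow> eqmod n I (x - x') (y - y')"
  using eqmod_add[of n I x y "- x'" "- y'"] eqmod_minus[of n I x' y'] by simp

lemma eqmod_diff_iff: "eqmod n I x y \<longleftrightarrow> eqmod n I (x - y) 0"
  by (auto simp: eqmod_def)

lemma eqmod_0_trans: "eqmod n I x y \<Longrightarrow> eqmod n I y 0 \<longleftrightarrow> eqmod n I x 0"
  using eqmod_sym eqmod_trans by blast

lemma eqmod_sum: "is_ideal I \<Longrightarrow> (\<And>j. j \<in> A \<Longrightarrow> eqmod n I (g j) (h j)) \<Longrightarrow> eqmod n I (sum g A) (sum h A)"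
  by (induction A rule: infinite_finite_induct) (auto intro: eqmod_add)

lemma eqmod_mono: "eqmod n I x y \<Longrightarrow> I \<subseteq> I' \<Longrightarrow> is_ideal I' \<Longrightarrow> eqmod n I' x y"
  unfolding eqmod_def by auto

lemma eqmod_0_scl_in: "is_ideal I \<Longrightarrow> c \<in> I \<Longrightarrow> eqmod n I (c \<star> x) 0"
  unfolding eqmod_def by (auto intro: ideal_mult_right)

lemma eqmod_0_scl: "eqmod n I x 0 \<Longrightarrow> eqmod n I (c \<star> x) 0"
  using eqmod_scl[of n I x 0 c] by (simp add: scl_zero)

lemma eqmod_0_sum: "is_ideal I \<Longrightarrow> (\<And>j. j \<in> A \<Longrightarrow> eqmod n I (g j) 0) \<Longrightarrow> eqmod n I (sum g A) 0"
  using eqmod_sum[of I A n g "\<lambda>_. 0"] by simp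

lemma eqmod_0_add: "eqmod n I x 0 \<Longrightarrow> eqmod n I y 0 \<Longrightarrow> eqmod n I (x + y) 0"
  using eqmod_add[of n I x 0 y 0] by simp

lemma eqmod_0_diff: "eqmod n I x 0 \<Longrightarrow> eqmod n I y 0 \<Longrightarrow> eqmod n I (x - y) 0"
  using eqmod_diff[of n I x 0 y 0] by simp

text \<open>A linear map preserves congruences modulo every ideal, so one lift to the ring type serves all quotients.\<close>

lemma eqmod_lin_0: "lin n F \<Longrightarrow> eqmod n I x 0 \<Longrightarrow> eqmod m I (F x) 0"
  unfolding lin_expand[of n F x]
  by (rule eqmod_0_sum) (auto simp: eqmod_def intro: ideal_mult_right)

lemma eqmod_lin: "lin n F \<Longrightarrow> eqmod n I x y \<Longrightarrow> eqmod m I (F x) (F y)"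
  using eqmod_lin_0[of n F I "x - y" m] eqmod_diff_iff[of m I "F x" "F y"]
  by (metis eqmod_diff_iff lin_diff)

definition submod :: "(nat \<Rightarrow> 'r::comm_ring_1) set \<Rightarrow> bool" where
  "submod K \<longleftrightarrow> 0 \<in> K \<and> (\<forall>x\<in>K. \<forall>y\<in>K. x + y \<in> K) \<and> (\<forall>c. \<forall>x\<in>K. c \<star> x \<in> K)"

lemma submod_zero: "submod K \<Longrightarrow> 0 \<in> K"
  and submod_add: "submod K \<Longrightarrow> x \<in> K \<Longrightarrow> y \<in> K \<Longrightarrow> x + y \<in> K"
  and submod_scl: "submod K \<Longrightarrow> x \<in> K \<Longrightarrow> c \<star> x \<in> K"
  by (auto simp: submod_def)

lemma submod_diff: "submod K \<Longrightarrow> x \<in> K \<Longrightarrow> y \<in> K \<Longrightarrow> x - y \<in> K"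
  using submod_add[of K x "- y"] submod_scl[of K y "-1"] by (simp add: scl_minus_left scl_one)

lemma submod_sum: "submod K \<Longrightarrow> (\<And>j. j \<in> A \<Longrightarrow> g j \<in> K) \<Longrightarrow> sum g A \<in> K"
  by (induction A rule: infinite_finite_induct) (auto intro: submod_zero submod_add)

(* As default simplification rules, the pointwise equations would also expand vectors that are not
   applied to an index. *)
lemmas vec_apply = plus_fun_apply zero_fun_apply minus_apply uminus_apply scl_apply sum_vec_apply

declare plus_fun_apply [simp del] zero_fun_apply [simp del] minus_apply [simp del]
  uminus_apply [simp del] scl_apply [simp del]

text \<open>A linear map exists with prescribed values on the basis; so it can be chosen inside any
  linear relation that is total on the left.\<close>

lemma lin_choose:
  assumes "\<And>x y x' y'. P x y \<Longrightarrow> P x' y' \<Longrightarrow> P (x + x') (y + y')"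
    and "\<And>c x y. P x y \<Longrightarrow> P (c \<star> x) (c \<star> y)"
    and "\<And>x. (\<And>i. i < n \<Longrightarrow> x i = 0) \<Longrightarrow> P x 0"
    and "\<And>j. j < n \<Longrightarrow> \<exists>y. P (stdvec j) y"
  shows "\<exists>F. lin n F \<and> (\<forall>x. P x (F x))"
proof -
  obtain v where v: "\<And>j. j < n \<Longrightarrow> P (stdvec j) (v j)" using assms(4) by metis
  define F where "F = (\<lambda>x. \<Sum>j<n. x j \<star> v j)"
  have sums: "P (\<Sum>j<k. x j \<star> stdvec j) (\<Sum>j<k. x j \<star> v j)" if "k \<le> n" for k and x :: "nat \<Rightarrow> 'a"
    using that
  proof (induction k)
    case 0
    have "P 0 0" by (rule assms(3)) (simp add: vec_apply)
    then show ?case by (simp only: sum.empty lessThan_0)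
  next
    case (Suc k)
    then show ?case using assms(1)[OF Suc.IH assms(2)[OF v[of k]]]
      by (simp only: sum.lessThan_Suc Suc_le_eq less_imp_le)
  qed
  have "P x (F x)" for x
  proof -
    let ?s = "\<Sum>j<n. x j \<star> stdvec j"
    have "P (x - ?s) 0"
      by (rule assms(3)) (simp add: stdvec_def vec_apply if_distrib cong: if_cong)
    from assms(1)[OF this sums[of n x]] show ?thesis unfolding F_def by simp
  qed
  then show ?thesis using linI_expand[of n v] unfolding F_def by blast
qed

section \<open>Linear algebra over a local ring\<close>

lemma det_diff_in_ideal:
  assumes "is_ideal J" "A \<in> carrier_mat n n" "B \<in> carrier_mat n n"
    and "\<And>i j. i < n \<Longrightarrow> j < n \<Longrightarrow> A $$ (i,j) - B $$ (i,j) \<in> J"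
  shows "det A - det B \<in> J"
proof -
  have "(\<Prod>i = 0..<n. A $$ (i, p i)) - (\<Prod>i = 0..<n. B $$ (i, p i)) \<in> J" if "p permutes {0..<n}" for p
    using assms(1,4) permutes_in_image[OF that] by (intro ideal_prod_diff) auto
  then show ?thesis
    unfolding det_def'[OF assms(2)] det_def'[OF assms(3)] sum_subtractf[symmetric]
      right_diff_distrib[symmetric]
    using assms(1) by (auto intro!: ideal_sum ideal_mult_left)
qed

lemma adj_mat_sums:
  assumes "A \<in> carrier_mat n n" "k < n" "j < n"
  shows "(\<Sum>i<n. adj_mat A $$ (k,i) * A $$ (i,j)) = (if k = j then det A else 0)"
    and "(\<Sum>i<n. A $$ (k,i) * adj_mat A $$ (i,j)) = (if k = j then det A else 0)"
proof -
  have "(adj_mat A * A) $$ (k,j) = (\<Sum>i<n. adj_mat A $$ (k,i) * A $$ (i,j))"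
       "(A * adj_mat A) $$ (k,j) = (\<Sum>i<n. A $$ (k,i) * adj_mat A $$ (i,j))"
    using assms adj_mat(1)[OF assms(1)] by (auto simp: scalar_prod_def lessThan_atLeast0)
  then show "(\<Sum>i<n. adj_mat A $$ (k,i) * A $$ (i,j)) = (if k = j then det A else 0)"
    and "(\<Sum>i<n. A $$ (k,i) * adj_mat A $$ (i,j)) = (if k = j then det A else 0)"
    using adj_mat(2,3)[OF assms(1)] assms(2,3) by auto
qed

text \<open>A factorization of multiplication by \<open>f\<close> on \<open>R\<^sup>a\<close> through \<open>R\<^sup>e\<close> with \<open>e \<le> a\<close>. Padding the matrices with
  zeros to squares, the product of their determinants is \<open>f\<^sup>a\<close> modulo \<open>J\<close>. If \<open>e < a\<close>, a column of \<open>A\<close> was padded, and the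
  product is zero. If \<open>e = a\<close>, the adjugate of \<open>A\<close> shows that \<open>f\<^sup>a\<close> annihilates the kernel of \<open>A\<close>.\<close>

lemma
  assumes J: "is_ideal J" and A: "lin e A" and N: "lin a N"
    and AN: "\<And>x. eqmod a J (A (N x)) (f \<star> x)" and "e \<le> a"
  shows rank_factor: "e < a \<Longrightarrow> f ^ a \<in> J"
    and kernel_factor: "e = a \<Longrightarrow> eqmod a J (A x) 0 \<Longrightarrow> eqmod a J (f ^ a \<star> x) 0"
proof -
  define A' where "A' = mat a a (\<lambda>(i,j). if j < e then A (stdvec j) i else 0)"
  define N' where "N' = mat a a (\<lambda>(i,j). if i < e then N (stdvec j) i else 0)"
  have c: "A' \<in> carrier_mat a a" "N' \<in> carrier_mat a a" unfolding A'_def N'_def by auto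
  have ent: "(A' * N') $$ (i,j) = A (N (stdvec j)) i" if ij: "i < a" "j < a" for i j
  proof -
    have "(A' * N') $$ (i,j) = (\<Sum>l<a. A' $$ (i,l) * N' $$ (l,j))"
      using ij c by (auto simp: scalar_prod_def lessThan_atLeast0)
    also have "\<dots> = (\<Sum>l<a. if l < e then A (stdvec l) i * N (stdvec j) l else 0)"
      using ij by (intro sum.cong) (auto simp: A'_def N'_def)
    also have "\<dots> = (\<Sum>l<e. A (stdvec l) i * N (stdvec j) l)"
      using \<open>e \<le> a\<close> by (intro sum.mono_neutral_cong_right) auto
    also have "\<dots> = A (N (stdvec j)) i"
      unfolding lin_expand[OF A, of "N (stdvec j)"] by (simp add: sum_vec_apply vec_apply mult.commute)
    finally show ?thesis .
  qed
  have "det (A' * N') - det (f \<cdot>\<^sub>m 1\<^sub>m a) \<in> J"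
  proof (rule det_diff_in_ideal[OF J])
    fix i j assume "i < a" "j < a"
    then show "(A' * N') $$ (i,j) - (f \<cdot>\<^sub>m 1\<^sub>m a) $$ (i,j) \<in> J"
      using AN[of "stdvec j"] ent[of i j] by (auto simp: eqmod_def vec_apply stdvec_def)
  qed (use c in auto)
  then have d: "det A' * det N' - f ^ a \<in> J"
    using det_mult[OF c] by simp
  show "f ^ a \<in> J" if "e < a"
  proof -
    have "det A' = (\<Sum>i<a. A' $$ (i,a-1) * cofactor A' i (a-1))"
      using that by (intro laplace_expansion_column[OF c(1)]) auto
    also have "\<dots> = 0" using that by (intro sum.neutral) (auto simp: A'_def)
    finally show ?thesis using d ideal_uminus[OF J] by fastforce
  qed
  assume ea: "e = a" and Ax: "eqmod a J (A x) 0"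
  have "f ^ a * x k \<in> J" if k: "k < a" for k
  proof -
    have "(\<Sum>i<a. adj_mat A' $$ (k,i) * A x i)
        = (\<Sum>i<a. \<Sum>j<a. adj_mat A' $$ (k,i) * A' $$ (i,j) * x j)"
      unfolding lin_expand[OF A, of x]
      by (auto simp: sum_vec_apply vec_apply sum_distrib_left ea A'_def intro!: sum.cong)
    also have "\<dots> = (\<Sum>j<a. (\<Sum>i<a. adj_mat A' $$ (k,i) * A' $$ (i,j)) * x j)"
      by (subst sum.swap) (simp add: sum_distrib_right)
    also have "\<dots> = (\<Sum>j<a. if k = j then det A' * x j else 0)"
      using adj_mat_sums(1)[OF c(1) k] by (intro sum.cong) auto
    also have "\<dots> = det A' * x k" using k by simp
    finally have "det A' * x k = (\<Sum>i<a. adj_mat A' $$ (k,i) * A x i)" by simp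
    then have "det A' * x k \<in> J"
      using Ax J by (auto simp: eqmod_def vec_apply intro!: ideal_sum ideal_mult_left)
    then have "det N' * (det A' * x k) - (det A' * det N' - f ^ a) * x k \<in> J"
      by (rule ideal_diff[OF J ideal_mult_left[OF J] ideal_mult_right[OF J d]])
    then show ?thesis by (simp add: algebra_simps)
  qed
  then show "eqmod a J (f ^ a \<star> x) 0" using J by (simp add: eqmod_def vec_apply)
qed

lemma retract_rank_le:
  assumes "is_ideal J" "1 \<notin> J" "lin n U" "lin n' V" "\<And>x. eqmod n J (V (U x)) x"
  shows "n \<le> n'"
  using rank_factor[of J n' V n U 1] assms by (fastforce simp: scl_one)

text \<open>The local ring is the quotient by \<open>J0\<close>, and \<open>m\<close> is the preimage of its maximal ideal.\<close>

locale local_quotient =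
  fixes J0 m :: "'r::comm_ring_1 set"
  assumes J0: "is_ideal J0" and m: "is_ideal m" and J0_m: "J0 \<subseteq> m" and one_m: "1 \<notin> m"
    and unit: "x \<notin> m \<Longrightarrow> \<exists>y. x * y - 1 \<in> J0"
begin

lemma eqmod_m: "eqmod n J0 x y \<Longrightarrow> eqmod n m x y"
  using eqmod_mono J0_m m by blast

text \<open>The determinant is congruent to 1, hence a unit of the local ring, and the adjugate gives the inverse.
  This takes the place of Nakayama's lemma.\<close>

lemma near_identity_invertible:
  assumes W: "lin n W" and near: "\<And>x. eqmod n m (W x) x"
  shows "\<exists>W'. lin n W' \<and> (\<forall>x. eqmod n J0 (W (W' x)) x \<and> eqmod n J0 (W' (W x)) x)"
proof -
  define w where "w = mat n n (\<lambda>(i,j). W (stdvec j) i)"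
  have c: "w \<in> carrier_mat n n" unfolding w_def by auto
  have "W (stdvec j) i - (if i = j then 1 else 0) \<in> m" if "i < n" for i j
    using near[of "stdvec j"] that by (simp add: eqmod_def vec_apply stdvec_def)
  then have "det w - det (1\<^sub>m n) \<in> m"
    by (intro det_diff_in_ideal[OF m c]) (simp_all add: w_def)
  then have "det w \<notin> m" using one_m ideal_diff[OF m, of "det w" "det w - 1"] by auto
  then obtain u where u: "det w * u - 1 \<in> J0" using unit by blast
  define W' where "W' = (\<lambda>x i. u * (\<Sum>j<n. adj_mat w $$ (i,j) * x j))"
  have lW': "lin n W'" unfolding lin_def W'_def
    by (auto simp: fun_eq_iff vec_apply algebra_simps sum.distrib sum_distrib_left)
  have Wx: "W x i = (\<Sum>j<n. w $$ (i,j) * x j)" if "i < n" for x i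
    unfolding lin_expand[OF W, of x] using that by (auto simp: sum_vec_apply vec_apply w_def mult.commute)
  have 1: "W (W' x) i = det w * u * x i" if "i < n" for x i
  proof -
    have "W (W' x) i = (\<Sum>j<n. \<Sum>l<n. w $$ (i,j) * adj_mat w $$ (j,l) * (u * x l))"
      by (auto simp: Wx[OF that] W'_def sum_distrib_left algebra_simps)
    also have "\<dots> = (\<Sum>l<n. (\<Sum>j<n. w $$ (i,j) * adj_mat w $$ (j,l)) * (u * x l))"
      by (subst sum.swap) (simp add: sum_distrib_right)
    also have "\<dots> = (\<Sum>l<n. if i = l then det w * u * x l else 0)"
      using adj_mat_sums(2)[OF c that] by (intro sum.cong) (auto simp: mult.assoc)
    finally show ?thesis using that by simp
  qed
  have 2: "W' (W x) i = det w * u * x i" if "i < n" for x i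
  proof -
    have "W' (W x) i = (\<Sum>j<n. \<Sum>l<n. adj_mat w $$ (i,j) * w $$ (j,l) * (u * x l))"
      unfolding W'_def by (auto simp: Wx sum_distrib_left algebra_simps intro!: sum.cong)
    also have "\<dots> = (\<Sum>l<n. (\<Sum>j<n. adj_mat w $$ (i,j) * w $$ (j,l)) * (u * x l))"
      by (subst sum.swap) (simp add: sum_distrib_right)
    also have "\<dots> = (\<Sum>l<n. if i = l then det w * u * x l else 0)"
      using adj_mat_sums(1)[OF c that] by (intro sum.cong) (auto simp: mult.assoc)
    finally show ?thesis using that by simp
  qed
  have 3: "det w * u * c - c \<in> J0" for c
    using ideal_mult_right[OF J0 u, of c] by (simp add: algebra_simps)
  have "eqmod n J0 (W (W' x)) x \<and> eqmod n J0 (W' (W x)) x" for x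
    using J0 3 by (simp add: eqmod_def vec_apply 1 2)
  then show ?thesis using lW' by blast
qed

lemma section_exists:
  assumes t: "lin n t" and surj: "\<And>y. \<exists>x. eqmod k m (t x) y"
  shows "\<exists>s. lin k s \<and> (\<forall>y. eqmod k J0 (t (s y)) y)"
proof -
  have "\<exists>s. lin k s \<and> (\<forall>y. eqmod k m (t (s y)) y)"
  proof (rule lin_choose)
    show "eqmod k m (t 0) x" if "\<And>i. i < k \<Longrightarrow> x i = 0" for x
      using that m by (simp add: lin_zero[OF t] eqmod_def vec_apply ideal_zero)
  qed (auto simp: lin_add[OF t] lin_scl[OF t] intro: eqmod_add eqmod_scl surj)
  then obtain s where s: "lin k s" "\<And>y. eqmod k m (t (s y)) y" by blast
  obtain W where "lin k W" "\<And>x. eqmod k J0 (t (s (W x))) x"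
    using near_identity_invertible[OF lin_comp[OF s(1) t]] s(2) by blast
  then show ?thesis using lin_comp[OF _ s(1)] by blast
qed

text \<open>The image of \<open>F\<close> is \<open>K\<close> up to vectors with entries in \<open>J0\<close>.\<close>

definition generates :: "nat \<Rightarrow> (nat \<Rightarrow> 'r) set \<Rightarrow> nat \<Rightarrow> ((nat \<Rightarrow> 'r) \<Rightarrow> nat \<Rightarrow> 'r) \<Rightarrow> bool" where
  "generates n K k F \<longleftrightarrow> lin k F \<and> (\<forall>y. F y \<in> K) \<and> (\<forall>x\<in>K. \<exists>y. eqmod n J0 x (F y))"

lemma generatesD:
  assumes "generates n K k F"
  shows "lin k F" and "F y \<in> K" and "x \<in> K \<Longrightarrow> \<exists>y. eqmod n J0 x (F y)"
  using assms by (simp_all add: generates_def)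

definition insert_zero :: "nat \<Rightarrow> (nat \<Rightarrow> 'r) \<Rightarrow> nat \<Rightarrow> 'r" where
  "insert_zero j z i = (if i < j then z i else if i = j then 0 else z (i - 1))"

lemma lin_insert_zero: "lin (Suc k) F \<Longrightarrow> j \<le> k \<Longrightarrow> lin k (\<lambda>z. F (insert_zero j z))"
proof -
  assume F: "lin (Suc k) F" and j: "j \<le> k"
  have "insert_zero j (x + y) = insert_zero j x + insert_zero j y"
       "insert_zero j (c \<star> x) = c \<star> insert_zero j x" for x y c
    by (auto simp: insert_zero_def vec_apply fun_eq_iff)
  moreover have "F (insert_zero j x) = 0" if "\<And>i. i < k \<Longrightarrow> x i = 0" for x
    by (rule lin_vanish[OF F]) (use that j in \<open>auto simp: insert_zero_def vec_apply\<close>)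
  ultimately show ?thesis
    unfolding lin_def[of k] by (auto simp: lin_add[OF F] lin_scl[OF F])
qed

text \<open>Take the least number of generators. If a relation had a unit as coefficient of the \<open>j\<close>-th generator, that
  generator could be dropped: subtracting a multiple of the relation clears the \<open>j\<close>-th coefficient.\<close>

lemma minimal_generators:
  assumes "generates n K k0 F0"
  shows "\<exists>k F. generates n K k F \<and> (\<forall>y. eqmod n J0 (F y) 0 \<longrightarrow> eqmod k m y 0)"
proof -
  define k where "k = (LEAST k. \<exists>F. generates n K k F)"
  have "\<exists>F. generates n K k F" unfolding k_def by (rule LeastI) (use assms in blast)
  then obtain F where F: "generates n K k F" by blast
  then have lF: "lin k F" by (rule generatesD(1))
  have "eqmod k m y 0" if y: "eqmod n J0 (F y) 0" for y
  proof (rule ccontr)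
    assume "\<not> eqmod k m y 0"
    then obtain j where j: "j < k" "y j \<notin> m" using m unfolding eqmod_def vec_apply by auto
    then obtain u where u: "y j * u - 1 \<in> J0" using unit by blast
    obtain k' where k': "k = Suc k'" using j by (cases k) auto
    let ?F = "\<lambda>z. F (insert_zero j z)"
    have "\<exists>z. eqmod n J0 x (?F z)" if "x \<in> K" for x
    proof -
      obtain w where w: "eqmod n J0 x (F w)" using generatesD(3)[OF F \<open>x \<in> K\<close>] by auto
      define w' where "w' = w - (w j * u) \<star> y"
      define z where "z = (\<lambda>i. if i < j then w' i else w' (Suc i))"
      have "w' j = - (w j * (y j * u - 1))" unfolding w'_def by (simp add: vec_apply algebra_simps)
      then have "w' j \<in> J0" using ideal_uminus[OF J0 ideal_mult_left[OF J0 u]] by metis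
      then have "eqmod k J0 w' (insert_zero j z)"
        using J0 by (auto simp: eqmod_def vec_apply insert_zero_def z_def ideal_zero)
      then have 1: "eqmod n J0 (F w') (?F z)" using eqmod_lin[OF lF] by blast
      have "eqmod n J0 (F w - (w j * u) \<star> F y) (F w - 0)"
        by (rule eqmod_diff[OF eqmod_refl[OF J0] eqmod_0_scl[OF y]])
      then have "eqmod n J0 (F w') (F w)"
        unfolding w'_def by (simp add: lin_diff[OF lF] lin_scl[OF lF])
      from eqmod_trans[OF w eqmod_sym[OF this]] show ?thesis using eqmod_trans[OF _ 1] by blast
    qed
    then have "generates n K k' ?F"
      using generatesD(2)[OF F] lin_insert_zero[of k' F j] lF j k' by (simp add: generates_def)
    then have "k \<le> k'" unfolding k_def by (intro Least_le) blast
    then show False using k' by simp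
  qed
  then show ?thesis using F by blast
qed

text \<open>Elimination over the residue field: if the last equation has a unit coefficient at \<open>j\<close>, its solutions are
  parametrized by the other coordinates.\<close>

lemma nontrivial_solution:
  assumes "lin b Y" "n < b"
  shows "\<exists>x. \<not> eqmod b m x 0 \<and> eqmod n m (Y x) 0"
  using assms
proof (induction n arbitrary: b Y)
  case 0
  then have "\<not> eqmod b m (stdvec 0) 0" using one_m by (auto simp: eqmod_def vec_apply stdvec_def)
  then show ?case using m by (auto simp: eqmod_def vec_apply)
next
  case (Suc n)
  obtain b' where b': "b = Suc b'" using Suc.prems by (cases b) auto
  have step: "eqmod (Suc n) m (Y x) 0" if "eqmod n m (Y x) 0" "Y x n \<in> m" for x
    using that by (auto simp: eqmod_def vec_apply less_Suc_eq)
  show ?case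
  proof (cases "\<forall>j<b. Y (stdvec j) n \<in> m")
    case True
    obtain x where x: "\<not> eqmod b m x 0" "eqmod n m (Y x) 0"
      using Suc.IH[OF Suc.prems(1)] Suc.prems(2) by auto
    have "Y x n \<in> m" unfolding lin_expand[OF Suc.prems(1), of x]
      using True m by (auto simp: sum_vec_apply vec_apply intro!: ideal_sum ideal_mult_left)
    then show ?thesis using x step by blast
  next
    case False
    then obtain j where j: "j < b" "Y (stdvec j) n \<notin> m" by blast
    define g where "g = Y (stdvec j) n"
    \<comment> \<open>Cross-multiplied, so that the last equation holds exactly and no inverse of \<open>g\<close> occurs.\<close>
    define ps where "ps = (\<lambda>z. g \<star> insert_zero j z - (Y (insert_zero j z) n) \<star> stdvec j)"
    have lz: "lin b' (\<lambda>z. F (insert_zero j z))" if "lin b F" for F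
      using lin_insert_zero[of b' F j] that j b' by simp
    have Yp: "Y (ps z) = g \<star> Y (insert_zero j z) - (Y (insert_zero j z) n) \<star> Y (stdvec j)" for z
      unfolding ps_def by (simp add: lin_diff[OF Suc.prems(1)] lin_scl[OF Suc.prems(1)])
    have "lin b' (\<lambda>z. Y (ps z))"
      unfolding Yp using lz[OF Suc.prems(1)] unfolding lin_def
      by (simp add: fun_eq_iff vec_apply algebra_simps)
    from Suc.IH[OF this] obtain z where z: "\<not> eqmod b' m z 0" "eqmod n m (Y (ps z)) 0"
      using Suc.prems b' by auto
    obtain i where i: "i < b'" "z i \<notin> m" using z m unfolding eqmod_def vec_apply by auto
    have prime: "g * c \<notin> m" if "c \<notin> m" for c
    proof
      assume a: "g * c \<in> m"
      obtain u where "g * u - 1 \<in> J0" using unit j unfolding g_def by blast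
      then have "u * (g * c) - (g * u - 1) * c \<in> m"
        using J0_m by (intro ideal_diff[OF m ideal_mult_left[OF m a] ideal_mult_right[OF m]]) auto
      then show False using that by (simp add: algebra_simps)
    qed
    let ?i = "if i < j then i else Suc i"
    have "ps z ?i = g * z i" unfolding ps_def by (auto simp: insert_zero_def vec_apply stdvec_def)
    then have "\<not> eqmod b m (ps z) 0" using prime[OF i(2)] i b' j
      by (auto simp: eqmod_def vec_apply split: if_splits intro!: exI[of _ ?i])
    moreover have "Y (ps z) n = 0" unfolding Yp g_def by (simp add: vec_apply)
    ultimately show ?thesis using step[OF z(2)] m by (auto simp: ideal_zero)
  qed
qed

text \<open>A split surjection onto \<open>R\<^sup>k\<close> has a free kernel of rank \<open>n - k\<close>. The kernel is the image of \<open>1 - s t\<close>. If \<open>P\<close>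
  maps minimal generators onto it, a lift \<open>q\<close> of \<open>1 - s t\<close> along \<open>P\<close> satisfies \<open>P q P = P\<close>, so \<open>q P\<close> is the identity modulo \<open>m\<close>
  by minimality, and \<open>q\<close> can be corrected to a left inverse of \<open>P\<close>. The rank follows from the resulting isomorphism.\<close>

lemma kernel_of_split_map_free:
  assumes t: "lin n t" and s: "lin k s" and ts: "\<And>y. eqmod k J0 (t (s y)) y"
  obtains r P q where "n = r + k" "lin r P" "lin n q" "\<And>y. eqmod r J0 (q (P y)) y"
    "\<And>x. eqmod n J0 (P (q x) + s (t x)) x" "\<And>y. eqmod k J0 (t (P y)) 0" "\<And>y. eqmod r J0 (q (s y)) 0"
proof -
  define K where "K = {x. eqmod k J0 (t x) 0}"
  define F0 where "F0 = (\<lambda>x. (\<lambda>i. if i < n then x i else 0) - s (t x))"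
  have F0: "eqmod n J0 (F0 x) (x - s (t x))" for x
    unfolding F0_def using J0 by (auto simp: eqmod_def vec_apply ideal_zero)
  have lF0: "lin n F0" unfolding F0_def
    by (intro lin_minus_map lin_id_trunc lin_comp[OF lin_comp[OF lin_id_trunc t] s] lin_comp[OF t s])
  have ext_n: "eqmod n J0 x (x' :: nat \<Rightarrow> 'r) \<Longrightarrow> eqmod k J0 (t x) (t x')" for x x'
    using eqmod_lin[OF t] .
  have F0K: "F0 x \<in> K" for x
  proof -
    have "eqmod k J0 (t (F0 x)) (t (x - s (t x)))" by (rule ext_n[OF F0])
    also have "t (x - s (t x)) = t x - t (s (t x))" by (simp add: lin_diff[OF t])
    also have "eqmod k J0 \<dots> (t x - t x)" by (rule eqmod_diff[OF eqmod_refl[OF J0] ts])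
    finally show ?thesis unfolding K_def by simp
  qed
  have "\<exists>y. eqmod n J0 x (F0 y)" if "x \<in> K" for x
  proof -
    have "eqmod n J0 (s (t x)) 0" using that eqmod_lin_0[OF s] unfolding K_def by blast
    then have "eqmod n J0 (x - s (t x)) (x - 0)" by (rule eqmod_diff[OF eqmod_refl[OF J0]])
    then have "eqmod n J0 (F0 x) x" using eqmod_trans[OF F0] by simp
    then show ?thesis using eqmod_sym by blast
  qed
  then have "generates n K n F0" using lF0 F0K unfolding generates_def by blast
  from minimal_generators[OF this] obtain r P where
    gen: "generates n K r P" and min: "\<And>y. eqmod n J0 (P y) 0 \<Longrightarrow> eqmod r m y 0" by blast
  then have P: "lin r P" and tP: "\<And>y. eqmod k J0 (t (P y)) 0"
    and Psurj: "\<And>x. eqmod k J0 (t x) 0 \<Longrightarrow> \<exists>y. eqmod n J0 x (P y)"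
    unfolding generates_def K_def by auto
  have "\<exists>q. lin n q \<and> (\<forall>x. eqmod n J0 (P (q x)) (x - s (t x)))"
  proof (rule lin_choose)
    show "eqmod n J0 (P 0) (x - s (t x))" if "\<And>i. i < n \<Longrightarrow> x i = 0" for x
    proof -
      have "t x = 0" by (rule lin_vanish[OF t that])
      then show ?thesis using that J0 by (simp add: lin_zero[OF P] lin_zero[OF s] eqmod_def vec_apply ideal_zero)
    qed
    show "\<exists>y. eqmod n J0 (P y) (stdvec j - s (t (stdvec j)))" for j
    proof -
      obtain y where "eqmod n J0 (F0 (stdvec j)) (P y)"
        using Psurj F0K[of "stdvec j"] unfolding K_def by blast
      from eqmod_trans[OF eqmod_sym[OF this] F0] show ?thesis by blast
    qed
  next
    fix x y x' y' assume "eqmod n J0 (P y) (x - s (t x))" "eqmod n J0 (P y') (x' - s (t x'))"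
    from eqmod_add[OF this] show "eqmod n J0 (P (y + y')) (x + x' - s (t (x + x')))"
      by (simp add: lin_add[OF P] lin_add[OF s] lin_add[OF t] algebra_simps)
  next
    fix c x y assume "eqmod n J0 (P y) (x - s (t x))"
    from eqmod_scl[OF this, of c] show "eqmod n J0 (P (c \<star> y)) (c \<star> x - s (t (c \<star> x)))"
      by (simp add: lin_scl[OF P] lin_scl[OF s] lin_scl[OF t] scl_diff)
  qed
  then obtain q0 where q0: "lin n q0" "\<And>x. eqmod n J0 (P (q0 x)) (x - s (t x))" by blast
  have Pq0P: "eqmod n J0 (P (q0 (P y))) (P y)" for y
  proof -
    have "eqmod n J0 (P (q0 (P y))) (P y - s (t (P y)))" by (rule q0(2))
    also have "eqmod n J0 \<dots> (P y - 0)" by (rule eqmod_diff[OF eqmod_refl[OF J0] eqmod_lin_0[OF s tP]])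
    finally show ?thesis by simp
  qed
  have "eqmod r m (q0 (P y)) y" for y
    
    using min[of "q0 (P y) - y"] Pq0P[of y] eqmod_diff_iff[of n J0 "P (q0 (P y))" "P y"]
      eqmod_diff_iff[of r m "q0 (P y)" y] by (simp add: lin_diff[OF P])
  from near_identity_invertible[OF lin_comp[OF P q0(1)] this]
  obtain W where W: "lin r W" "\<And>x. eqmod r J0 (q0 (P (W x))) x" "\<And>x. eqmod r J0 (W (q0 (P x))) x"
    by blast
  have PW: "eqmod n J0 (P (W x)) (P x)" for x
  proof -
    have "eqmod n J0 (P (W x)) (P (q0 (P (W x))))" by (rule eqmod_sym[OF Pq0P])
    also have "eqmod n J0 \<dots> (P x)" by (rule eqmod_lin[OF P W(2)])
    finally show ?thesis .
  qed
  define q where "q = (\<lambda>x. W (q0 x))"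
  have q: "lin n q" unfolding q_def by (rule lin_comp[OF q0(1) W(1)])
  have qP: "eqmod r J0 (q (P y)) y" for y unfolding q_def by (rule W(3))
  have Pq: "eqmod n J0 (P (q x)) (x - s (t x))" for x
    unfolding q_def by (rule eqmod_trans[OF PW q0(2)])
  then have dec: "eqmod n J0 (P (q x) + s (t x)) x" for x
    using eqmod_add[OF Pq eqmod_refl[OF J0], of x "s (t x)"] by simp
  have qs: "eqmod r J0 (q (s y)) 0" for y
  proof -
    have "eqmod n J0 (P (q (s y))) (s y - s (t (s y)))" by (rule Pq)
    also have "eqmod n J0 \<dots> (s y - s y)" by (rule eqmod_diff[OF eqmod_refl[OF J0] eqmod_lin[OF s ts]])
    finally have "eqmod r J0 (q (P (q (s y)))) 0" by (intro eqmod_lin_0[OF q]) simp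
    then show ?thesis by (rule eqmod_trans[OF eqmod_sym[OF qP]])
  qed
  define A where "A = (\<lambda>x i. if i < r then q x i else t x (i - r))"
  define B where "B = (\<lambda>w. P w + s (\<lambda>i. w (i + r)))"
  have lA: "lin n A"
    unfolding lin_def A_def fun_eq_iff
    by (auto simp: vec_apply lin_add[OF q] lin_add[OF t] lin_scl[OF q] lin_scl[OF t] lin_vanish[OF q] lin_vanish[OF t])
  have shift: "(\<lambda>i. (x + y) (i + r)) = (\<lambda>i. x (i + r)) + (\<lambda>i. y (i + r))"
    "(\<lambda>i. (c \<star> x) (i + r)) = c \<star> (\<lambda>i. x (i + r))" for x y :: "nat \<Rightarrow> 'r" and c
    by (auto simp: vec_apply)
  have lB: "lin (r + k) B"
    unfolding lin_def B_def
  proof (intro conjI allI impI)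
    fix x :: "nat \<Rightarrow> 'r" assume "\<forall>i<r + k. x i = 0"
    then have "P x = 0" "s (\<lambda>i. x (i + r)) = 0"
      by (simp_all add: lin_vanish[OF P] lin_vanish[OF s])
    then show "P x + s (\<lambda>i. x (i + r)) = 0" by simp
  qed (simp_all only: shift lin_add[OF P] lin_add[OF s] lin_scl[OF P] lin_scl[OF s] scl_add add_ac)
  have "B (A x) = P (q x) + s (t x)" for x
    unfolding B_def by (intro arg_cong2[of _ _ _ _ "(+)"] lin_eq[OF P] lin_eq[OF s]) (auto simp: A_def)
  then have "n \<le> r + k"
    using retract_rank_le[OF J0 _ lA lB] dec J0_m one_m by auto
  moreover have "eqmod (r + k) J0 (A (B w)) w" for w
  proof -
    let ?w = "\<lambda>i. w (i + r)"
    have "eqmod r J0 (q (P w) + q (s ?w)) (w + 0)" using qP qs by (intro eqmod_add)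
    then have "q (B w) i - w i \<in> J0" if "i < r" for i
      using that by (simp add: eqmod_def B_def lin_add[OF q] vec_apply)
    moreover have "t (B w) (i - r) - w i \<in> J0" if "r \<le> i" "i < r + k" for i
    proof -
      have "eqmod k J0 (t (B w)) (0 + ?w)"
        unfolding B_def lin_add[OF t] using tP ts by (intro eqmod_add)
      then have "t (B w) j - w (j + r) \<in> J0" if "j < k" for j
        using that by (simp add: eqmod_def vec_apply)
      from this[of "i - r"] show ?thesis using that by simp
    qed
    ultimately show ?thesis using J0 by (simp add: eqmod_def A_def)
  qed
  then have "r + k \<le> n"
    using retract_rank_le[OF J0 _ lB lA] J0_m one_m by auto
  ultimately have "n = r + k" by simp
  then show thesis by (rule that[OF _ P q qP dec tP qs])
qed

section \<open>Minimal presentations and minimal resolutions\<close>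

text \<open>A pair \<open>(n, K)\<close> stands for the module \<open>R\<^sup>n/K\<close>. Isomorphisms are required to lift to isomorphisms of the free
  modules, as they do between minimal presentations.\<close>

definition presentation_iso :: "nat \<Rightarrow> (nat \<Rightarrow> 'r) set \<Rightarrow> nat \<Rightarrow> (nat \<Rightarrow> 'r) set \<Rightarrow> bool" where
  "presentation_iso n K n' K' \<longleftrightarrow> n = n' \<and>
     (\<exists>U V. lin n U \<and> lin n V \<and> (\<forall>x. eqmod n J0 (V (U x)) x) \<and> (\<forall>y. eqmod n J0 (U (V y)) y) \<and>
        (\<forall>x\<in>K. U x \<in> K') \<and> (\<forall>y\<in>K'. V y \<in> K))"

text \<open>Two minimal presentations of one module are isomorphic. The module is hidden in the relation \<open>\<rho> x y\<close>, which
  says that \<open>x\<close> and \<open>y\<close> represent the same element; so the two presentations may come from quite different descriptions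
  of the module. Lifts \<open>U\<close>, \<open>V\<close> of the identity in both directions are inverse modulo \<open>m\<close> by minimality.\<close>

lemma minimal_presentations_iso:
  assumes add: "\<And>x y x' y'. \<rho> x y \<Longrightarrow> \<rho> x' y' \<Longrightarrow> \<rho> (x + x') (y + y')"
    and scl: "\<And>c x y. \<rho> x y \<Longrightarrow> \<rho> (c \<star> x) (c \<star> y)"
    and null_left: "\<And>x. eqmod n J0 x 0 \<Longrightarrow> \<rho> x 0" and null_right: "\<And>y. eqmod n' J0 y 0 \<Longrightarrow> \<rho> 0 y"
    and total_left: "\<And>x. \<exists>y. \<rho> x y" and total_right: "\<And>y. \<exists>x. \<rho> x y"
    and min_left: "\<And>x. \<rho> x 0 \<Longrightarrow> eqmod n m x 0" and min_right: "\<And>y. \<rho> 0 y \<Longrightarrow> eqmod n' m y 0"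
  shows "presentation_iso n {x. \<rho> x 0} n' {y. \<rho> 0 y}"
proof -
  have diff: "\<rho> (x - x') (y - y')" if "\<rho> x y" "\<rho> x' y'" for x y x' y'
    using add[OF that(1) scl[OF that(2), of "-1"]] by (simp add: scl_minus_left scl_one)
  have "\<exists>U. lin n U \<and> (\<forall>x. \<rho> x (U x))"
    by (rule lin_choose[OF add scl null_left total_left]) (use J0 in \<open>simp_all add: eqmod_def vec_apply ideal_zero\<close>)
  then obtain U where U: "lin n U" "\<And>x. \<rho> x (U x)" by blast
  have "\<exists>V. lin n' V \<and> (\<forall>y. \<rho> (V y) y)"
    by (rule lin_choose[where P = "\<lambda>y x. \<rho> x y", OF add scl null_right total_right])
      (use J0 in \<open>simp_all add: eqmod_def vec_apply ideal_zero\<close>)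
  then obtain V where V: "lin n' V" "\<And>y. \<rho> (V y) y" by blast
  have VU: "\<rho> (V (U x) - x) 0" for x using diff[OF V(2) U(2), of "U x" x] by simp
  have UV: "\<rho> 0 (U (V y) - y)" for y using diff[OF U(2) V(2), of "V y" y] by simp
  have VUm: "eqmod n m (V (U x)) x" for x using min_left[OF VU] eqmod_diff_iff by blast
  have UVm: "eqmod n' m (U (V y)) y" for y using min_right[OF UV] eqmod_diff_iff by blast
  have nn: "n' = n"
    using retract_rank_le[OF m one_m U(1) V(1) VUm] retract_rank_le[OF m one_m V(1) U(1) UVm] by simp
  obtain W where W: "lin n W" "\<And>x. eqmod n J0 (V (U (W x))) x" "\<And>x. eqmod n J0 (W (V (U x))) x"
    using near_identity_invertible[OF lin_comp[OF U(1) V(1)[unfolded nn]] VUm] by blast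
  obtain W' where W': "lin n W'" "\<And>x. eqmod n J0 (U (V (W' x))) x"
    using near_identity_invertible[OF lin_comp[OF V(1) U(1)] UVm] nn by blast
  define V' where "V' = (\<lambda>y. W (V y))"
  have V': "lin n V'" unfolding V'_def by (rule lin_comp[OF V(1)[unfolded nn] W(1)])
  have V'U: "eqmod n J0 (V' (U x)) x" for x unfolding V'_def by (rule W(3))
  have UV': "eqmod n J0 (U (V' y)) y" for y
  proof -
    have "eqmod n J0 (V' y) (V' (U (V (W' y))))" by (rule eqmod_lin[OF V' eqmod_sym[OF W'(2)]])
    also have "eqmod n J0 \<dots> (V (W' y))" by (rule V'U)
    finally have "eqmod n J0 (U (V' y)) (U (V (W' y)))" by (rule eqmod_lin[OF U(1)])
    then show ?thesis by (rule eqmod_trans[OF _ W'(2)])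
  qed
  have UK: "\<rho> 0 (U x)" if "\<rho> x 0" for x
    using diff[OF U(2) that, of x] by simp
  have VK: "\<rho> (V' y) 0" if "\<rho> 0 y" for y
  proof -
    let ?v = "V y"
    have "\<rho> ?v 0" using diff[OF V(2) that, of y] by simp
    \<comment> \<open>\<open>V \<circ> U\<close> is the identity modulo the kernel, so its inverse \<open>W\<close> preserves the kernel.\<close>
    moreover have "\<rho> (W ?v - ?v) 0"
    proof -
      have "\<rho> (V (U (W ?v)) - ?v) 0"
        using W(2) eqmod_diff_iff null_left by blast
      from diff[OF this VU[of "W ?v"]] show ?thesis by simp
    qed
    ultimately show ?thesis unfolding V'_def using add[of "W ?v - ?v" 0 ?v 0] by simp
  qed
  show ?thesis unfolding presentation_iso_def using nn U(1) V' V'U UV' UK VK by blast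
qed

text \<open>A minimal exact complex of free modules of ranks \<open>n\<close> over the quotient by \<open>J\<close>. Here \<open>D i\<close> goes from degree
  \<open>i + 1\<close> to degree \<open>i\<close>.\<close>

definition minimal_exact :: "'r set \<Rightarrow> (nat \<Rightarrow> nat) \<Rightarrow> (nat \<Rightarrow> (nat \<Rightarrow> 'r) \<Rightarrow> nat \<Rightarrow> 'r) \<Rightarrow> bool" where
  "minimal_exact J n D \<longleftrightarrow>
     (\<forall>i. lin (n (Suc i)) (D i)) \<and> (\<forall>i x. eqmod (n i) m (D i x) 0) \<and>
     (\<forall>i x. eqmod (n i) J (D i (D (Suc i) x)) 0) \<and>
     (\<forall>i x. eqmod (n i) J (D i x) 0 \<longrightarrow> (\<exists>y. eqmod (n (Suc i)) J x (D (Suc i) y)))"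

lemma minimal_exactD:
  assumes "minimal_exact J n D"
  shows "lin (n (Suc i)) (D i)" "eqmod (n i) m (D i x) 0" "eqmod (n i) J (D i (D (Suc i) x)) 0"
    "eqmod (n i) J (D i x) 0 \<Longrightarrow> \<exists>y. eqmod (n (Suc i)) J x (D (Suc i) y)"
  using assms by (simp_all add: minimal_exact_def)

lemma minimal_exact_kernel:
  assumes "minimal_exact J n D"
  shows "eqmod (n i) J (D i x) 0 \<longleftrightarrow> (\<exists>y. eqmod (n (Suc i)) J x (D (Suc i) y))"
proof
  assume "\<exists>y. eqmod (n (Suc i)) J x (D (Suc i) y)"
  then obtain y where "eqmod (n (Suc i)) J x (D (Suc i) y)" by blast
  from eqmod_lin[OF minimal_exactD(1)[OF assms] this] show "eqmod (n i) J (D i x) 0"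
    using minimal_exactD(3)[OF assms] by (rule eqmod_trans)
qed (rule minimal_exactD(4)[OF assms])

lemma minimal_exact_kernel_minimal:
  assumes "minimal_exact J n D" "J \<subseteq> m" "eqmod (n i) J (D i x) 0"
  shows "eqmod (n (Suc i)) m x 0"
proof -
  obtain y where "eqmod (n (Suc i)) J x (D (Suc i) y)" using minimal_exactD(4)[OF assms(1,3)] by blast
  from eqmod_mono[OF this assms(2) m] show ?thesis
    using minimal_exactD(2)[OF assms(1)] by (rule eqmod_trans)
qed

lemma minimal_exact_shift: "minimal_exact J n D \<Longrightarrow> minimal_exact J (\<lambda>i. n (i + k)) (\<lambda>i. D (i + k))"
  by (simp add: minimal_exact_def)

text \<open>The isomorphism of the presented modules extends to all syzygies in turn: at each step the syzygies have
  minimal presentations by the next terms, and representing corresponding elements is the relation \<open>\<rho>\<close>.\<close>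

lemma minimal_resolution_ranks_unique:
  assumes D: "minimal_exact J n D" and D': "minimal_exact J n' D'" and J: "is_ideal J" "J0 \<subseteq> J" "J \<subseteq> m"
    and iso: "presentation_iso (n 0) {x. \<exists>y. eqmod (n 0) J x (D 0 y)} (n' 0) {x. \<exists>y. eqmod (n' 0) J x (D' 0 y)}"
  shows "n i = n' i"
proof -
  have "presentation_iso (n i) {x. \<exists>y. eqmod (n i) J x (D i y)} (n' i) {x. \<exists>y. eqmod (n' i) J x (D' i y)}"
  proof (induction i)
    case 0
    then show ?case by (rule iso)
  next
    case (Suc i)
    note lD = minimal_exactD(1)[OF D, of i] and lD' = minimal_exactD(1)[OF D', of i]
    have nn: "n' i = n i" using Suc by (simp add: presentation_iso_def)
    from Suc obtain U V where U: "lin (n i) U" and V: "lin (n i) V"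
      and VU: "\<And>x. eqmod (n i) J0 (V (U x)) x" and UV: "\<And>x. eqmod (n i) J0 (U (V x)) x"
      and Uk: "\<And>x y. eqmod (n i) J x (D i y) \<Longrightarrow> \<exists>z. eqmod (n i) J (U x) (D' i z)"
      and Vk: "\<And>x y. eqmod (n i) J x (D' i y) \<Longrightarrow> \<exists>z. eqmod (n i) J (V x) (D i z)"
      unfolding presentation_iso_def nn mem_Collect_eq by blast
    define \<rho> where "\<rho> = (\<lambda>x y. eqmod (n i) J (U (D i x)) (D' i y))"
    have VUJ: "eqmod (n i) J (V (U x)) x" and UVJ: "eqmod (n i) J (U (V x)) x" for x
      using eqmod_mono[OF VU] eqmod_mono[OF UV] J by auto
    have left: "\<rho> x 0 \<longleftrightarrow> eqmod (n i) J (D i x) 0" for x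
    proof
      assume "\<rho> x 0"
      then have "eqmod (n i) J (V (U (D i x))) 0"
        unfolding \<rho>_def lin_zero[OF lD'] by (rule eqmod_lin_0[OF V])
      then show "eqmod (n i) J (D i x) 0" using eqmod_0_trans[OF VUJ] by blast
    qed (simp add: \<rho>_def lin_zero[OF lD'] eqmod_lin_0[OF U])
    have right: "\<rho> 0 y \<longleftrightarrow> eqmod (n i) J (D' i y) 0" for y
      unfolding \<rho>_def lin_zero[OF lD] lin_zero[OF U] by (auto intro: eqmod_sym)
    have "presentation_iso (n (Suc i)) {x. \<rho> x 0} (n' (Suc i)) {y. \<rho> 0 y}"
    proof (rule minimal_presentations_iso)
      show "\<rho> (x + x') (y + y')" if "\<rho> x y" "\<rho> x' y'" for x y x' y'
        using that unfolding \<rho>_def lin_add[OF lD] lin_add[OF lD'] lin_add[OF U] by (rule eqmod_add)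
      show "\<rho> (c \<star> x) (c \<star> y)" if "\<rho> x y" for c x y
        using that unfolding \<rho>_def lin_scl[OF lD] lin_scl[OF lD'] lin_scl[OF U] by (rule eqmod_scl)
      show "\<rho> x 0" if "eqmod (n (Suc i)) J0 x 0" for x
        unfolding left by (rule eqmod_lin_0[OF lD eqmod_mono[OF that J(2,1)]])
      show "\<rho> 0 y" if "eqmod (n' (Suc i)) J0 y 0" for y
        unfolding right by (rule eqmod_lin_0[OF lD' eqmod_mono[OF that J(2,1)]])
      show "\<exists>y. \<rho> x y" for x unfolding \<rho>_def by (rule Uk[OF eqmod_refl[OF J(1)]])
      show "\<exists>x. \<rho> x y" for y
      proof -
        obtain x where "eqmod (n i) J (V (D' i y)) (D i x)" using Vk[OF eqmod_refl[OF J(1)]] by blast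
        from eqmod_lin[OF U eqmod_sym[OF this]] have "\<rho> x y"
          unfolding \<rho>_def by (rule eqmod_trans[OF _ UVJ])
        then show ?thesis by blast
      qed
      show "eqmod (n (Suc i)) m x 0" if "\<rho> x 0" for x
        using minimal_exact_kernel_minimal[OF D J(3)] that left by blast
      show "eqmod (n' (Suc i)) m y 0" if "\<rho> 0 y" for y
        using minimal_exact_kernel_minimal[OF D' J(3)] that right nn by metis
    qed
    moreover have "{x. \<rho> x 0} = {x. \<exists>y. eqmod (n (Suc i)) J x (D (Suc i) y)}"
      unfolding left minimal_exact_kernel[OF D] ..
    moreover have "{y. \<rho> 0 y} = {x. \<exists>y. eqmod (n' (Suc i)) J x (D' (Suc i) y)}"
      unfolding right nn[symmetric] minimal_exact_kernel[OF D'] ..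
    ultimately show ?case by simp
  qed
  then show ?thesis by (simp add: presentation_iso_def)
qed

text \<open>The submodule \<open>\<mm>K + J\<^sub>0R\<^sup>n\<close>.\<close>

definition max_times :: "nat \<Rightarrow> (nat \<Rightarrow> 'r) set \<Rightarrow> (nat \<Rightarrow> 'r) set" where
  "max_times n K = {v. \<forall>T. submod T \<and> (\<forall>x. eqmod n J0 x 0 \<longrightarrow> x \<in> T) \<and>
     (\<forall>c\<in>m. \<forall>k\<in>K. c \<star> k \<in> T) \<longrightarrow> v \<in> T}"

lemma submod_max_times: "submod (max_times n K)"
  unfolding submod_def[of "max_times n K"]
  by (simp add: max_times_def submod_zero submod_add submod_scl)

lemma max_times_null: "eqmod n J0 x 0 \<Longrightarrow> x \<in> max_times n K"
  and max_times_scl: "c \<in> m \<Longrightarrow> k \<in> K \<Longrightarrow> c \<star> k \<in> max_times n K"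
  unfolding max_times_def by auto

lemma max_times_cong: "eqmod n J0 x y \<Longrightarrow> y \<in> max_times n K \<Longrightarrow> x \<in> max_times n K"
  using submod_add[OF submod_max_times max_times_null[of n "x - y" K], of y] eqmod_diff_iff[of n J0 x y]
  by simp

lemma max_times_subset:
  assumes "submod T" "\<And>x. eqmod n J0 x 0 \<Longrightarrow> x \<in> T" "\<And>c k. c \<in> m \<Longrightarrow> k \<in> K \<Longrightarrow> c \<star> k \<in> T"
  shows "max_times n K \<subseteq> T"
  using assms by (auto simp: max_times_def)

lemma max_times_lin:
  assumes "lin k H" "\<And>j. j < k \<Longrightarrow> H (stdvec j) \<in> K" "eqmod k m x 0"
  shows "H x \<in> max_times n K"
  unfolding lin_expand[OF assms(1), of x]
  using assms(2,3) by (intro submod_sum[OF submod_max_times] max_times_scl) (auto simp: eqmod_def vec_apply)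

text \<open>The images of the first \<open>b\<close> basis vectors are linearly independent in \<open>K/\<mm>K\<close>. This certifies that \<open>K\<close> needs at
  least \<open>b\<close> generators and passes well from one level to the next. A map is used instead of a family since families
  are then concatenated by adding shifted maps.\<close>

definition independent_in :: "nat \<Rightarrow> (nat \<Rightarrow> 'r) set \<Rightarrow> nat \<Rightarrow> ((nat \<Rightarrow> 'r) \<Rightarrow> nat \<Rightarrow> 'r) \<Rightarrow> bool" where
  "independent_in n K b F \<longleftrightarrow> lin b F \<and> (\<forall>x. F x \<in> K) \<and> (\<forall>x. F x \<in> max_times n K \<longrightarrow> eqmod b m x 0)"

lemma independent_in_iso:
  assumes "presentation_iso n K n' K'" "independent_in n K b F"
  shows "\<exists>F'. independent_in n' K' b F'"
proof -
  from assms(1) obtain U V where nn: "n' = n" and U: "lin n U" and V: "lin n V"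
    and VU: "\<And>x. eqmod n J0 (V (U x)) x" and UK: "\<And>x. x \<in> K \<Longrightarrow> U x \<in> K'" and VK: "\<And>x. x \<in> K' \<Longrightarrow> V x \<in> K"
    unfolding presentation_iso_def by blast
  have F: "lin b F" "\<And>x. F x \<in> K" "\<And>x. F x \<in> max_times n K \<Longrightarrow> eqmod b m x 0"
    using assms(2) unfolding independent_in_def by blast+
  have "max_times n K' \<subseteq> {x. V x \<in> max_times n K}"
  proof (rule max_times_subset)
    show "submod {x. V x \<in> max_times n K}"
      using submod_max_times[of n K] unfolding submod_def
      by (simp add: lin_zero[OF V] lin_add[OF V] lin_scl[OF V])
  qed (auto simp: lin_scl[OF V] intro: max_times_null eqmod_lin_0[OF V] max_times_scl VK)
  then have "eqmod b m x 0" if "U (F x) \<in> max_times n K'" for x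
    using F(3)[OF max_times_cong[OF eqmod_sym[OF VU]]] that by blast
  then have "independent_in n' K' b (\<lambda>x. U (F x))"
    unfolding independent_in_def nn using lin_comp[OF F(1) U] UK F(2) by blast
  then show ?thesis by (intro exI)
qed

text \<open>Lifting \<open>F\<close> along generators gives a map that is injective over the residue field.\<close>

lemma independent_rank_le:
  assumes "independent_in n K b F" and D: "lin k D" "\<And>y. D y \<in> K" "\<And>x. x \<in> K \<Longrightarrow> \<exists>y. eqmod n J0 x (D y)"
  shows "b \<le> k"
proof (rule ccontr)
  assume "\<not> b \<le> k"
  have F: "lin b F" "\<And>x. F x \<in> K" "\<And>x. F x \<in> max_times n K \<Longrightarrow> eqmod b m x 0"
    using assms(1) unfolding independent_in_def by blast+
  have "\<exists>Y. lin b Y \<and> (\<forall>x. eqmod n J0 (F x) (D (Y x)))"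
  proof (rule lin_choose)
    show "eqmod n J0 (F x) (D 0)" if "\<And>i. i < b \<Longrightarrow> x i = 0" for x
      using lin_vanish[OF F(1) that] J0 by (simp add: lin_zero[OF D(1)])
    show "eqmod n J0 (F (x + x')) (D (y + y'))"
      if "eqmod n J0 (F x) (D y)" "eqmod n J0 (F x') (D y')" for x y x' y'
      unfolding lin_add[OF F(1)] lin_add[OF D(1)] using that by (rule eqmod_add)
    show "eqmod n J0 (F (c \<star> x)) (D (c \<star> y))" if "eqmod n J0 (F x) (D y)" for c x y
      unfolding lin_scl[OF F(1)] lin_scl[OF D(1)] using that by (rule eqmod_scl)
  qed (rule D(3)[OF F(2)])
  then obtain Y where Y: "lin b Y" "\<And>x. eqmod n J0 (F x) (D (Y x))" by blast
  obtain x where x: "\<not> eqmod b m x 0" "eqmod k m (Y x) 0"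
    using nontrivial_solution[OF Y(1), of k] \<open>\<not> b \<le> k\<close> by auto
  have "D (Y x) \<in> max_times n K" by (rule max_times_lin[OF D(1,2) x(2)])
  then have "F x \<in> max_times n K" by (rule max_times_cong[OF Y(2)])
  then show False using F(3) x(1) by blast
qed

end

text \<open>Finite generation, modulo \<open>J0\<close>, is stated by the minimality of the generated ideal.\<close>

locale noetherian_local_quotient = local_quotient J0 m for J0 m :: "'r::comm_ring_1 set" +
  assumes ideal_finitely_generated: "is_ideal I \<Longrightarrow> J0 \<subseteq> I \<Longrightarrow>
    \<exists>G. finite G \<and> G \<subseteq> I \<and> (\<forall>I'. is_ideal I' \<and> J0 \<subseteq> I' \<and> G \<subseteq> I' \<longrightarrow> I \<subseteq> I')"
begin

text \<open>Induction on the rank. The last coordinates of the elements of \<open>K\<close> form an ideal; elements of \<open>K\<close> over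
  generators of this ideal, together with generators of the elements with last coordinate zero, generate \<open>K\<close>.\<close>

lemma submodule_finitely_generated:
  assumes "submod K" "\<And>x. eqmod n J0 x 0 \<Longrightarrow> x \<in> K"
  shows "\<exists>G. finite G \<and> G \<subseteq> K \<and>
    (\<forall>T. submod T \<and> (\<forall>x. eqmod n J0 x 0 \<longrightarrow> x \<in> T) \<and> G \<subseteq> T \<longrightarrow> K \<subseteq> T)"
  using assms
proof (induction n arbitrary: K)
  case 0
  have "K \<subseteq> T" if "\<forall>x. eqmod 0 J0 x 0 \<longrightarrow> x \<in> T" for T
    using that J0 by (auto simp: eqmod_def)
  then show ?case by (intro exI[of _ "{}"]) auto
next
  case (Suc n)
  define tr where "tr = (\<lambda>x :: nat \<Rightarrow> 'r. x(n := 0))"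
  have tr: "tr 0 = 0" "tr (x + y) = tr x + tr y" "tr (c \<star> x) = c \<star> tr x" for x y c
    by (auto simp: tr_def fun_eq_iff vec_apply)
  have tr_null: "eqmod (Suc n) J0 (tr x) 0" if "eqmod n J0 x 0" for x
    using that by (auto simp: tr_def eqmod_def vec_apply less_Suc_eq ideal_zero)
  have tr_id: "tr x = x" if "x n = 0" for x using that by (auto simp: tr_def)
  have sub_tr: "submod {x. tr x \<in> T}" if "submod T" for T
    using that unfolding submod_def by (simp add: tr)
  obtain G1 where G1: "finite G1" "G1 \<subseteq> {x. tr x \<in> K}"
    and G1': "\<And>T. submod T \<Longrightarrow> (\<And>x. eqmod n J0 x 0 \<Longrightarrow> x \<in> T) \<Longrightarrow> G1 \<subseteq> T \<Longrightarrow> {x. tr x \<in> K} \<subseteq> T"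
    using Suc.IH[OF sub_tr[OF Suc.prems(1)]] tr_null Suc.prems(2) by (metis mem_Collect_eq)
  have lead_ideal: "is_ideal {x n |x. x \<in> T}" "J0 \<subseteq> {x n |x. x \<in> T}"
    if T: "submod T" "\<And>x. eqmod (Suc n) J0 x 0 \<Longrightarrow> x \<in> T" for T
  proof -
    show "is_ideal {x n |x. x \<in> T}"
      unfolding is_ideal_def
    proof (intro conjI ballI allI)
      show "0 \<in> {x n |x. x \<in> T}" using submod_zero[OF T(1)]
        by (intro CollectI exI[of _ "0 :: nat \<Rightarrow> 'r"]) (simp add: vec_apply)
      fix a assume "a \<in> {x n |x. x \<in> T}"
      then obtain x where x: "a = x n" "x \<in> T" by blast
      show "c * a \<in> {x n |x. x \<in> T}" for c
        using submod_scl[OF T(1) x(2), of c] x(1)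
        by (intro CollectI exI[of _ "c \<star> x"]) (simp add: vec_apply)
      fix b assume "b \<in> {x n |x. x \<in> T}"
      then obtain y where y: "b = y n" "y \<in> T" by blast
      show "a + b \<in> {x n |x. x \<in> T}"
        using submod_add[OF T(1) x(2) y(2)] x(1) y(1)
        by (intro CollectI exI[of _ "x + y"]) (simp add: vec_apply)
    qed
    show "J0 \<subseteq> {x n |x. x \<in> T}"
    proof
      fix a assume "a \<in> J0"
      then have "a \<star> stdvec n \<in> T" using T(2) eqmod_0_scl_in[OF J0] by blast
      moreover have "a = (a \<star> stdvec n) n" by (simp add: vec_apply stdvec_def)
      ultimately show "a \<in> {x n |x. x \<in> T}" by blast
    qed
  qed
  have "\<exists>A. finite A \<and> A \<subseteq> {x n |x. x \<in> K} \<and>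
      (\<forall>I. is_ideal I \<and> J0 \<subseteq> I \<and> A \<subseteq> I \<longrightarrow> {x n |x. x \<in> K} \<subseteq> I)"
    by (rule ideal_finitely_generated[OF lead_ideal[OF Suc.prems]])
  then obtain A where AA: "finite A \<and> A \<subseteq> {x n |x. x \<in> K} \<and>
      (\<forall>I. is_ideal I \<and> J0 \<subseteq> I \<and> A \<subseteq> I \<longrightarrow> {x n |x. x \<in> K} \<subseteq> I)" ..
  note A = AA[THEN conjunct1] AA[THEN conjunct2, THEN conjunct1]
  note A' = AA[THEN conjunct2, THEN conjunct2, rule_format, OF conjI[OF _ conjI]]
  have "\<forall>a\<in>A. \<exists>x. x \<in> K \<and> x n = a" using A(2) by blast
  from bchoice[OF this] obtain w where w: "\<forall>a\<in>A. w a \<in> K \<and> w a n = a" ..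
  define G where "G = w ` A \<union> tr ` G1"
  have GT: "K \<subseteq> T" if T: "submod T" "\<And>x. eqmod (Suc n) J0 x 0 \<Longrightarrow> x \<in> T" "G \<subseteq> T" for T
  proof
    fix x assume x: "x \<in> K"
    have "{x. tr x \<in> K} \<subseteq> {x. tr x \<in> T}"
      using T(3) by (intro G1' sub_tr T(1)) (auto simp: G_def intro: T(2) tr_null)
    then have zero: "y \<in> T" if "y \<in> K" "y n = 0" for y using that tr_id by (metis Collect_mono_iff)
    have KX: "submod (K \<inter> T)" using Suc.prems(1) T(1) unfolding submod_def by auto
    have "A \<subseteq> {x n |x. x \<in> K \<inter> T}"
    proof
      fix a assume a: "a \<in> A"
      then have "w a \<in> K \<inter> T" "a = w a n" using w T(3) unfolding G_def by auto
      then show "a \<in> {x n |x. x \<in> K \<inter> T}" by blast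
    qed
    then have "{x n |x. x \<in> K} \<subseteq> {x n |x. x \<in> K \<inter> T}"
      using lead_ideal[OF KX] Suc.prems(2) T(2) by (intro A') auto
    then obtain y where y: "y \<in> K" "y \<in> T" "y n = x n" using x by fastforce
    have "x - y \<in> T" using submod_diff[OF Suc.prems(1) x y(1)] y(3) by (intro zero) (auto simp: vec_apply)
    then show "x \<in> T" using submod_add[OF T(1) _ y(2), of "x - y"] by simp
  qed
  have "finite G" "G \<subseteq> K" using A(1) G1 w unfolding G_def by auto
  then show ?case by (intro exI[of _ G] conjI allI impI GT) simp_all
qed

lemma generates_exists:
  assumes K: "submod K" "\<And>x. eqmod n J0 x 0 \<Longrightarrow> x \<in> K"
  shows "\<exists>k F. generates n K k F"
proof -
  from submodule_finitely_generated[OF K] obtain G where GG: "finite G \<and> G \<subseteq> K \<and>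
    (\<forall>T. submod T \<and> (\<forall>x. eqmod n J0 x 0 \<longrightarrow> x \<in> T) \<and> G \<subseteq> T \<longrightarrow> K \<subseteq> T)" ..
  note G = GG[THEN conjunct1] GG[THEN conjunct2, THEN conjunct1]
  obtain k and g :: "nat \<Rightarrow> nat \<Rightarrow> 'r" where g: "G = g ` {i. i < k}"
    using finite_imp_nat_seg_image_inj_on[OF G(1)] by metis
  define F where "F = (\<lambda>x. \<Sum>j<k. x j \<star> g j)"
  have F: "lin k F" unfolding F_def by (rule linI_expand)
  have std: "F (stdvec j) = g j" if "j < k" for j
    unfolding F_def using that by (rule sum_stdvec)
  have "K \<subseteq> {x. \<exists>y. eqmod n J0 x (F y)}"
  proof (rule GG[THEN conjunct2, THEN conjunct2, rule_format], intro conjI allI impI)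
    show "submod {x. \<exists>y. eqmod n J0 x (F y)}"
      unfolding submod_def
    proof (intro conjI ballI allI)
      show "0 \<in> {x. \<exists>y. eqmod n J0 x (F y)}"
        using J0 by (intro CollectI exI[of _ 0]) (simp add: lin_zero[OF F])
      fix x assume "x \<in> {x. \<exists>y. eqmod n J0 x (F y)}"
      then obtain u where u: "eqmod n J0 x (F u)" by blast
      show "c \<star> x \<in> {x. \<exists>y. eqmod n J0 x (F y)}" for c
        using eqmod_scl[OF u, of c] by (intro CollectI exI[of _ "c \<star> u"]) (simp add: lin_scl[OF F])
      fix y assume "y \<in> {x. \<exists>y. eqmod n J0 x (F y)}"
      then obtain v where v: "eqmod n J0 y (F v)" by blast
      show "x + y \<in> {x. \<exists>y. eqmod n J0 x (F y)}"
        using eqmod_add[OF u v] by (intro CollectI exI[of _ "u + v"]) (simp add: lin_add[OF F])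
    qed
    show "x \<in> {x. \<exists>y. eqmod n J0 x (F y)}" if "eqmod n J0 x 0" for x
      using that by (intro CollectI exI[of _ 0]) (simp add: lin_zero[OF F])
    show "G \<subseteq> {x. \<exists>y. eqmod n J0 x (F y)}"
      unfolding g
    proof clarify
      fix j assume "j < k"
      then have "eqmod n J0 (g j) (F (stdvec j))" using std J0 by simp
      then show "\<exists>y. eqmod n J0 (g j) (F y)" by (intro exI)
    qed
  qed
  moreover have "F y \<in> K" for y
    unfolding F_def using G(2) g by (intro submod_sum[OF K(1)] submod_scl[OF K(1)]) auto
  ultimately show ?thesis using F unfolding generates_def by blast
qed

lemma minimal_resolution_exists:
  assumes K: "submod K" "\<And>x. eqmod N J0 x 0 \<Longrightarrow> x \<in> K" "\<And>x. x \<in> K \<Longrightarrow> eqmod N m x 0"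
  shows "\<exists>n D. n 0 = N \<and> minimal_exact J0 n D \<and> (\<forall>x. x \<in> K \<longleftrightarrow> (\<exists>y. eqmod N J0 x (D 0 y)))"
proof -
  define good where "good = (\<lambda>(a, K, k, F). generates a K k F \<and> submod K \<and>
    (\<forall>x. eqmod a J0 x 0 \<longrightarrow> x \<in> K) \<and> (\<forall>x\<in>K. eqmod a m x 0) \<and> (\<forall>y. eqmod a J0 (F y) 0 \<longrightarrow> eqmod k m y 0))"
  have ex: "\<exists>k F. good (a, K, k, F)"
    if K: "submod K" "\<And>x. eqmod a J0 x 0 \<Longrightarrow> x \<in> K" "\<And>x. x \<in> K \<Longrightarrow> eqmod a m x 0" for a K
  proof -
    obtain k0 F0 where "generates a K k0 F0" using generates_exists[OF K(1,2)] by blast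
    from minimal_generators[OF this] show ?thesis unfolding good_def using K by simp
  qed
  define succ :: "nat \<times> (nat \<Rightarrow> 'r) set \<times> nat \<times> ((nat \<Rightarrow> 'r) \<Rightarrow> nat \<Rightarrow> 'r)
      \<Rightarrow> nat \<times> (nat \<Rightarrow> 'r) set \<times> nat \<times> ((nat \<Rightarrow> 'r) \<Rightarrow> nat \<Rightarrow> 'r) \<Rightarrow> bool"
    where "succ = (\<lambda>(a, K, k, F) (a', K', k', F'). a' = k \<and> K' = {x. eqmod a J0 (F x) 0})"
  obtain k F where kF: "good (N, K, k, F)" using ex[OF K] by blast
  have step: "\<exists>q. good q \<and> succ p q" if "good p" for p
  proof -
    obtain a K k F where p: "p = (a, K, k, F)" by (cases p) auto
    have lF: "lin k F" using that unfolding p good_def generates_def by auto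
    have "\<exists>k' F'. good (k, {x. eqmod a J0 (F x) 0}, k', F')"
    proof (rule ex)
      show "submod {x. eqmod a J0 (F x) 0}"
        unfolding submod_def using J0
        by (auto simp: lin_zero[OF lF] lin_add[OF lF] lin_scl[OF lF] intro: eqmod_0_add eqmod_0_scl)
      show "x \<in> {x. eqmod a J0 (F x) 0}" if "eqmod k J0 x 0" for x using eqmod_lin_0[OF lF that] by simp
      show "eqmod k m x 0" if "x \<in> {x. eqmod a J0 (F x) 0}" for x
        using that \<open>good p\<close> unfolding p good_def by auto
    qed
    then show ?thesis unfolding p succ_def by auto
  qed
  have "\<exists>s. \<forall>i. (good (s i) \<and> (i = 0 \<longrightarrow> s i = (N, K, k, F))) \<and> succ (s i) (s (Suc i))"
    by (rule dependent_nat_choice) (use kF step in auto)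
  then obtain s where ss: "\<forall>i. (good (s i) \<and> (i = 0 \<longrightarrow> s i = (N, K, k, F))) \<and> succ (s i) (s (Suc i))" ..
  then have s0: "s 0 = (N, K, k, F)" by blast
  from ss have s: "good (s i)" "succ (s i) (s (Suc i))" for i by simp_all
  define n where "n = (\<lambda>i. fst (s i))"
  define D where "D = (\<lambda>i. snd (snd (snd (s i))))"
  define L where "L = (\<lambda>i. fst (snd (s i)))"
  have si: "s i = (n i, L i, n (Suc i), D i)" and L: "L (Suc i) = {x. eqmod (n i) J0 (D i x) 0}" for i
    using s(2)[of i] unfolding succ_def n_def D_def L_def by (auto split: prod.splits)
  have lD: "lin (n (Suc i)) (D i)" and DL: "D i y \<in> L i" and surj: "x \<in> L i \<Longrightarrow> \<exists>y. eqmod (n i) J0 x (D i y)"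
    and Lm: "x \<in> L i \<Longrightarrow> eqmod (n i) m x 0" and Ls: "submod (L i)" and Ln: "eqmod (n i) J0 x 0 \<Longrightarrow> x \<in> L i" for i x y
    using s(1)[of i] unfolding si good_def generates_def by auto
  have nK: "n 0 = N" "L 0 = K" using s0 unfolding n_def L_def by auto
  have "minimal_exact J0 n D"
    unfolding minimal_exact_def
  proof (intro conjI allI impI)
    show "eqmod (n i) J0 (D i (D (Suc i) x)) 0" for i x using DL[of "Suc i" x] unfolding L by simp
    show "\<exists>y. eqmod (n (Suc i)) J0 x (D (Suc i) y)" if "eqmod (n i) J0 (D i x) 0" for i x
      using surj[of x "Suc i"] that unfolding L by simp
  qed (rule lD Lm[OF DL])+
  moreover have "x \<in> K \<longleftrightarrow> (\<exists>y. eqmod N J0 x (D 0 y))" for x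
  proof
    assume "\<exists>y. eqmod N J0 x (D 0 y)"
    then obtain y where "eqmod N J0 (x - D 0 y) 0" using eqmod_diff_iff by blast
    then show "x \<in> K" using submod_add[OF K(1) K(2) DL[of 0 y, unfolded nK], of "x - D 0 y"] by simp
  qed (use surj[of x 0] nK in auto)
  ultimately show ?thesis using nK by blast
qed

end

section \<open>One step along a regular sequence\<close>

text \<open>The ideals \<open>J p\<close> are the preimages of the ideals generated by the first \<open>p\<close> members of a regular sequence.\<close>

locale ci_tower = local_quotient J0 m for J0 m :: "'r::comm_ring_1 set" +
  fixes J :: "nat \<Rightarrow> 'r set" and f :: "nat \<Rightarrow> 'r" and c :: nat
  assumes J_0: "J 0 = J0"
    and J_Suc: "p < c \<Longrightarrow> J (Suc p) = {x + f (Suc p) * y |x y. x \<in> J p}"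
    and regular: "p < c \<Longrightarrow> f (Suc p) * x \<in> J p \<Longrightarrow> x \<in> J p"
    and J_c: "J c \<subseteq> m"
begin

lemma J_step: "p < c \<Longrightarrow> x \<in> J p \<Longrightarrow> x + f (Suc p) * y \<in> J (Suc p)"
  using J_Suc by auto

lemma J_ideal: "p \<le> c \<Longrightarrow> is_ideal (J p)"
proof (induction p)
  case (Suc p)
  then have I: "is_ideal (J p)" and p: "p < c" by auto
  show ?case
    unfolding is_ideal_def
  proof (intro conjI ballI allI)
    show "0 \<in> J (Suc p)" using J_step[OF p ideal_zero[OF I], of 0] by simp
    fix x assume "x \<in> J (Suc p)"
    then obtain a u where x: "x = a + f (Suc p) * u" "a \<in> J p" using J_Suc[OF p] by auto
    show "k * x \<in> J (Suc p)" for k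
      using J_step[OF p ideal_mult_left[OF I x(2), of k], of "k * u"] x(1) by (simp add: algebra_simps)
    fix y assume "y \<in> J (Suc p)"
    then obtain b v where y: "y = b + f (Suc p) * v" "b \<in> J p" using J_Suc[OF p] by auto
    show "x + y \<in> J (Suc p)"
      using J_step[OF p ideal_add[OF I x(2) y(2)], of "u + v"] x(1) y(1) by (simp add: algebra_simps)
  qed
qed (simp add: J_0 J0)

lemma J_mono: "p \<le> p' \<Longrightarrow> p' \<le> c \<Longrightarrow> J p \<subseteq> J p'"
proof (induction p' rule: dec_induct)
  case (step k)
  then show ?case using J_step[of k _ 0] by force
qed simp

lemma J_m: "p \<le> c \<Longrightarrow> J p \<subseteq> m"
  using J_mono[of p c] J_c by auto

lemma f_in_J: "1 \<le> j \<Longrightarrow> j \<le> p \<Longrightarrow> p \<le> c \<Longrightarrow> f j \<in> J p"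
proof -
  assume j: "1 \<le> j" "j \<le> p" "p \<le> c"
  then obtain k where k: "j = Suc k" by (cases j) auto
  have "0 + f (Suc k) * 1 \<in> J (Suc k)" using j k J_ideal[of k] by (intro J_step) (auto intro: ideal_zero)
  then show ?thesis using J_mono[of j p] j k by auto
qed

lemma eqmod_J: "p \<le> c \<Longrightarrow> eqmod n J0 x y \<Longrightarrow> eqmod n (J p) x y"
  using eqmod_mono[of n J0 x y "J p"] J_mono[of 0 p] J_0 J_ideal by simp

lemma eqmod_J_m: "p \<le> c \<Longrightarrow> eqmod n (J p) x y \<Longrightarrow> eqmod n m x y"
  using eqmod_mono[of n "J p" x y m] J_m m by simp

lemma J_Suc_vec:
  assumes "p < c" "eqmod n (J (Suc p)) x 0"
  shows "\<exists>y. eqmod n (J p) x (f (Suc p) \<star> y)"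
proof -
  have "\<exists>y. x i - f (Suc p) * y \<in> J p" if "i < n" for i
  proof -
    have "x i \<in> J (Suc p)" using assms(2) that by (simp add: eqmod_def vec_apply)
    then obtain a y where "x i = a + f (Suc p) * y" "a \<in> J p" using J_Suc[OF assms(1)] by auto
    then show ?thesis by (intro exI[of _ y]) simp
  qed
  then obtain y where "\<And>i. i < n \<Longrightarrow> x i - f (Suc p) * y i \<in> J p" by metis
  then show ?thesis using J_ideal[of p] assms(1) by (intro exI[of _ y]) (simp add: eqmod_def vec_apply)
qed

lemma J_decompose:
  assumes "p \<le> c" "eqmod n (J p) x 0"
  shows "\<exists>y. eqmod n J0 x (\<Sum>j\<in>{1..p}. f j \<star> y j)"
  using assms
proof (induction p arbitrary: x)
  case (Suc p)
  obtain w where w: "eqmod n (J p) x (f (Suc p) \<star> w)" using J_Suc_vec[OF _ Suc.prems(2)] Suc.prems(1) by auto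
  then have "eqmod n (J p) (x - f (Suc p) \<star> w) 0" using eqmod_diff_iff by blast
  from Suc.IH[OF _ this] obtain y where y: "eqmod n J0 (x - f (Suc p) \<star> w) (\<Sum>j\<in>{1..p}. f j \<star> y j)"
    using Suc.prems(1) by auto
  have "(\<Sum>j\<in>{1..Suc p}. f j \<star> (y(Suc p := w)) j) = (\<Sum>j\<in>{1..p}. f j \<star> y j) + f (Suc p) \<star> w"
    by (simp add: sum.nat_ivl_Suc')
  moreover have "eqmod n J0 (x - f (Suc p) \<star> w + f (Suc p) \<star> w) ((\<Sum>j\<in>{1..p}. f j \<star> y j) + f (Suc p) \<star> w)"
    by (rule eqmod_add[OF y eqmod_refl[OF J0]])
  ultimately have "eqmod n J0 x (\<Sum>j\<in>{1..Suc p}. f j \<star> (y(Suc p := w)) j)" by simp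
  then show ?case by (intro exI)
qed (simp add: J_0)

lemma J_combination: "p \<le> c \<Longrightarrow> eqmod n (J p) (\<Sum>j\<in>{1..p}. f j \<star> y j) 0"
  using J_ideal[of p] f_in_J by (intro eqmod_0_sum eqmod_0_scl_in) auto

lemma J_regular_vec: "p < c \<Longrightarrow> eqmod n (J p) (f (Suc p) \<star> x) 0 \<Longrightarrow> eqmod n (J p) x 0"
  using regular unfolding eqmod_def by (simp add: vec_apply)

lemma J_regular_power: "p < c \<Longrightarrow> f (Suc p) ^ k * x \<in> J p \<Longrightarrow> x \<in> J p"
  by (induction k) (auto simp: mult.assoc dest: regular)

text \<open>By regularity the last coefficient lies in \<open>J p\<close>. Writing it in terms of \<open>f\<^sub>1, \<dots>, f\<^sub>p\<close> and moving it to
  the other terms gives a shorter relation, whose coefficients differ from the old ones by multiples of \<open>f\<^sub>p\<^sub>+\<^sub>1\<close>.\<close>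

lemma relation_coefficients_in_m:
  assumes "p \<le> c" "eqmod n J0 (\<Sum>j\<in>{1..p}. f j \<star> w j) 0" "j \<in> {1..p}"
  shows "eqmod n m (w j) 0"
  using assms
proof (induction p arbitrary: w j)
  case (Suc p)
  then have p: "p < c" "p \<le> c" by auto
  let ?comb = "\<lambda>w. \<Sum>j\<in>{1..p}. f j \<star> w j"
  have sum: "(\<Sum>j\<in>{1..Suc p}. f j \<star> w j) = ?comb w + f (Suc p) \<star> w (Suc p)"
    by (simp add: sum.nat_ivl_Suc')
  have "eqmod n (J p) ((?comb w + f (Suc p) \<star> w (Suc p)) - ?comb w) (0 - 0)"
    using eqmod_J[OF p(2) Suc.prems(2)[unfolded sum]] J_combination[OF p(2)] by (rule eqmod_diff)
  then have "eqmod n (J p) (f (Suc p) \<star> w (Suc p)) 0" by simp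
  then have w: "eqmod n (J p) (w (Suc p)) 0" by (rule J_regular_vec[OF p(1)])
  obtain a where a: "eqmod n J0 (w (Suc p)) (?comb a)" using J_decompose[OF p(2) w] by blast
  have "eqmod n J0 (?comb w + f (Suc p) \<star> ?comb a) (?comb w + f (Suc p) \<star> w (Suc p))"
    by (rule eqmod_add[OF eqmod_refl[OF J0] eqmod_scl[OF eqmod_sym[OF a]]])
  also have "eqmod n J0 \<dots> 0" using Suc.prems(2) unfolding sum .
  also have "?comb w + f (Suc p) \<star> ?comb a = ?comb (\<lambda>j. w j + f (Suc p) \<star> a j)"
    by (simp add: scl_sum sum.distrib[symmetric] scl_add scl_scl mult.commute)
  finally have IH: "eqmod n m (w j + f (Suc p) \<star> a j) 0" if "j \<in> {1..p}" for j
    using Suc.IH[OF p(2) _ that, of "\<lambda>j. w j + f (Suc p) \<star> a j"] by simp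
  have fm: "f (Suc p) \<in> m" using f_in_J[of "Suc p" "Suc p"] J_m[of "Suc p"] Suc.prems(1) by auto
  show ?case
  proof (cases "j = Suc p")
    case True
    then show ?thesis using eqmod_J_m[OF p(2) w] by simp
  next
    case False
    then have "j \<in> {1..p}" using Suc.prems(3) by auto
    from eqmod_0_diff[OF IH[OF this] eqmod_0_scl_in[OF m fm, of n "a j"]] show ?thesis by simp
  qed
qed simp

end

definition shift :: "nat \<Rightarrow> (nat \<Rightarrow> 'r) \<Rightarrow> nat \<Rightarrow> 'r" where
  "shift k x = (\<lambda>i. x (i + k))"

lemma lin_shift:
  assumes "lin n F"
  shows "lin (k + n) (\<lambda>x. F (shift k x))"
proof -
  have "shift k (x + y) = shift k x + shift k y" "shift k (c \<star> x) = c \<star> shift k x"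
    for x y :: "nat \<Rightarrow> 'a" and c by (auto simp: shift_def fun_eq_iff vec_apply)
  moreover have "F (shift k x) = 0" if "\<forall>i<k + n. x i = 0" for x
    by (rule lin_vanish[OF assms]) (use that in \<open>simp add: shift_def\<close>)
  ultimately show ?thesis
    unfolding lin_def[of "k + n"] by (simp add: lin_add[OF assms] lin_scl[OF assms])
qed

text \<open>A minimal exact complex over \<open>R\<^sub>p\<^sub>+\<^sub>1\<close>, lifted to the ring type together with its CI operators \<open>t j\<close>, of which
  the last one is surjective.\<close>

locale ci_layer = ci_tower J0 m J f c for J0 m :: "'r::comm_ring_1 set" and J f c +
  fixes p :: nat and n :: "nat \<Rightarrow> nat" and D :: "nat \<Rightarrow> (nat \<Rightarrow> 'r) \<Rightarrow> nat \<Rightarrow> 'r"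
    and t :: "nat \<Rightarrow> nat \<Rightarrow> (nat \<Rightarrow> 'r) \<Rightarrow> nat \<Rightarrow> 'r"
  assumes p: "p < c" and exact: "minimal_exact (J (Suc p)) n D"
    and lin_t: "j \<in> {1..Suc p} \<Longrightarrow> lin (n (Suc (Suc i))) (t j i)"
    and homotopy: "eqmod (n i) J0 (D i (D (Suc i) x)) (\<Sum>j\<in>{1..Suc p}. f j \<star> t j i x)"
    and surjective: "\<exists>x. eqmod (n i) (J (Suc p)) (t (Suc p) i x) y"
begin

abbreviation "J' \<equiv> J p"
abbreviation "fp \<equiv> f (Suc p)"
abbreviation "T i \<equiv> t (Suc p) i"
abbreviation "n1 \<equiv> n (Suc 0)"
abbreviation "n2 \<equiv> n (Suc (Suc 0))"
abbreviation "n3 \<equiv> n (Suc (Suc (Suc 0)))"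
abbreviation "D2 \<equiv> D (Suc (Suc 0))"

lemma J': "is_ideal J'" using J_ideal p by simp
lemma eqmod_J': "eqmod k J0 x y \<Longrightarrow> eqmod k J' x y" using eqmod_J p by simp
lemma eqmod_J'_m: "eqmod k J' x y \<Longrightarrow> eqmod k m x y" using eqmod_J_m[of p] p by simp
lemma eqmod_J'_J: "eqmod k J' x y \<Longrightarrow> eqmod k (J (Suc p)) x y"
  using eqmod_mono J_mono[of p "Suc p"] J_ideal[of "Suc p"] p by (simp add: eqmod_mono)

lemma lin_T: "lin (n (Suc (Suc i))) (T i)" using lin_t by simp
lemma lin_D: "lin (n (Suc i)) (D i)" by (rule minimal_exactD(1)[OF exact])
lemma D_m: "eqmod (n i) m (D i x) 0" by (rule minimal_exactD(2)[OF exact])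

lemma DD: "eqmod (n i) J' (D i (D (Suc i) x)) (fp \<star> T i x)"
proof -
  have "eqmod (n i) J' (D i (D (Suc i) x)) (\<Sum>j\<in>{1..Suc p}. f j \<star> t j i x)"
    by (rule eqmod_J'[OF homotopy])
  also have "(\<Sum>j\<in>{1..Suc p}. f j \<star> t j i x) = (\<Sum>j\<in>{1..p}. f j \<star> t j i x) + fp \<star> T i x"
    by (simp add: sum.nat_ivl_Suc')
  also have "eqmod (n i) J' \<dots> (0 + fp \<star> T i x)"
    using p by (intro eqmod_add eqmod_refl[OF J'] J_combination) simp
  finally show ?thesis by simp
qed

lemma cancel_fp: "eqmod k J' (fp \<star> x) (fp \<star> y) \<Longrightarrow> eqmod k J' x y"
  using J_regular_vec[OF p, of k "x - y"] eqmod_diff_iff[of k J' x y] eqmod_diff_iff[of k J' "fp \<star> x"]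
  by (simp add: scl_diff)

text \<open>Both sides multiplied by \<open>f\<^sub>p\<^sub>+\<^sub>1\<close> are the cube of the differential.\<close>

lemma TD: "eqmod (n i) J' (T i (D (Suc (Suc i)) x)) (D i (T (Suc i) x))"
proof (rule cancel_fp)
  have "eqmod (n i) J' (fp \<star> T i (D (Suc (Suc i)) x)) (D i (D (Suc i) (D (Suc (Suc i)) x)))"
    by (rule eqmod_sym[OF DD])
  also have "eqmod (n i) J' \<dots> (D i (fp \<star> T (Suc i) x))"
    by (rule eqmod_lin[OF lin_D DD])
  finally show "eqmod (n i) J' (fp \<star> T i (D (Suc (Suc i)) x)) (fp \<star> D i (T (Suc i) x))"
    by (simp add: lin_scl[OF lin_D])
qed

lemma cycle_in_m: "eqmod (n i) J' (D i x) 0 \<Longrightarrow> eqmod (n (Suc i)) m x 0"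
  using minimal_exact_kernel_minimal[OF exact J_m[of "Suc p"]] p eqmod_J'_J by simp

text \<open>Over the local ring itself, the failure of the surjective operator to commute with the differential is a
  combination of \<open>f\<^sub>1, \<dots>, f\<^sub>p\<close> with linear coefficients \<open>h\<close>. Linearity makes \<open>h\<close> preserve vectors with entries in \<open>m\<close>.\<close>

lemma T_D_homotopy:
  "\<exists>h. (\<forall>j. lin (n (Suc (Suc (Suc i)))) (h j)) \<and>
     (\<forall>x. eqmod (n i) J0 (T i (D (Suc (Suc i)) x)) (D i (T (Suc i) x) + (\<Sum>j\<in>{1..p}. f j \<star> h j x)))"
proof -
  let ?N = "n (Suc (Suc (Suc i)))"
  define E where "E = (\<lambda>x. T i (D (Suc (Suc i)) x) - D i (T (Suc i) x))"
  have E: "lin ?N E" unfolding E_def by (intro lin_minus_map lin_comp[OF lin_D lin_T] lin_comp[OF lin_T lin_D])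
  have "\<exists>y. eqmod (n i) J0 (E (stdvec k)) (\<Sum>j\<in>{1..p}. f j \<star> y j)" for k
  proof (rule J_decompose)
    show "eqmod (n i) J' (E (stdvec k)) 0"
      unfolding E_def using TD[of i "stdvec k"] eqmod_diff_iff by blast
  qed (use p in simp)
  then have "\<forall>k. \<exists>y. eqmod (n i) J0 (E (stdvec k)) (\<Sum>j\<in>{1..p}. f j \<star> y j)" ..
  from choice[OF this] obtain y where
    y: "\<forall>k. eqmod (n i) J0 (E (stdvec k)) (\<Sum>j\<in>{1..p}. f j \<star> y k j)" ..
  define h where "h = (\<lambda>j x. \<Sum>k<?N. x k \<star> y k j)"
  have h: "lin ?N (h j)" for j unfolding h_def by (rule linI_expand)
  have "eqmod (n i) J0 (E x) (\<Sum>j\<in>{1..p}. f j \<star> h j x)" for x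
  proof -
    have 1: "eqmod (n i) J0 (\<Sum>k<?N. x k \<star> E (stdvec k)) (\<Sum>k<?N. x k \<star> (\<Sum>j\<in>{1..p}. f j \<star> y k j))"
      using J0 y by (intro eqmod_sum eqmod_scl) auto
    have "(\<Sum>k<?N. x k \<star> (\<Sum>j\<in>{1..p}. f j \<star> y k j)) = (\<Sum>k<?N. \<Sum>j\<in>{1..p}. f j \<star> x k \<star> y k j)"
      by (simp only: scl_sum scl_scl mult.commute)
    also have "\<dots> = (\<Sum>j\<in>{1..p}. \<Sum>k<?N. f j \<star> x k \<star> y k j)" by (rule sum.swap)
    also have "\<dots> = (\<Sum>j\<in>{1..p}. f j \<star> h j x)" by (simp only: h_def scl_sum)
    finally show ?thesis using 1 lin_expand[OF E, of x] by metis
  qed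
  then have "eqmod (n i) J0 (E x + D i (T (Suc i) x)) ((\<Sum>j\<in>{1..p}. f j \<star> h j x) + D i (T (Suc i) x))" for x
    using J0 by (intro eqmod_add) auto
  then show ?thesis using h unfolding E_def by (intro exI[of _ h]) (simp add: add.commute)
qed

lemma splitting_exists:
  "\<exists>r s P q. n (Suc (Suc i)) = r + n i \<and> lin (n i) s \<and> lin r P \<and> lin (n (Suc (Suc i))) q \<and>
     (\<forall>y. eqmod (n i) J0 (T i (s y)) y) \<and> (\<forall>y. eqmod r J0 (q (P y)) y) \<and>
     (\<forall>x. eqmod (n (Suc (Suc i))) J0 (P (q x) + s (T i x)) x) \<and>
     (\<forall>y. eqmod (n i) J0 (T i (P y)) 0) \<and> (\<forall>y. eqmod r J0 (q (s y)) 0)"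
proof -
  have "\<exists>x. eqmod (n i) m (T i x) y" for y
  proof -
    obtain x where "eqmod (n i) (J (Suc p)) (T i x) y" using surjective by blast
    then have "eqmod (n i) m (T i x) y" using p by (intro eqmod_J_m[of "Suc p"]) auto
    then show ?thesis by (intro exI)
  qed
  from section_exists[OF lin_T this] obtain s where s: "lin (n i) s" "\<And>y. eqmod (n i) J0 (T i (s y)) y"
    by blast
  show ?thesis
    by (rule kernel_of_split_map_free[OF lin_T s]) (use s in blast)
qed

end

text \<open>The kernel of the surjective operator \<open>T i\<close> is free: \<open>s i\<close> is a section of \<open>T i\<close>, \<open>P i\<close> is a basis of the
  kernel, and \<open>q i\<close> is the projection to the kernel in terms of this basis.\<close>

locale ci_layer_split = ci_layer J0 m J f c p n D t for J0 m :: "'r::comm_ring_1 set" and J f c p n D t +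
  fixes r :: "nat \<Rightarrow> nat" and s P q :: "nat \<Rightarrow> (nat \<Rightarrow> 'r) \<Rightarrow> nat \<Rightarrow> 'r"
  assumes rank: "n (Suc (Suc i)) = r i + n i" and lin_s: "lin (n i) (s i)" and lin_P: "lin (r i) (P i)"
    and lin_q: "lin (n (Suc (Suc i))) (q i)" and Ts: "eqmod (n i) J0 (T i (s i y)) y"
    and qP: "eqmod (r i) J0 (q i (P i y)) y"
    and Pq_sT: "eqmod (n (Suc (Suc i))) J0 (P i (q i x) + s i (T i x)) x"
    and TP: "eqmod (n i) J0 (T i (P i y)) 0" and qs: "eqmod (r i) J0 (q i (s i y)) 0"
begin

text \<open>The differential on the kernel of the operator \<open>T\<close>, in terms of the bases \<open>P\<close>.\<close>

definition g :: "nat \<Rightarrow> (nat \<Rightarrow> 'r) \<Rightarrow> nat \<Rightarrow> 'r" where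
  "g i x = q i (D (Suc (Suc i)) (P (Suc i) x))"

lemma lin_g: "lin (r (Suc i)) (g i)"
  unfolding g_def by (rule lin_comp[OF lin_comp[OF lin_P lin_D] lin_q])

lemma Pq_of_kernel:
  assumes "eqmod (n i) J' (T i x) 0"
  shows "eqmod (n (Suc (Suc i))) J' (P i (q i x)) x"
proof -
  have "eqmod (n (Suc (Suc i))) J' (P i (q i x) + s i (T i x) - s i (T i x)) (x - 0)"
    by (rule eqmod_diff[OF eqmod_J'[OF Pq_sT] eqmod_lin_0[OF lin_s assms]])
  then show ?thesis by simp
qed

lemma TDP: "eqmod (n i) J' (T i (D (Suc (Suc i)) (P (Suc i) x))) 0"
  by (rule eqmod_trans[OF TD eqmod_lin_0[OF lin_D eqmod_J'[OF TP]]])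

lemma Pg: "eqmod (n (Suc (Suc i))) J' (P i (g i x)) (D (Suc (Suc i)) (P (Suc i) x))"
  unfolding g_def by (rule Pq_of_kernel[OF TDP])

lemma DDP: "eqmod (n i) J' (D i (D (Suc i) (P i x))) 0"
  by (rule eqmod_trans[OF DD eqmod_0_scl[OF eqmod_J'[OF TP]]])

text \<open>A cycle \<open>z\<close> over \<open>R\<^sub>p\<close> is a boundary over \<open>R\<^sub>p\<^sub>+\<^sub>1\<close>, so \<open>z = \<delta> y + f w\<close>. Being a cycle means \<open>T y = - \<delta> w\<close>. Surjectivity
  gives \<open>w = T v\<close>, and then \<open>y + \<delta> v\<close> has boundary \<open>z\<close> and lies in the kernel of \<open>T\<close>.\<close>

lemma lift_cycle:
  assumes "eqmod (n i) J' (D i z) 0"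
  shows "\<exists>v. eqmod (n (Suc i)) J' z (D (Suc i) (P i v))"
proof -
  let ?n1 = "n (Suc i)" and ?n2 = "n (Suc (Suc i))"
  obtain y where "eqmod ?n1 (J (Suc p)) z (D (Suc i) y)"
    using minimal_exactD(4)[OF exact eqmod_J'_J[OF assms]] by blast
  then have "eqmod ?n1 (J (Suc p)) (z - D (Suc i) y) 0" using eqmod_diff_iff by blast
  from J_Suc_vec[OF p this] obtain w where w: "eqmod ?n1 J' (z - D (Suc i) y) (fp \<star> w)" by blast
  have zw: "eqmod ?n1 J' (D (Suc i) y + fp \<star> w) z"
    using eqmod_add[OF eqmod_refl[OF J'] eqmod_sym[OF w], of "D (Suc i) y"] by simp
  have Ty: "eqmod (n i) J' (T i y + D i w) 0"
  proof (rule J_regular_vec[OF p])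
    have "eqmod (n i) J' (fp \<star> T i y + fp \<star> D i w) (D i (D (Suc i) y) + fp \<star> D i w)"
      by (rule eqmod_add[OF eqmod_sym[OF DD] eqmod_refl[OF J']])
    also have "\<dots> = D i (D (Suc i) y + fp \<star> w)" by (simp add: lin_add[OF lin_D] lin_scl[OF lin_D])
    also have "eqmod (n i) J' \<dots> (D i z)" by (rule eqmod_lin[OF lin_D zw])
    also have "eqmod (n i) J' \<dots> 0" by (rule assms)
    finally show "eqmod (n i) J' (fp \<star> (T i y + D i w)) 0" by (simp add: scl_add)
  qed
  define v where "v = s (Suc i) w"
  have v: "eqmod ?n1 J' (T (Suc i) v) w" unfolding v_def by (rule eqmod_J'[OF Ts])
  define y' where "y' = y + D (Suc (Suc i)) v"
  have "eqmod (n i) J' (T i y') (T i y + D i (T (Suc i) v))"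
    unfolding y'_def lin_add[OF lin_T] by (rule eqmod_add[OF eqmod_refl[OF J'] TD])
  also have "eqmod (n i) J' \<dots> (T i y + D i w)"
    by (rule eqmod_add[OF eqmod_refl[OF J'] eqmod_lin[OF lin_D v]])
  also have "eqmod (n i) J' \<dots> 0" by (rule Ty)
  finally have Ty': "eqmod ?n2 J' (P i (q i y')) y'" by (rule Pq_of_kernel)
  have "eqmod ?n1 J' (D (Suc i) (P i (q i y'))) (D (Suc i) y')" by (rule eqmod_lin[OF lin_D Ty'])
  also have "eqmod ?n1 J' \<dots> (D (Suc i) y + fp \<star> T (Suc i) v)"
    unfolding y'_def lin_add[OF lin_D] by (rule eqmod_add[OF eqmod_refl[OF J'] DD])
  also have "eqmod ?n1 J' \<dots> (D (Suc i) y + fp \<star> w)"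
    by (rule eqmod_add[OF eqmod_refl[OF J'] eqmod_scl[OF v]])
  also have "eqmod ?n1 J' \<dots> z" by (rule zw)
  finally have "eqmod ?n1 J' z (D (Suc i) (P i (q i y')))" by (rule eqmod_sym)
  then show ?thesis by (intro exI)
qed

lemma DP_kernel:
  "eqmod (n (Suc i)) J' (D (Suc i) (P i x)) 0 \<longleftrightarrow> (\<exists>v. eqmod (r i) J' x (g i v))"
proof
  assume "eqmod (n (Suc i)) J' (D (Suc i) (P i x)) 0"
  from lift_cycle[OF this] obtain v where v: "eqmod (n (Suc (Suc i))) J' (P i x) (D (Suc (Suc i)) (P (Suc i) v))"
    by blast
  have "eqmod (r i) J' x (q i (P i x))" by (rule eqmod_sym[OF eqmod_J'[OF qP]])
  also have "eqmod (r i) J' \<dots> (g i v)" unfolding g_def by (rule eqmod_lin[OF lin_q v])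
  finally show "\<exists>v. eqmod (r i) J' x (g i v)" by (intro exI)
next
  assume "\<exists>v. eqmod (r i) J' x (g i v)"
  then obtain v where v: "eqmod (r i) J' x (g i v)" by blast
  have "eqmod (n (Suc i)) J' (D (Suc i) (P i x)) (D (Suc i) (P i (g i v)))"
    by (rule eqmod_lin[OF lin_comp[OF lin_P lin_D] v])
  also have "eqmod (n (Suc i)) J' \<dots> (D (Suc i) (D (Suc (Suc i)) (P (Suc i) v)))"
    by (rule eqmod_lin[OF lin_D Pg])
  also have "eqmod (n (Suc i)) J' \<dots> 0" by (rule DDP)
  finally show "eqmod (n (Suc i)) J' (D (Suc i) (P i x)) 0" .
qed

lemma g_zero_iff: "eqmod (r i) J' (g i x) 0 \<longleftrightarrow> eqmod (n (Suc (Suc i))) J' (D (Suc (Suc i)) (P (Suc i) x)) 0"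
proof
  assume "eqmod (r i) J' (g i x) 0"
  from eqmod_lin_0[OF lin_P this] show "eqmod (n (Suc (Suc i))) J' (D (Suc (Suc i)) (P (Suc i) x)) 0"
    by (rule eqmod_trans[OF eqmod_sym[OF Pg]])
next
  assume "eqmod (n (Suc (Suc i))) J' (D (Suc (Suc i)) (P (Suc i) x)) 0"
  then show "eqmod (r i) J' (g i x) 0" unfolding g_def by (rule eqmod_lin_0[OF lin_q])
qed

lemma minimal_exact_g: "minimal_exact J' r g"
  unfolding minimal_exact_def
proof (intro conjI allI impI)
  show "eqmod (r i) m (g i x) 0" for i x unfolding g_def by (rule eqmod_lin_0[OF lin_q D_m])
  show "eqmod (r i) J' (g i (g (Suc i) x)) 0" for i x
    unfolding g_zero_iff DP_kernel using eqmod_refl[OF J'] by blast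
  show "\<exists>y. eqmod (r (Suc i)) J' x (g (Suc i) y)" if "eqmod (r i) J' (g i x) 0" for i x
    using that unfolding g_zero_iff DP_kernel .
qed (rule lin_g)

lemma fp_nonunit_power: "fp ^ k \<notin> J'"
proof
  assume "fp ^ k \<in> J'"
  then have "1 \<in> J'" using J_regular_power[OF p, of k 1] by simp
  then show False using J_m[of p] p one_m by auto
qed

text \<open>So \<open>\<delta>\<^sub>1\<close> is, over \<open>R\<^sub>p\<close>, a factor of multiplication by a nonzerodivisor, and the determinant argument compares its
  ranks.\<close>

lemma D_section: "eqmod (n 0) J' (D 0 (D (Suc 0) (s 0 x))) (fp \<star> x)"
  by (rule eqmod_trans[OF DD eqmod_scl[OF eqmod_J'[OF Ts]]])

lemma rank_le: "n 0 \<le> n1"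
  using rank_factor[OF J' lin_D lin_comp[OF lin_s lin_D] D_section] fp_nonunit_power
  by (meson le_eq_less_or_eq not_le)

lemma rank_eq: assumes "n1 = n 0" shows "r 0 = 0"
proof -
  have inj: "eqmod (n 0) J' x 0" if x: "eqmod (n 0) J' (D 0 x) 0" for x
  proof -
    have "eqmod (n 0) J' (fp ^ n 0 \<star> x) 0"
      using kernel_factor[OF J' lin_D lin_comp[OF lin_s lin_D] D_section] assms x by simp
    then have "fp ^ n 0 * x i \<in> J'" if "i < n 0" for i
      using that by (simp add: eqmod_def vec_apply)
    then have "x i \<in> J'" if "i < n 0" for i using that J_regular_power[OF p] by blast
    then show ?thesis using J' by (simp add: eqmod_def vec_apply)
  qed
  have "eqmod (r 0) m y 0" for y
  proof -
    have "eqmod n1 J' (D (Suc 0) (P 0 y)) 0" unfolding assms by (rule inj[OF DDP])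
    then obtain v where "eqmod (r 0) J' y (g 0 v)" using DP_kernel by blast
    then show ?thesis
      using eqmod_trans[OF eqmod_J'_m minimal_exactD(2)[OF minimal_exact_g]] by blast
  qed
  from this[of "\<lambda>_. 1"] show ?thesis using one_m by (cases "r 0") (auto simp: eqmod_def vec_apply)
qed

lemma rank_zero: assumes "n i = 0" shows "n (Suc i) = 0"
proof -
  have "eqmod (n (Suc i)) m x 0" for x
    using assms J' by (intro cycle_in_m) (simp add: eqmod_def)
  from this[of "\<lambda>_. 1"] show ?thesis using one_m by (cases "n (Suc i)") (auto simp: eqmod_def vec_apply)
qed

definition comb :: "(nat \<Rightarrow> nat \<Rightarrow> 'r) \<Rightarrow> nat \<Rightarrow> 'r" where
  "comb y = (\<Sum>j\<in>{1..p}. f j \<star> y j)"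

lemma comb_add: "comb y + comb z = comb (\<lambda>j. y j + z j)"
  and comb_diff: "comb y - comb z = comb (\<lambda>j. y j - z j)"
  unfolding comb_def by (simp_all only: scl_add scl_diff sum.distrib sum_subtractf)

lemma comb_scl: "a \<star> comb y = comb (\<lambda>j. a \<star> y j)"
  unfolding comb_def scl_sum scl_scl by (simp only: mult.commute)

lemma comb_zero: "comb (\<lambda>j. 0) = 0"
  unfolding comb_def scl_zero by (rule sum.neutral) simp

lemma lin_comb: "lin k G \<Longrightarrow> G (comb y) = comb (\<lambda>j. G (y j))"
  unfolding comb_def by (simp only: lin_sum lin_scl)

lemma comb_J': "eqmod k J' (comb y) 0"
  unfolding comb_def using p by (intro J_combination) simp

lemma J'_decompose: "eqmod k J' x 0 \<Longrightarrow> \<exists>y. eqmod k J0 x (comb y)"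
  unfolding comb_def using p by (intro J_decompose) simp_all

text \<open>A relation among the differential and \<open>f\<^sub>1, \<dots>, f\<^sub>p\<close> is trivial in the coordinates seen by the
  operator of \<open>f\<^sub>p\<^sub>+\<^sub>1\<close>: applying this operator gives a relation among \<open>f\<^sub>1, \<dots>, f\<^sub>p\<close> alone, whose
  coefficients cannot be units.\<close>

lemma relation_trivial:
  assumes zero: "eqmod n2 J0 (D2 u + comb x) 0"
  shows "eqmod n1 J' (T (Suc 0) u) 0" and "eqmod n3 m u 0"
    and "j \<in> {1..p} \<Longrightarrow> eqmod (n 0) m (T 0 (x j)) 0"
proof -
  obtain h where h: "\<And>j. lin n3 (h j)"
    and Th: "\<And>x. eqmod (n 0) J0 (T 0 (D2 x)) (D 0 (T (Suc 0) x) + comb (\<lambda>j. h j x))"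
    unfolding comb_def using T_D_homotopy[of 0] by blast
  have "eqmod n2 J' (D2 u + comb x - comb x) (0 - 0)"
    by (rule eqmod_diff[OF eqmod_J'[OF zero] comb_J'])
  then have Du: "eqmod n2 J' (D2 u) 0" by simp
  then show um: "eqmod n3 m u 0" by (rule cycle_in_m)
  have "eqmod n1 J' (fp \<star> T (Suc 0) u) 0"
    by (rule eqmod_trans[OF eqmod_sym[OF DD] eqmod_lin_0[OF lin_D Du]])
  then show Tu: "eqmod n1 J' (T (Suc 0) u) 0" by (rule J_regular_vec[OF p])
  obtain y where y: "eqmod n1 J0 (T (Suc 0) u) (comb y)" using J'_decompose[OF Tu] by blast
  have DTu: "eqmod (n 0) J0 (D 0 (T (Suc 0) u)) (comb (\<lambda>j. D 0 (y j)))"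
    using eqmod_lin[OF lin_D y] unfolding lin_comb[OF lin_D] .
  have "eqmod (n 0) J0 (comb (\<lambda>j. D 0 (y j)) + comb (\<lambda>j. h j u)) (T 0 (D2 u))"
    by (rule eqmod_sym[OF eqmod_trans[OF Th eqmod_add[OF DTu eqmod_refl[OF J0]]]])
  then have 1: "eqmod (n 0) J0 (comb (\<lambda>j. D 0 (y j)) + comb (\<lambda>j. h j u) + comb (\<lambda>j. T 0 (x j)))
      (T 0 (D2 u) + comb (\<lambda>j. T 0 (x j)))"
    by (rule eqmod_add[OF _ eqmod_refl[OF J0]])
  have 2: "T 0 (D2 u) + comb (\<lambda>j. T 0 (x j)) = T 0 (D2 u + comb x)"
    by (simp only: lin_add[OF lin_T] lin_comb[OF lin_T])
  have "eqmod (n 0) J0 (comb (\<lambda>j. D 0 (y j) + h j u + T 0 (x j))) 0"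
    using eqmod_trans[OF 1[unfolded 2] eqmod_lin_0[OF lin_T zero]] unfolding comb_add .
  then have sm: "eqmod (n 0) m (D 0 (y j) + h j u + T 0 (x j)) 0" if "j \<in> {1..p}" for j
    using relation_coefficients_in_m[of p "n 0" "\<lambda>j. D 0 (y j) + h j u + T 0 (x j)"] that p
    unfolding comb_def by simp
  show "eqmod (n 0) m (T 0 (x j)) 0" if "j \<in> {1..p}"
    using eqmod_0_diff[OF sm[OF that] eqmod_0_add[OF D_m eqmod_lin_0[OF h um]], of "y j" j] by simp
qed

text \<open>Over the local ring, the second syzygies are generated by the columns of the differential and the multiples
  of \<open>f\<^sub>1, \<dots>, f\<^sub>p\<close>: multiples of \<open>f\<^sub>p\<^sub>+\<^sub>1\<close> are boundaries modulo these since \<open>T\<close> is surjective.\<close>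

lemma second_syzygy_decompose:
  assumes "eqmod n1 (J (Suc p)) (D (Suc 0) x) 0"
  shows "\<exists>u w. eqmod n2 J0 x (D2 u + comb w)"
proof -
  obtain u where "eqmod n2 (J (Suc p)) x (D2 u)" using minimal_exactD(4)[OF exact assms] by blast
  then have "eqmod n2 (J (Suc p)) (x - D2 u) 0" using eqmod_diff_iff by blast
  from J_Suc_vec[OF p this] obtain w where w: "eqmod n2 J' (x - D2 u) (fp \<star> w)" by blast
  let ?v = "s (Suc (Suc 0)) w"
  have "eqmod n2 J' (x - D2 u) (fp \<star> T (Suc (Suc 0)) ?v)"
    by (rule eqmod_trans[OF w eqmod_scl[OF eqmod_sym[OF eqmod_J'[OF Ts]]]])
  then have "eqmod n2 J' (x - D2 u) (D2 (D (Suc (Suc (Suc 0))) ?v))"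
    by (rule eqmod_trans[OF _ eqmod_sym[OF DD]])
  then have "eqmod n2 J' (x - D2 u - D2 (D (Suc (Suc (Suc 0))) ?v)) 0" using eqmod_diff_iff by blast
  from J'_decompose[OF this] obtain y where
    y: "eqmod n2 J0 (x - D2 u - D2 (D (Suc (Suc (Suc 0))) ?v)) (comb y)" by blast
  have "eqmod n2 J0 (D2 (u + D (Suc (Suc (Suc 0))) ?v) + (x - D2 u - D2 (D (Suc (Suc (Suc 0))) ?v)))
      (D2 (u + D (Suc (Suc (Suc 0))) ?v) + comb y)"
    by (rule eqmod_add[OF eqmod_refl[OF J0] y])
  then have "eqmod n2 J0 x (D2 (u + D (Suc (Suc (Suc 0))) ?v) + comb y)"
    by (simp add: lin_add[OF lin_D])
  then show ?thesis by (intro exI)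
qed

lemma max_times_second_syzygy:
  assumes "x \<in> max_times n2 {x. eqmod n1 (J (Suc p)) (D (Suc 0) x) 0}"
  shows "\<exists>u w. eqmod n3 m u 0 \<and> (\<forall>j. eqmod n2 m (w j) 0) \<and>
    eqmod n2 J0 x (D2 u + comb w)"
proof -
  define Y where "Y = {x. \<exists>u w. eqmod n3 m u 0 \<and> (\<forall>j. eqmod n2 m (w j) 0) \<and>
    eqmod n2 J0 x (D2 u + comb w)}"
  have YI: "x \<in> Y" if "eqmod n3 m u 0" "\<And>j. eqmod n2 m (w j) 0"
    "eqmod n2 J0 x (D2 u + comb w)" for x u w
    unfolding Y_def using that by blast
  have null: "x \<in> Y" if "eqmod n2 J0 x 0" for x
    using that m by (intro YI[of 0 "\<lambda>_. 0"]) (simp_all add: lin_zero[OF lin_D] comb_zero)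
  have "max_times n2 {x. eqmod n1 (J (Suc p)) (D (Suc 0) x) 0} \<subseteq> Y"
  proof (rule max_times_subset)
    show "submod Y"
      unfolding submod_def
    proof (intro conjI ballI allI)
      show "0 \<in> Y" using J0 by (intro null) simp
      fix x assume "x \<in> Y"
      then obtain u w where x: "eqmod n3 m u 0" "\<And>j. eqmod n2 m (w j) 0"
        "eqmod n2 J0 x (D2 u + comb w)" unfolding Y_def by auto
      show "k \<star> x \<in> Y" for k
      proof (rule YI)
        show "eqmod n2 J0 (k \<star> x) (D2 (k \<star> u) + comb (\<lambda>j. k \<star> w j))"
          using eqmod_scl[OF x(3), of k] by (simp add: scl_add comb_scl lin_scl[OF lin_D])
      qed (rule eqmod_0_scl x)+
      fix y assume "y \<in> Y"
      then obtain u' w' where y: "eqmod n3 m u' 0" "\<And>j. eqmod n2 m (w' j) 0"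
        "eqmod n2 J0 y (D2 u' + comb w')" unfolding Y_def by auto
      show "x + y \<in> Y"
      proof (rule YI)
        show "eqmod n2 J0 (x + y) (D2 (u + u') + comb (\<lambda>j. w j + w' j))"
          using eqmod_add[OF x(3) y(3)] by (simp add: lin_add[OF lin_D] comb_add[symmetric] add_ac)
      qed (rule eqmod_0_add x y)+
    qed
    show "k \<star> x \<in> Y" if k: "k \<in> m" and kx: "x \<in> {x. eqmod n1 (J (Suc p)) (D (Suc 0) x) 0}" for k x
    proof -
      obtain u w where x: "eqmod n2 J0 x (D2 u + comb w)" 
        using second_syzygy_decompose kx by blast
      show ?thesis
      proof (rule YI)
        show "eqmod n2 J0 (k \<star> x) (D2 (k \<star> u) + comb (\<lambda>j. k \<star> w j))"
          using eqmod_scl[OF x, of k] by (simp add: scl_add comb_scl lin_scl[OF lin_D])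
      qed (rule eqmod_0_scl_in[OF m k])+
    qed
  qed (rule null)
  then show ?thesis using assms unfolding Y_def by blast
qed

lemma max_times_syzygy_below:
  assumes "\<And>j. eqmod (r 0) m (w j) 0"
  shows "comb w \<in> max_times (r 0) {y. eqmod n1 J' (D (Suc 0) (P 0 y)) 0}"
  unfolding comb_def
proof (rule submod_sum[OF submod_max_times])
  fix j assume j: "j \<in> {1..p}"
  define H where "H = (\<lambda>y :: nat \<Rightarrow> 'r. f j \<star> (\<lambda>i. if i < r 0 then y i else 0))"
  have H: "lin (r 0) H" unfolding H_def by (intro lin_scl_map lin_id_trunc)
  have "eqmod n1 J' (D (Suc 0) (P 0 (H y))) 0" for y
    unfolding H_def using f_in_J[of j p] j p J'
    by (intro eqmod_lin_0[OF lin_D] eqmod_lin_0[OF lin_P] eqmod_0_scl_in) auto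
  then have "H (w j) \<in> max_times (r 0) {y. eqmod n1 J' (D (Suc 0) (P 0 y)) 0}"
    using assms by (intro max_times_lin[OF H]) auto
  moreover have "eqmod (r 0) J0 (f j \<star> w j) (H (w j))"
    using J0 by (simp add: H_def eqmod_def vec_apply ideal_zero)
  ultimately show "f j \<star> w j \<in> max_times (r 0) {y. eqmod n1 J' (D (Suc 0) (P 0 y)) 0}"
    using max_times_cong by blast
qed

text \<open>To the independent relations one level below, add \<open>\<delta>\<^sub>3\<close> on the section of \<open>T\<close> and the multiples of
  \<open>f\<^sub>1, \<dots>, f\<^sub>p\<close> on the section of \<open>T\<close>. The section of \<open>T\<close> spans the new generators. By the triviality of
  relations, the coefficients of the added elements in a dependence lie in \<open>m\<close>; projecting along \<open>q\<close> then gives a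
  dependence one level below.\<close>

lemma independent_step:
  assumes F: "independent_in (r 0) {y. eqmod n1 J' (D (Suc 0) (P 0 y)) 0} b F"
  shows "\<exists>F'. independent_in n2 {x. eqmod n1 (J (Suc p)) (D (Suc 0) x) 0}
    (b + n1 + p * n 0) F'"
proof -
  let ?K = "{x. eqmod n1 (J (Suc p)) (D (Suc 0) x) 0}"
  let ?K' = "{y. eqmod n1 J' (D (Suc 0) (P 0 y)) 0}"
  let ?B = "b + n1 + p * n 0"
  have lF: "lin b F" and FK: "eqmod n1 J' (D (Suc 0) (P 0 (F x))) 0"
    and Fm: "F x \<in> max_times (r 0) ?K' \<Longrightarrow> eqmod b m x 0" for x
    using F unfolding independent_in_def by blast+
  define \<xi> :: "(nat \<Rightarrow> 'r) \<Rightarrow> nat \<Rightarrow> nat \<Rightarrow> 'r" where "\<xi> = (\<lambda>x j. shift (b + n1 + (j - 1) * n 0) x)"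
  define F' where "F' = (\<lambda>x. P 0 (F x) + D2 (s (Suc 0) (shift b x)) + comb (\<lambda>j. s 0 (\<xi> x j)))"
  have lF': "lin ?B F'"
    unfolding F'_def comb_def \<xi>_def
  proof (intro lin_plus lin_sum_map lin_scl_map)
    show "lin ?B (\<lambda>x. P 0 (F x))" by (rule lin_mono[OF lin_comp[OF lF lin_P]]) simp
    show "lin ?B (\<lambda>x. D2 (s (Suc 0) (shift b x)))"
      by (rule lin_mono[OF lin_shift[OF lin_comp[OF lin_s lin_D]]]) simp
    fix j assume j: "j \<in> {1..p}"
    then have "(j - 1) * n 0 + n 0 \<le> p * n 0"
      using mult_le_mono1[of j p "n 0"] by (cases j) auto
    then show "lin ?B (\<lambda>x. s 0 (shift (b + n1 + (j - 1) * n 0) x))"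
      by (intro lin_mono[OF lin_shift[OF lin_s]]) simp
  qed
  have F'K: "F' x \<in> ?K" for x
  proof -
    have "eqmod n1 (J (Suc p)) (D (Suc 0) (P 0 (F x))) 0" by (rule eqmod_J'_J[OF FK])
    moreover have "eqmod n1 (J (Suc p)) (D (Suc 0) (comb y)) 0" for y
      by (rule eqmod_J'_J[OF eqmod_lin_0[OF lin_D comb_J']])
    ultimately show ?thesis
      unfolding F'_def using minimal_exactD(3)[OF exact]
      by (simp add: lin_add[OF lin_D] eqmod_0_add)
  qed
  have "eqmod ?B m x 0" if xK: "F' x \<in> max_times n2 ?K" for x
  proof -
    \<comment> \<open>\<open>x\<close> is the coefficient vector of a dependence; \<open>u\<close> and \<open>w\<close> show its value in \<open>\<mm>K\<close>.\<close>
    obtain u w where um: "eqmod n3 m u 0" and wm: "\<And>j. eqmod n2 m (w j) 0"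
      and uw: "eqmod n2 J0 (F' x) (D2 u + comb w)"
      using max_times_second_syzygy[OF xK] by blast
    let ?\<gamma> = "shift b x"
    obtain h where h: "\<And>j. lin n3 (h j)"
      and Th: "\<And>x. eqmod (n 0) J0 (T 0 (D2 x)) (D 0 (T (Suc 0) x) + comb (\<lambda>j. h j x))"
      unfolding comb_def using T_D_homotopy[of 0] by blast
    obtain v where v: "eqmod (r 0) J' (F x) (g 0 v)" using FK DP_kernel by blast
    then have "eqmod (r 0) J' (F x - g 0 v) 0" using eqmod_diff_iff by blast
    from J'_decompose[OF this] obtain \<eta> where \<eta>: "eqmod (r 0) J0 (F x - g 0 v) (comb \<eta>)" by blast
    let ?Pv = "P (Suc 0) v"
    have "eqmod (n 0) J0 (T 0 (D2 ?Pv)) (D 0 (T (Suc 0) ?Pv) + comb (\<lambda>j. h j ?Pv))" by (rule Th)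
    also have "eqmod (n 0) J0 \<dots> (0 + comb (\<lambda>j. h j ?Pv))"
      by (rule eqmod_add[OF eqmod_lin_0[OF lin_D TP] eqmod_refl[OF J0]])
    finally have "eqmod (n 0) J0 (T 0 (D2 ?Pv)) (comb (\<lambda>j. h j ?Pv))" by simp
    from eqmod_lin[OF lin_s this]
    have sT: "eqmod n2 J0 (s 0 (T 0 (D2 ?Pv))) (comb (\<lambda>j. s 0 (h j ?Pv)))" unfolding lin_comb[OF lin_s] .
    have "eqmod n2 J0 (P 0 (g 0 v) + s 0 (T 0 (D2 ?Pv)) - s 0 (T 0 (D2 ?Pv)))
        (D2 ?Pv - comb (\<lambda>j. s 0 (h j ?Pv)))"
      unfolding g_def by (rule eqmod_diff[OF Pq_sT sT])
    then have Pgv: "eqmod n2 J0 (P 0 (g 0 v)) (D2 ?Pv - comb (\<lambda>j. s 0 (h j ?Pv)))" by simp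
    have "eqmod n2 J0 (P 0 (F x - g 0 v) + P 0 (g 0 v))
        (comb (\<lambda>j. P 0 (\<eta> j)) + (D2 ?Pv - comb (\<lambda>j. s 0 (h j ?Pv))))"
      using eqmod_add[OF eqmod_lin[OF lin_P \<eta>] Pgv] unfolding lin_comb[OF lin_P] .
    then have PF: "eqmod n2 J0 (P 0 (F x)) (comb (\<lambda>j. P 0 (\<eta> j)) + (D2 ?Pv - comb (\<lambda>j. s 0 (h j ?Pv))))"
      unfolding lin_add[OF lin_P, symmetric] by simp
    define u' where "u' = ?Pv + s (Suc 0) ?\<gamma> - u"
    define x' where "x' = (\<lambda>j. P 0 (\<eta> j) - s 0 (h j ?Pv) + s 0 (\<xi> x j) - w j)"
    have rel: "eqmod n2 J0 (D2 u' + comb x') 0"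
    proof -
      have "D2 u' + comb x' = comb (\<lambda>j. P 0 (\<eta> j)) + (D2 ?Pv - comb (\<lambda>j. s 0 (h j ?Pv)))
          + (D2 (s (Suc 0) ?\<gamma>) + comb (\<lambda>j. s 0 (\<xi> x j))) - (D2 u + comb w)"
        unfolding u'_def x'_def comb_diff[symmetric] comb_add[symmetric] lin_add[OF lin_D] lin_diff[OF lin_D]
        by simp
      moreover have "eqmod n2 J0 \<dots> (P 0 (F x) + (D2 (s (Suc 0) ?\<gamma>) + comb (\<lambda>j. s 0 (\<xi> x j))) - F' x)"
        by (rule eqmod_diff[OF eqmod_add[OF eqmod_sym[OF PF] eqmod_refl[OF J0]] eqmod_sym[OF uw]])
      moreover have "P 0 (F x) + (D2 (s (Suc 0) ?\<gamma>) + comb (\<lambda>j. s 0 (\<xi> x j))) - F' x = 0"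
        unfolding F'_def by simp
      ultimately show ?thesis by simp
    qed
    note rel' = relation_trivial[OF rel]
    have Tu': "eqmod n1 m (T (Suc 0) u') 0" by (rule eqmod_J'_m[OF rel'(1)])
    have \<gamma>m: "eqmod n1 m ?\<gamma> 0"
    proof -
      have "eqmod n1 m (0 + ?\<gamma> - 0) (T (Suc 0) ?Pv + T (Suc 0) (s (Suc 0) ?\<gamma>) - T (Suc 0) u)"
        by (rule eqmod_sym[OF eqmod_diff[OF eqmod_add[OF eqmod_m[OF TP] eqmod_m[OF Ts]] eqmod_lin_0[OF lin_T um]]])
      moreover have "\<dots> = T (Suc 0) u'" unfolding u'_def by (simp add: lin_add[OF lin_T] lin_diff[OF lin_T])
      ultimately show ?thesis using eqmod_trans[OF _ Tu'] by simp
    qed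
    have s\<gamma>: "eqmod n3 m (s (Suc 0) ?\<gamma>) 0" by (rule eqmod_lin_0[OF lin_s \<gamma>m])
    have Pvm: "eqmod n3 m ?Pv 0"
      using eqmod_0_add[OF eqmod_0_diff[OF rel'(2) s\<gamma>] um] unfolding u'_def by simp
    have \<xi>m: "eqmod (n 0) m (\<xi> x j) 0" if j: "j \<in> {1..p}" for j
    proof -
      have "eqmod (n 0) m (T 0 (P 0 (\<eta> j)) - T 0 (s 0 (h j ?Pv)) + T 0 (s 0 (\<xi> x j)) - T 0 (w j))
          (0 - h j ?Pv + \<xi> x j - 0)"
        by (rule eqmod_diff[OF eqmod_add[OF eqmod_diff[OF eqmod_m[OF TP] eqmod_m[OF Ts]] eqmod_m[OF Ts]]
              eqmod_lin_0[OF lin_T wm]])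
      moreover have "T 0 (P 0 (\<eta> j)) - T 0 (s 0 (h j ?Pv)) + T 0 (s 0 (\<xi> x j)) - T 0 (w j) = T 0 (x' j)"
        unfolding x'_def by (simp add: lin_add[OF lin_T] lin_diff[OF lin_T])
      ultimately have "eqmod (n 0) m (- h j ?Pv + \<xi> x j) 0"
        using eqmod_trans[OF eqmod_sym rel'(3)[OF j]] by simp
      from eqmod_0_add[OF this eqmod_lin_0[OF h[of j] Pvm]] show ?thesis by simp
    qed
    \<comment> \<open>With these coefficients in \<open>m\<close>, moving their terms to the right and projecting along \<open>q\<close> leaves a
      dependence one level below.\<close>
    define u'' where "u'' = u - s (Suc 0) ?\<gamma>"
    have u''m: "eqmod n3 m u'' 0" unfolding u''_def by (rule eqmod_0_diff[OF um s\<gamma>])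
    have "u'' = ?Pv - u'" unfolding u''_def u'_def by simp
    then have "T (Suc 0) u'' = T (Suc 0) ?Pv - T (Suc 0) u'" by (simp add: lin_diff[OF lin_T])
    then have "eqmod n1 J' (T (Suc 0) u'') 0"
      using eqmod_0_diff[OF eqmod_J'[OF TP] rel'(1), of v] by simp
    from J'_decompose[OF this] obtain y where y: "eqmod n1 J0 (T (Suc 0) u'') (comb y)" by blast
    let ?G = "\<lambda>z. q 0 (D2 z)"
    have lG: "lin n3 ?G" by (rule lin_comp[OF lin_D lin_q])
    have lGs: "lin n1 (\<lambda>z. ?G (s (Suc 0) z))" by (rule lin_comp[OF lin_s lG])
    have "eqmod (r 0) J0 (?G u'') (?G (P (Suc 0) (q (Suc 0) u'') + s (Suc 0) (T (Suc 0) u'')))"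
      by (rule eqmod_lin[OF lG eqmod_sym[OF Pq_sT]])
    also have "\<dots> = g 0 (q (Suc 0) u'') + ?G (s (Suc 0) (T (Suc 0) u''))"
      unfolding g_def lin_add[OF lG] ..
    also have "eqmod (r 0) J0 \<dots> (g 0 (q (Suc 0) u'') + comb (\<lambda>j. ?G (s (Suc 0) (y j))))"
      using eqmod_add[OF eqmod_refl[OF J0] eqmod_lin[OF lGs y]] unfolding lin_comb[OF lGs] .
    finally have Gu: "eqmod (r 0) J0 (?G u'') (g 0 (q (Suc 0) u'') + comb (\<lambda>j. ?G (s (Suc 0) (y j))))" .
    define w' where "w' = (\<lambda>j. if j \<in> {1..p} then ?G (s (Suc 0) (y j)) + q 0 (w j - s 0 (\<xi> x j)) else 0)"
    have w'm: "eqmod (r 0) m (w' j) 0" for j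
      unfolding w'_def using m
      by (auto intro!: eqmod_0_add eqmod_lin_0[OF lin_q] D_m eqmod_0_diff wm eqmod_lin_0[OF lin_s] \<xi>m
          simp del: atLeastAtMost_iff)
    have "F' x - D2 (s (Suc 0) ?\<gamma>) - comb (\<lambda>j. s 0 (\<xi> x j)) = P 0 (F x)" unfolding F'_def by simp
    then have "eqmod n2 J0 (P 0 (F x)) (D2 u + comb w - D2 (s (Suc 0) ?\<gamma>) - comb (\<lambda>j. s 0 (\<xi> x j)))"
      using eqmod_diff[OF eqmod_diff[OF uw eqmod_refl[OF J0]] eqmod_refl[OF J0],
          of "D2 (s (Suc 0) ?\<gamma>)" "comb (\<lambda>j. s 0 (\<xi> x j))"] by simp
    moreover have "D2 u + comb w - D2 (s (Suc 0) ?\<gamma>) - comb (\<lambda>j. s 0 (\<xi> x j))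
        = D2 u'' + comb (\<lambda>j. w j - s 0 (\<xi> x j))"
      unfolding u''_def comb_diff[symmetric] lin_diff[OF lin_D] by simp
    ultimately have "eqmod (r 0) J0 (q 0 (P 0 (F x))) (q 0 (D2 u'' + comb (\<lambda>j. w j - s 0 (\<xi> x j))))"
      using eqmod_lin[OF lin_q] by simp
    then have "eqmod (r 0) J0 (F x) (?G u'' + comb (\<lambda>j. q 0 (w j - s 0 (\<xi> x j))))"
      unfolding lin_add[OF lin_q] lin_comb[OF lin_q] by (rule eqmod_trans[OF eqmod_sym[OF qP]])
    then have "eqmod (r 0) J0 (F x)
        (g 0 (q (Suc 0) u'') + comb (\<lambda>j. ?G (s (Suc 0) (y j))) + comb (\<lambda>j. q 0 (w j - s 0 (\<xi> x j))))"
      by (rule eqmod_trans[OF _ eqmod_add[OF Gu eqmod_refl[OF J0]]])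
    moreover have "comb (\<lambda>j. ?G (s (Suc 0) (y j))) + comb (\<lambda>j. q 0 (w j - s 0 (\<xi> x j))) = comb w'"
      unfolding comb_add unfolding comb_def w'_def by (intro sum.cong) simp_all
    ultimately have Fx: "eqmod (r 0) J0 (F x) (g 0 (q (Suc 0) u'') + comb w')" by (simp add: add.assoc)
    have "g 0 (q (Suc 0) u'') \<in> max_times (r 0) ?K'"
    proof (rule max_times_lin[OF lin_g])
      show "g 0 (stdvec j) \<in> ?K'" for j using DP_kernel eqmod_refl[OF J'] by blast
      show "eqmod (r (Suc 0)) m (q (Suc 0) u'') 0" by (rule eqmod_lin_0[OF lin_q u''m])
    qed
    from submod_add[OF submod_max_times this max_times_syzygy_below[OF w'm]]
    have "eqmod b m x 0" by (intro Fm max_times_cong[OF Fx])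
    then have 1: "x i \<in> m" if "i < b" for i using that by (simp add: eqmod_def vec_apply)
    have 2: "x i \<in> m" if "b \<le> i" "i < b + n1" for i
    proof -
      have "shift b x j \<in> m" if "j < n1" for j using \<gamma>m that by (simp add: eqmod_def vec_apply)
      from this[of "i - b"] show ?thesis using that by (simp add: shift_def)
    qed
    have 3: "x i \<in> m" if i: "b + n1 \<le> i" "i < ?B" for i
    proof -
      define k where "k = i - (b + n1)"
      have k: "k < p * n 0" "i = b + n1 + k" using i unfolding k_def by auto
      then have n0: "0 < n 0" by (cases "n 0") auto
      have "k div n 0 < p" using k(1) by (simp add: less_mult_imp_div_less)
      then have "eqmod (n 0) m (\<xi> x (Suc (k div n 0))) 0" by (intro \<xi>m) auto
      then have "\<xi> x (Suc (k div n 0)) l \<in> m" if "l < n 0" for l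
        using that by (simp add: eqmod_def vec_apply)
      from this[of "k mod n 0"] n0 have "x (k mod n 0 + (b + n1 + k div n 0 * n 0)) \<in> m"
        unfolding \<xi>_def shift_def by simp
      moreover have "k mod n 0 + (b + n1 + k div n 0 * n 0) = i"
        unfolding k(2) using div_mult_mod_eq[of k "n 0"] by linarith
      ultimately show ?thesis by simp
    qed
    have "x i \<in> m" if "i < ?B" for i using 1 2 3 that by (meson not_le)
    then show ?thesis using m by (simp add: eqmod_def vec_apply)
  qed
  then have "independent_in n2 ?K ?B F'" unfolding independent_in_def using lF' F'K by blast
  then show ?thesis by (intro exI)
qed

end

section \<open>The numerical consequences\<close>

text \<open>The numbers attached to a pre-stable syzygy of level \<open>p\<close>: its Betti numbers \<open>\<beta>\<close> over \<open>R\<^sub>p\<close> and the number of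
  independent relations found over \<open>S\<close>. The step adds the ranks \<open>a\<close>, \<open>e\<close> of the two first terms of the resolution at
  level \<open>p + 1\<close>.\<close>

inductive layers :: "nat \<Rightarrow> (nat \<Rightarrow> nat) \<Rightarrow> nat \<Rightarrow> bool" where
  layers_0: "layers 0 (\<lambda>_. 0) 0"
| layers_Suc: "layers p \<beta>' B' \<Longrightarrow> a \<le> e \<Longrightarrow> (\<beta>' 0 \<noteq> 0 \<Longrightarrow> a < e) \<Longrightarrow> (a = 0 \<Longrightarrow> e = 0 \<and> \<beta>' 0 = 0) \<Longrightarrow>
    \<beta> 0 = \<beta>' 0 + a \<Longrightarrow> \<beta> (Suc 0) = \<beta>' (Suc 0) + e \<Longrightarrow> (\<And>i. \<beta> (Suc (Suc i)) = \<beta>' (Suc (Suc i)) + \<beta> i) \<Longrightarrow>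
    layers (Suc p) \<beta> (B' + e + p * a)"

lemma induct_two_steps: "P 0 \<Longrightarrow> P (Suc 0) \<Longrightarrow> (\<And>i. P i \<Longrightarrow> P (Suc (Suc i))) \<Longrightarrow> P (i::nat)"
  by (rule nat_induct2) (auto simp: numeral_2_eq_2)

text \<open>Growth of order \<open>i\<^sup>z\<^sup>-\<^sup>1\<close>. The lower bound is a binomial coefficient because the recursion for \<open>\<beta>\<close> reproduces these
  by Pascal's rule.\<close>

definition growth :: "nat \<Rightarrow> (nat \<Rightarrow> nat) \<Rightarrow> bool" where
  "growth z \<beta> \<longleftrightarrow> (if z = 0 then \<forall>i. \<beta> i = 0 else
     (\<forall>i. (i div 2 + (z - 1)) choose (z - 1) \<le> \<beta> i) \<and> (\<exists>C. \<forall>i. \<beta> i \<le> C * (i + 1) ^ (z - 1)))"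

lemma growth_step:
  assumes g: "growth z \<beta>'" and "0 < a" "a \<le> e"
    and rec: "\<beta> 0 = \<beta>' 0 + a" "\<beta> (Suc 0) = \<beta>' (Suc 0) + e" "\<And>i. \<beta> (Suc (Suc i)) = \<beta>' (Suc (Suc i)) + \<beta> i"
  shows "growth (Suc z) \<beta>"
proof (cases z)
  case 0
  then have z: "\<beta>' i = 0" for i using g by (simp add: growth_def)
  have "1 \<le> \<beta> i \<and> \<beta> i \<le> e" for i
    by (induction i rule: induct_two_steps) (use assms z in auto)
  then show ?thesis using 0 by (auto simp: growth_def)
next
  case (Suc k)
  then obtain C where low: "\<And>i. (i div 2 + k) choose k \<le> \<beta>' i" and up: "\<And>i. \<beta>' i \<le> C * (i + 1) ^ k"
    using g by (auto simp: growth_def)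
  have "(i div 2 + z) choose z \<le> \<beta> i" for i
  proof (induction i rule: induct_two_steps)
    case (3 i)
    have "(Suc (Suc i) div 2 + z) choose z = (i div 2 + z choose z) + (Suc (Suc i) div 2 + k choose k)"
      unfolding Suc by simp
    then show ?case using 3 low[of "Suc (Suc i)"] rec(3) by simp
  qed (use assms in auto)
  moreover have "\<beta> i \<le> (C + a + e) * (i + 1) ^ z" for i
  proof (induction i rule: induct_two_steps)
    case 1
    then show ?case using up[of 0] rec by simp
  next
    case 2
    have 1: "C * 2 ^ k \<le> C * 2 ^ z" using Suc by simp
    have 2: "e \<le> e * 2 ^ z" by simp
    have 3: "\<beta>' (Suc 0) \<le> C * 2 ^ k" using up[of "Suc 0"] by (simp add: numeral_2_eq_2)
    have "\<beta> (Suc 0) \<le> C * 2 ^ z + e * 2 ^ z" unfolding rec(2) using 1 2 3 by linarith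
    then show ?case by (simp add: algebra_simps numeral_2_eq_2)
  next
    case (3 i)
    let ?C = "C + a + e"
    have "?C * (i + 1) ^ z \<le> ?C * ((i + 3) ^ k * (i + 1))"
      unfolding Suc power_Suc2 by (intro mult_le_mono power_mono le_refl) auto
    moreover have "C * (i + 3) ^ k \<le> ?C * (i + 3) ^ k" by simp
    moreover have "\<beta> (Suc (Suc i)) \<le> C * (i + 3) ^ k + ?C * (i + 1) ^ z"
      using up[of "Suc (Suc i)"] 3 rec(3) by (simp add: numeral_3_eq_3)
    ultimately have "\<beta> (Suc (Suc i)) \<le> ?C * ((i + 3) ^ k * (i + 2))" by (simp add: algebra_simps)
    also have "\<dots> \<le> ?C * ((i + 3) ^ k * (i + 3))" by (intro mult_le_mono le_refl) auto
    finally show ?case unfolding Suc by (simp add: algebra_simps numeral_3_eq_3)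
  qed
  ultimately show ?thesis unfolding growth_def by auto
qed

lemma growth_zero_iff: "growth z \<beta> \<Longrightarrow> \<beta> 0 = 0 \<longleftrightarrow> z = 0"
  unfolding growth_def by (cases "z = 0") (auto dest: spec[of _ 0])

text \<open>Here \<open>z\<close> counts the nonzero levels. At the first of them \<open>e \<ge> a\<close>, later \<open>e \<ge> a + 1\<close>, and \<open>a \<ge> 1\<close> at each; the
  factor \<open>p - z + 1\<close> is the number of that first level.\<close>

lemma layers_bounds:
  assumes "layers p \<beta> B"
  shows "\<exists>z\<le>p. growth z \<beta> \<and> z \<le> \<beta> 0 \<and> (z = 0 \<or> 2 * (p - z + 1) * \<beta> 0 + z * (z + 1) \<le> 2 * (B + 1))"
  using assms
proof induction
  case layers_0
  then show ?case by (intro exI[of _ 0]) (simp add: growth_def)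
next
  case (layers_Suc p \<beta>' B' a e \<beta>)
  then obtain z where z: "z \<le> p" "growth z \<beta>'" "z \<le> \<beta>' 0"
    and B': "z = 0 \<or> 2 * (p - z + 1) * \<beta>' 0 + z * (z + 1) \<le> 2 * (B' + 1)" by blast
  show ?case
  proof (cases "a = 0")
    case True
    then have 0: "e = 0" "z = 0" "\<And>i. \<beta>' i = 0" using layers_Suc.hyps(4) z growth_zero_iff[OF z(2)]
      by (auto simp: growth_def)
    have "\<beta> i = 0" for i
      by (induction i rule: induct_two_steps) (use layers_Suc.hyps 0 True in auto)
    then show ?thesis by (intro exI[of _ 0]) (simp add: growth_def)
  next
    case False
    then have g: "growth (Suc z) \<beta>" using layers_Suc.hyps by (intro growth_step[OF z(2)]) auto
    have "2 * (Suc p - Suc z + 1) * \<beta> 0 + Suc z * (Suc z + 1) \<le> 2 * (B' + e + p * a + 1)"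
    proof (cases "z = 0")
      case True
      then have "\<beta>' 0 = 0" using growth_zero_iff[OF z(2)] by blast
      then show ?thesis using layers_Suc.hyps(2,5) True by (simp add: algebra_simps)
    next
      case nz: False
      then have ae: "a + 1 \<le> e" using layers_Suc.hyps(3) growth_zero_iff[OF z(2)] by auto
      obtain k where k: "p = z + k" using z(1) le_Suc_ex by blast
      obtain a' where a': "a = Suc a'" using False by (cases a) auto
      have "2 * (k + 1) * \<beta>' 0 + z * (z + 1) \<le> 2 * (B' + 1)" using B' nz k by simp
      then show ?thesis using ae layers_Suc.hyps(5) by (simp add: k a' algebra_simps)
    qed
    then show ?thesis using z(1,3) g False layers_Suc.hyps(5)
      by (intro exI[of _ "Suc z"]) auto
  qed
qed

lemma growth_exponent:
  assumes g: "growth z \<beta>"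
  shows "Inf {enat q |q. \<exists>w::real. \<forall>\<^sub>F i in sequentially. real (\<beta> i) \<le> w * real i powi (int q - 1)} = enat z"
    (is "Inf ?Q = _")
proof (cases "z = 0")
  case True
  then have "\<beta> i = 0" for i using g by (simp add: growth_def)
  then have "enat 0 \<in> ?Q" by (intro CollectI exI[of _ 0] conjI refl exI[of _ "0::real"]) simp
  then have "Inf ?Q \<le> enat 0" by (rule Inf_lower)
  then show ?thesis using True by (simp add: zero_enat_def[symmetric])
next
  case False
  then obtain k where k: "z = Suc k" by (cases z) auto
  obtain C where low: "\<And>i. (i div 2 + k) choose k \<le> \<beta> i" and up: "\<And>i. \<beta> i \<le> C * (i + 1) ^ k"
    using g k by (auto simp: growth_def)
  have "\<forall>\<^sub>F i in sequentially. real (\<beta> i) \<le> real C * 2 ^ k * real i powi (int z - 1)"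
  proof (rule eventually_sequentiallyI[of 1])
    fix i :: nat assume i: "1 \<le> i"
    have "real (\<beta> i) \<le> real C * (real i + 1) ^ k"
      using up[of i] by (metis (no_types, lifting) of_nat_1 of_nat_add of_nat_le_iff of_nat_mult of_nat_power)
    also have "\<dots> \<le> real C * (2 * real i) ^ k" using i by (intro mult_left_mono power_mono) auto
    finally show "real (\<beta> i) \<le> real C * 2 ^ k * real i powi (int z - 1)"
      by (simp add: k power_mult_distrib)
  qed
  then have "Inf ?Q \<le> enat z" by (intro Inf_lower) blast
  moreover have "enat z \<le> Inf ?Q"
  proof (rule Inf_greatest)
    fix x assume "x \<in> ?Q"
    then obtain q w where x: "x = enat q"
      and ev: "\<forall>\<^sub>F i in sequentially. real (\<beta> i) \<le> w * real i powi (int q - 1)" by blast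
    show "enat z \<le> x"
    proof (rule ccontr)
      assume "\<not> enat z \<le> x"
      then have q: "q \<le> k" using x k by simp
      define \<kappa> where "\<kappa> = (1 / (2 * real k)) ^ k"
      have "\<kappa> > 0" unfolding \<kappa>_def by (cases "k = 0") auto
      have "\<forall>\<^sub>F i in sequentially. \<bar>w\<bar> / \<kappa> < real i"
        using filterlim_real_sequentially by (simp add: filterlim_at_top_dense)
      with ev eventually_gt_at_top[of 0] have "\<forall>\<^sub>F i in sequentially. False"
      proof eventually_elim
        case (elim i)
        have "real i powi (int q - 1) \<le> real i powi (int k - 1)"
          using elim(2) q by (intro power_int_increasing) auto
        then have "w * real i powi (int q - 1) \<le> \<bar>w\<bar> * real i powi (int k - 1)"
          by (intro mult_mono) auto
        also have "real i powi (int k - 1) = real i ^ k / real i"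
          using elim(2) by (simp add: power_int_diff)
        finally have 1: "real (\<beta> i) \<le> \<bar>w\<bar> * (real i ^ k / real i)" using elim(1) by simp
        have "i \<le> 2 * (i div 2 + k)" if "k \<noteq> 0" using that by presburger
        then have "real i \<le> 2 * real (i div 2 + k)" if "k \<noteq> 0"
          using that by (metis of_nat_le_iff of_nat_mult of_nat_numeral)
        then have "real i / (2 * real k) \<le> real (i div 2 + k) / real k"
          by (cases "k = 0") (auto simp: field_simps)
        then have "(real i / (2 * real k)) ^ k \<le> (real (i div 2 + k) / real k) ^ k"
          by (intro power_mono) auto
        also have "\<dots> \<le> real ((i div 2 + k) choose k)" by (intro binomial_ge_n_over_k_pow_k) simp
        also have "\<dots> \<le> real (\<beta> i)" using low by simp
        finally have "\<kappa> * real i ^ k \<le> \<bar>w\<bar> * (real i ^ k / real i)"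
          using 1 unfolding \<kappa>_def by (simp add: power_divide)
        then have "\<kappa> * real i ^ k * real i \<le> \<bar>w\<bar> * real i ^ k" using elim(2) by (simp add: field_simps)
        then have "\<kappa> * real i \<le> \<bar>w\<bar>" using elim(2) by (simp add: mult.commute mult.left_commute)
        then show ?case using elim(3) \<open>\<kappa> > 0\<close> by (simp add: field_simps)
      qed
      then show False by simp
    qed
  qed
  ultimately show ?thesis by simp
qed

section \<open>Ring structures as quotients of a ring type\<close>

text \<open>The product of all commutative rings carried by subsets of the type \<open>'a\<close>, one factor for each ring structure.
  Evaluation at a structure maps it onto that ring. The additional factor of integers makes \<open>0 \<noteq> 1\<close> even if no
  structure is nontrivial.\<close>

typedef (overloaded) ('a, 'x) uring =
  "{F :: ('a, 'x) ring_scheme \<Rightarrow> 'a. \<forall>S. if cring S then F S \<in> carrier S else F S = undefined} \<times> (UNIV :: int set)"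
  by (intro exI[of _ "(\<lambda>S. if cring S then \<zero>\<^bsub>S\<^esub> else undefined, 0)"])
    (auto intro!: abelian_monoid.zero_closed abelian_group.axioms ring.is_abelian_group cring.axioms)

definition ev :: "('a, 'x) ring_scheme \<Rightarrow> ('a, 'x) uring \<Rightarrow> 'a" where
  "ev S x = fst (Rep_uring x) S"

definition ipart :: "('a, 'x) uring \<Rightarrow> int" where
  "ipart x = snd (Rep_uring x)"

definition uring :: "(('a, 'x) ring_scheme \<Rightarrow> 'a) \<Rightarrow> int \<Rightarrow> ('a, 'x) uring" where
  "uring F k = Abs_uring (\<lambda>S. if cring S then if F S \<in> carrier S then F S else \<zero>\<^bsub>S\<^esub> else undefined, k)"

lemma cring_zero_closed: "cring S \<Longrightarrow> \<zero>\<^bsub>S\<^esub> \<in> carrier S"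
  by (rule cring.cring_simprules)

lemma Rep_uring_uring:
  "Rep_uring (uring F k) =
    (\<lambda>S. if cring S then if F S \<in> carrier S then F S else \<zero>\<^bsub>S\<^esub> else undefined, k)"
  unfolding uring_def by (rule Abs_uring_inverse) (auto simp: cring_zero_closed)

lemma ev_uring: "cring S \<Longrightarrow> F S \<in> carrier S \<Longrightarrow> ev S (uring F k) = F S"
  by (simp add: ev_def Rep_uring_uring)

lemma ipart_uring [simp]: "ipart (uring F k) = k"
  by (simp add: ipart_def Rep_uring_uring)

lemma ev_closed: "cring S \<Longrightarrow> ev S x \<in> carrier S"
  using Rep_uring[of x] unfolding ev_def by (auto dest!: spec[of _ S])

lemma uring_eqI:
  assumes "\<And>S. cring S \<Longrightarrow> ev S x = ev S y" "ipart x = ipart y"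
  shows "x = y"
proof -
  have "fst (Rep_uring x) S = fst (Rep_uring y) S" for S
  proof (cases "cring S")
    case False
    then show ?thesis using Rep_uring[of x] Rep_uring[of y] by (auto dest!: spec[of _ S])
  qed (use assms(1) in \<open>simp add: ev_def\<close>)
  then show ?thesis
    using assms(2) unfolding ipart_def by (metis Rep_uring_inject prod_eqI ext)
qed

instantiation uring :: (type, type) comm_ring_1
begin

definition "0 = uring (\<lambda>S. \<zero>\<^bsub>S\<^esub>) 0"
definition "1 = uring (\<lambda>S. \<one>\<^bsub>S\<^esub>) 1"
definition "x + y = uring (\<lambda>S. ev S x \<oplus>\<^bsub>S\<^esub> ev S y) (ipart x + ipart y)"
definition "x * y = uring (\<lambda>S. ev S x \<otimes>\<^bsub>S\<^esub> ev S y) (ipart x * ipart y)"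
definition "- x = uring (\<lambda>S. \<ominus>\<^bsub>S\<^esub> ev S x) (- ipart x)"
definition "(x :: ('a, 'b) uring) - y = x + - y"

lemma ev_ops:
  assumes "cring S"
  shows "ev S 0 = \<zero>\<^bsub>S\<^esub>" "ev S 1 = \<one>\<^bsub>S\<^esub>" "ev S (x + y) = ev S x \<oplus>\<^bsub>S\<^esub> ev S y"
    "ev S (x * y) = ev S x \<otimes>\<^bsub>S\<^esub> ev S y" "ev S (- x) = \<ominus>\<^bsub>S\<^esub> ev S x"
proof -
  interpret cring S by fact
  show "ev S 0 = \<zero>\<^bsub>S\<^esub>" "ev S 1 = \<one>\<^bsub>S\<^esub>" "ev S (x + y) = ev S x \<oplus>\<^bsub>S\<^esub> ev S y"
    "ev S (x * y) = ev S x \<otimes>\<^bsub>S\<^esub> ev S y" "ev S (- x) = \<ominus>\<^bsub>S\<^esub> ev S x"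
    unfolding zero_uring_def one_uring_def plus_uring_def times_uring_def uminus_uring_def
    by (simp_all add: ev_uring assms ev_closed)
qed

lemma ipart_ops:
  "ipart (0 :: ('a, 'b) uring) = 0" "ipart (1 :: ('a, 'b) uring) = 1"
  "ipart (x + y :: ('a, 'b) uring) = ipart x + ipart y" "ipart (x * y) = ipart x * ipart y"
  "ipart (- x) = - ipart x"
  unfolding zero_uring_def one_uring_def plus_uring_def times_uring_def uminus_uring_def by simp_all

instance
proof
  fix x y z :: "('a, 'b) uring"
  show "x + y + z = x + (y + z)" "x + y = y + x" "0 + x = x" "- x + x = 0" "x * y * z = x * (y * z)"
    "x * y = y * x" "1 * x = x" "(x + y) * z = x * z + y * z"
    by (rule uring_eqI; simp add: ev_ops ipart_ops ev_closed cring.cring_simprules algebra_simps)+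
  show "x - y = x + - y" by (rule minus_uring_def)
  show "(0 :: ('a, 'b) uring) \<noteq> 1"
    using ipart_ops(1,2) by (metis zero_neq_one)
qed

end

lemma ev_surj: "cring S \<Longrightarrow> ev S ` UNIV = carrier S"
proof (intro equalityI subsetI)
  fix a assume "cring S" "a \<in> carrier S"
  then have "ev S (uring (\<lambda>_. a) 0) = a" by (simp add: ev_uring)
  then show "a \<in> ev S ` UNIV" by (metis rangeI)
qed (auto simp: ev_closed)

lemma mod_hom_iff:
  "h \<in> mod_hom R M N \<longleftrightarrow> (\<forall>x\<in>carrier M. h x \<in> carrier N) \<and>
     (\<forall>x\<in>carrier M. \<forall>y\<in>carrier M. h (x \<oplus>\<^bsub>M\<^esub> y) = h x \<oplus>\<^bsub>N\<^esub> h y) \<and>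
     (\<forall>a\<in>carrier R. \<forall>x\<in>carrier M. h (a \<odot>\<^bsub>M\<^esub> x) = a \<odot>\<^bsub>N\<^esub> h x)"
  by (auto simp: mod_hom_def hom_def)

lemma free_mod_simps [simp]:
  "carrier (free_mod R n) = {..<n} \<rightarrow>\<^sub>E carrier R" "\<zero>\<^bsub>free_mod R n\<^esub> = (\<lambda>i\<in>{..<n}. \<zero>\<^bsub>R\<^esub>)"
  "x \<oplus>\<^bsub>free_mod R n\<^esub> y = (\<lambda>i\<in>{..<n}. x i \<oplus>\<^bsub>R\<^esub> y i)"
  "a \<odot>\<^bsub>free_mod R n\<^esub> x = (\<lambda>i\<in>{..<n}. a \<otimes>\<^bsub>R\<^esub> x i)"
  by (simp_all add: free_mod_def)

lemma free_mod_module: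
  fixes R (structure)
  assumes "cring R"
  shows "module R (free_mod R n)"
proof -
  interpret cring R by fact
  have mem: "x i \<in> carrier R" if "x \<in> {..<n} \<rightarrow>\<^sub>E carrier R" "i < n" for x i
    using that by auto
  have ext: "(\<lambda>i\<in>{..<n}. g i) = x" if "x \<in> {..<n} \<rightarrow>\<^sub>E carrier R" "\<And>i. i < n \<Longrightarrow> g i = x i" for g x
    using that by (intro PiE_ext[of _ "{..<n}" "\<lambda>_. carrier R"]) (auto simp: PiE_def Pi_def)
  have req: "(\<lambda>i\<in>{..<n}. u i) = (\<lambda>i\<in>{..<n}. v i)" if "\<And>i. i < n \<Longrightarrow> u i = v i" for u v :: "nat \<Rightarrow> 'a"
    using that by (intro restrict_ext) simp
  show ?thesis
  proof (rule moduleI)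
    show "abelian_group (free_mod R n)"
    proof (rule abelian_groupI)
      fix x assume x: "x \<in> carrier (free_mod R n)"
      then have neg: "(\<lambda>i\<in>{..<n}. \<ominus> x i) \<in> carrier (free_mod R n)"
        by (simp add: restrict_PiE_iff mem)
      have "(\<lambda>i\<in>{..<n}. \<ominus> x i) \<oplus>\<^bsub>free_mod R n\<^esub> x = \<zero>\<^bsub>free_mod R n\<^esub>"
        using x unfolding free_mod_simps by (intro req) (simp add: l_neg mem)
      then show "\<exists>y\<in>carrier (free_mod R n). y \<oplus>\<^bsub>free_mod R n\<^esub> x = \<zero>\<^bsub>free_mod R n\<^esub>"
        using neg by (rule bexI)
      show "\<zero>\<^bsub>free_mod R n\<^esub> \<oplus>\<^bsub>free_mod R n\<^esub> x = x"
        using x unfolding free_mod_simps by (intro ext) (simp_all add: mem)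
      fix y assume y: "y \<in> carrier (free_mod R n)"
      show "x \<oplus>\<^bsub>free_mod R n\<^esub> y \<in> carrier (free_mod R n)"
        using x y by (simp add: restrict_PiE_iff mem)
      show "x \<oplus>\<^bsub>free_mod R n\<^esub> y = y \<oplus>\<^bsub>free_mod R n\<^esub> x"
        using x y unfolding free_mod_simps by (intro req) (simp add: a_comm mem)
      fix z assume z: "z \<in> carrier (free_mod R n)"
      show "(x \<oplus>\<^bsub>free_mod R n\<^esub> y) \<oplus>\<^bsub>free_mod R n\<^esub> z = x \<oplus>\<^bsub>free_mod R n\<^esub> (y \<oplus>\<^bsub>free_mod R n\<^esub> z)"
        using x y z unfolding free_mod_simps by (intro req) (simp add: a_assoc mem)
    next
      show "\<zero>\<^bsub>free_mod R n\<^esub> \<in> carrier (free_mod R n)" by (simp add: restrict_PiE_iff)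
    qed
    show "cring R" by fact
  next
    fix x assume x: "x \<in> carrier (free_mod R n)"
    show "\<one> \<odot>\<^bsub>free_mod R n\<^esub> x = x"
      using x unfolding free_mod_simps by (intro ext) (simp_all add: mem)
    fix a assume a: "a \<in> carrier R"
    show "a \<odot>\<^bsub>free_mod R n\<^esub> x \<in> carrier (free_mod R n)"
      using a x by (simp add: restrict_PiE_iff mem)
    fix y assume y: "y \<in> carrier (free_mod R n)"
    show "a \<odot>\<^bsub>free_mod R n\<^esub> (x \<oplus>\<^bsub>free_mod R n\<^esub> y)
        = a \<odot>\<^bsub>free_mod R n\<^esub> x \<oplus>\<^bsub>free_mod R n\<^esub> a \<odot>\<^bsub>free_mod R n\<^esub> y"
      using a x y unfolding free_mod_simps by (intro req) (simp add: r_distr mem)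
  next
    fix a b x assume a: "a \<in> carrier R" "b \<in> carrier R" and x: "x \<in> carrier (free_mod R n)"
    show "(a \<oplus> b) \<odot>\<^bsub>free_mod R n\<^esub> x
        = a \<odot>\<^bsub>free_mod R n\<^esub> x \<oplus>\<^bsub>free_mod R n\<^esub> b \<odot>\<^bsub>free_mod R n\<^esub> x"
      using a x unfolding free_mod_simps by (intro req) (simp add: l_distr mem)
    show "(a \<otimes> b) \<odot>\<^bsub>free_mod R n\<^esub> x = a \<odot>\<^bsub>free_mod R n\<^esub> (b \<odot>\<^bsub>free_mod R n\<^esub> x)"
      using a x unfolding free_mod_simps by (intro req) (simp add: m_assoc mem)
  qed
qed

text \<open>A ring with carrier as a quotient of a ring type. Elements of free modules then lift to vectors, and
  equality in the free module is congruence modulo the kernel.\<close>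

locale ring_presentation = cring R for R :: "('b, 'y) ring_scheme" (structure) +
  fixes \<phi> :: "'r::comm_ring_1 \<Rightarrow> 'b"
  assumes phi_add: "\<phi> (x + y) = \<phi> x \<oplus> \<phi> y" and phi_mult: "\<phi> (x * y) = \<phi> x \<otimes> \<phi> y"
    and phi_one: "\<phi> 1 = \<one>" and phi_surj: "range \<phi> = carrier R"
begin

definition ker :: "'r set" where "ker = {x. \<phi> x = \<zero>}"

lemma phi_closed [simp, intro]: "\<phi> x \<in> carrier R" using phi_surj by blast

lemma phi_zero [simp]: "\<phi> 0 = \<zero>"
proof -
  have "\<phi> 0 \<oplus> \<phi> 0 = \<phi> 0 \<oplus> \<zero>" using phi_add[of 0 0] by simp
  then show ?thesis by (simp only: add.l_cancel phi_closed zero_closed)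
qed

lemma phi_eq_iff: "\<phi> x = \<phi> y \<longleftrightarrow> x - y \<in> ker"
proof -
  have x: "\<phi> x = \<phi> (x - y) \<oplus> \<phi> y" using phi_add[of "x - y" y] by simp
  show ?thesis
  proof
    assume "\<phi> x = \<phi> y"
    then have "\<phi> (x - y) \<oplus> \<phi> y = \<zero> \<oplus> \<phi> y" using x by simp
    then show "x - y \<in> ker" unfolding ker_def by (simp only: add.r_cancel phi_closed zero_closed mem_Collect_eq)
  qed (simp add: x ker_def)
qed

lemma ker_ideal: "is_ideal ker"
  by (simp add: is_ideal_def ker_def phi_add phi_mult)

definition vecmap :: "nat \<Rightarrow> (nat \<Rightarrow> 'r) \<Rightarrow> nat \<Rightarrow> 'b" where
  "vecmap n x = (\<lambda>i\<in>{..<n}. \<phi> (x i))"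

lemma vecmap_closed [simp, intro]: "vecmap n x \<in> {..<n} \<rightarrow>\<^sub>E carrier R"
  by (simp add: vecmap_def)

lemma vecmap_eq_iff: "vecmap n x = vecmap n y \<longleftrightarrow> eqmod n ker x y"
  by (auto simp: vecmap_def eqmod_def phi_eq_iff[symmetric] ker_ideal fun_eq_iff restrict_def)

lemma vecmap_surj: "y \<in> {..<n} \<rightarrow>\<^sub>E carrier R \<Longrightarrow> \<exists>x. vecmap n x = y"
proof -
  assume y: "y \<in> {..<n} \<rightarrow>\<^sub>E carrier R"
  then have "\<forall>i. \<exists>a. i < n \<longrightarrow> \<phi> a = y i" using phi_surj by (metis PiE_mem lessThan_iff rangeE)
  then obtain x where "\<forall>i. i < n \<longrightarrow> \<phi> (x i) = y i" by metis
  then show ?thesis using y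
    by (intro exI[of _ x] PiE_ext[of _ "{..<n}" "\<lambda>_. carrier R"]) (auto simp: vecmap_def)
qed

lemma free_modE:
  assumes "x \<in> carrier (free_mod R n)"
  obtains u where "x = vecmap n u"
proof -
  have "\<exists>u. vecmap n u = x" by (rule vecmap_surj) (use assms in simp)
  then obtain u where "vecmap n u = x" ..
  then show thesis using that[of u] by simp
qed

lemma vecmap_add: "vecmap n (x + y) = vecmap n x \<oplus>\<^bsub>free_mod R n\<^esub> vecmap n y"
  and vecmap_scl: "vecmap n (c \<star> x) = \<phi> c \<odot>\<^bsub>free_mod R n\<^esub> vecmap n x"
  and vecmap_zero: "vecmap n 0 = \<zero>\<^bsub>free_mod R n\<^esub>"
  by (auto simp: vecmap_def vec_apply phi_add phi_mult intro!: restrict_ext)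

lemma free_module: "module R (free_mod R n)"
  by (rule free_mod_module) (rule is_cring)

text \<open>A linear map from the free module of rank \<open>n\<close> to \<open>M\<close>, pulled back to vectors over the ring type.\<close>

definition lifted_linear :: "('b, 'l, 'z) module_scheme \<Rightarrow> nat \<Rightarrow> ((nat \<Rightarrow> 'r) \<Rightarrow> 'l) \<Rightarrow> bool" where
  "lifted_linear M n \<alpha> \<longleftrightarrow> (\<forall>x. \<alpha> x \<in> carrier M) \<and> (\<forall>x y. \<alpha> (x + y) = \<alpha> x \<oplus>\<^bsub>M\<^esub> \<alpha> y) \<and>
     (\<forall>c x. \<alpha> (c \<star> x) = \<phi> c \<odot>\<^bsub>M\<^esub> \<alpha> x) \<and> (\<forall>x. eqmod n ker x 0 \<longrightarrow> \<alpha> x = \<zero>\<^bsub>M\<^esub>)"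

lemma lifted_linearD:
  assumes "lifted_linear M n \<alpha>"
  shows "\<alpha> x \<in> carrier M" "\<alpha> (x + y) = \<alpha> x \<oplus>\<^bsub>M\<^esub> \<alpha> y" "\<alpha> (c \<star> x) = \<phi> c \<odot>\<^bsub>M\<^esub> \<alpha> x"
    "eqmod n ker x 0 \<Longrightarrow> \<alpha> x = \<zero>\<^bsub>M\<^esub>" "\<alpha> 0 = \<zero>\<^bsub>M\<^esub>"
  using assms ker_ideal by (simp_all add: lifted_linear_def)

lemma lifted_linear_cong:
  assumes "module R M" "lifted_linear M n \<alpha>" "eqmod n ker x y"
  shows "\<alpha> x = \<alpha> y"
proof -
  interpret module R M by fact
  have "\<alpha> x = \<alpha> (x - y) \<oplus>\<^bsub>M\<^esub> \<alpha> y" using lifted_linearD(2)[OF assms(2), of "x - y" y] by simp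
  also have "\<alpha> (x - y) = \<zero>\<^bsub>M\<^esub>" using lifted_linearD(4)[OF assms(2)] assms(3) eqmod_diff_iff by blast
  finally show ?thesis using lifted_linearD(1)[OF assms(2)] by simp
qed

lemma lifted_linear_vecmap: "lin k H \<Longrightarrow> lifted_linear (free_mod R n) k (\<lambda>x. vecmap n (H x))"
  unfolding lifted_linear_def
  by (auto simp: vecmap_add[simplified] vecmap_scl[simplified] lin_add lin_scl vecmap_eq_iff
      vecmap_zero[simplified, symmetric] eqmod_lin_0)

lemma hom_lifted_linear:
  assumes "module R M" "h \<in> mod_hom R (free_mod R n) M"
  shows "lifted_linear M n (\<lambda>x. h (vecmap n x))"
proof -
  interpret module R M by fact
  have h: "x \<in> {..<n} \<rightarrow>\<^sub>E carrier R \<Longrightarrow> h x \<in> carrier M" for x using assms(2) by (simp add: mod_hom_iff)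
  have hs: "h (\<phi> c \<odot>\<^bsub>free_mod R n\<^esub> vecmap n x) = \<phi> c \<odot>\<^bsub>M\<^esub> h (vecmap n x)" for c x
    using assms(2) by (simp add: mod_hom_iff)
  have ha: "h (vecmap n x \<oplus>\<^bsub>free_mod R n\<^esub> vecmap n y) = h (vecmap n x) \<oplus>\<^bsub>M\<^esub> h (vecmap n y)" for x y
    using assms(2) by (simp add: mod_hom_iff)
  have "h (vecmap n x) = \<zero>\<^bsub>M\<^esub>" if "eqmod n ker x 0" for x
  proof -
    have "vecmap n x = vecmap n (0 \<star> x)" using that by (simp add: vecmap_eq_iff scl_zero_left)
    then have "h (vecmap n x) = \<phi> 0 \<odot>\<^bsub>M\<^esub> h (vecmap n x)" using hs[of 0 x] unfolding vecmap_scl by argo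
    then show ?thesis using h by (simp add: smult_l_null)
  qed
  then show ?thesis
    unfolding lifted_linear_def vecmap_add vecmap_scl by (simp add: h hs[simplified] ha[simplified])
qed

lemma lifted_linear_hom:
  assumes "module R M" "lifted_linear M n \<alpha>"
  shows "\<exists>h\<in>mod_hom R (free_mod R n) M. \<forall>x. h (vecmap n x) = \<alpha> x"
proof -
  define h where "h y = \<alpha> (SOME x. vecmap n x = y)" for y
  have h: "h (vecmap n x) = \<alpha> x" for x
  proof -
    have "vecmap n (SOME x'. vecmap n x' = vecmap n x) = vecmap n x" by (rule someI[of _ x]) simp
    then show ?thesis unfolding h_def vecmap_eq_iff by (rule lifted_linear_cong[OF assms])
  qed
  have "h \<in> mod_hom R (free_mod R n) M"
    unfolding mod_hom_iff
  proof (intro conjI ballI)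
    fix x assume "x \<in> carrier (free_mod R n)"
    then obtain u where u: "x = vecmap n u" by (rule free_modE)
    show "h x \<in> carrier M" unfolding u h by (rule lifted_linearD(1)[OF assms(2)])
    fix a assume "a \<in> carrier R"
    then obtain k where k: "a = \<phi> k" using phi_surj by blast
    show "h (a \<odot>\<^bsub>free_mod R n\<^esub> x) = a \<odot>\<^bsub>M\<^esub> h x"
      unfolding u k vecmap_scl[symmetric] h by (rule lifted_linearD(3)[OF assms(2)])
  next
    fix x y assume x: "x \<in> carrier (free_mod R n)" and y: "y \<in> carrier (free_mod R n)"
    from x obtain u where x: "x = vecmap n u" by (rule free_modE)
    from y obtain v where y: "y = vecmap n v" by (rule free_modE)
    note u = x y
    show "h (x \<oplus>\<^bsub>free_mod R n\<^esub> y) = h x \<oplus>\<^bsub>M\<^esub> h y"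
      unfolding u vecmap_add[symmetric] h by (rule lifted_linearD(2)[OF assms(2)])
  qed
  then show ?thesis using h by blast
qed

lemma lifted_linear_ext:
  assumes "module R M" "lifted_linear M n \<alpha>" "lifted_linear M n \<beta>" "\<And>j. j < n \<Longrightarrow> \<alpha> (stdvec j) = \<beta> (stdvec j)"
  shows "\<alpha> x = \<beta> x"
proof -
  have "\<alpha> (\<Sum>j<k. x j \<star> stdvec j) = \<beta> (\<Sum>j<k. x j \<star> stdvec j)" if "k \<le> n" for k
    using that
  proof (induction k)
    case 0
    then show ?case unfolding lessThan_0 sum.empty lifted_linearD(5)[OF assms(2)] lifted_linearD(5)[OF assms(3)] by simp
  next
    case (Suc k)
    then show ?case
      unfolding sum.lessThan_Suc by (simp add: lifted_linearD(2,3)[OF assms(2)] lifted_linearD(2,3)[OF assms(3)] assms(4))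
  qed
  moreover have "eqmod n ker x (\<Sum>j<n. x j \<star> stdvec j)"
    using ker_ideal by (auto simp: eqmod_def vec_apply stdvec_def if_distrib ideal_zero cong: if_cong)
  ultimately show ?thesis using lifted_linear_cong[OF assms(1,2)] lifted_linear_cong[OF assms(1,3)] by simp
qed

lemma hom_lin:
  assumes "h \<in> mod_hom R (free_mod R k) (free_mod R n)"
  shows "\<exists>H. lin k H \<and> (\<forall>x. h (vecmap k x) = vecmap n (H x))"
proof -
  note h = hom_lifted_linear[OF free_module assms]
  have "\<exists>v. h (vecmap k (stdvec j)) = vecmap n v" for j
  proof -
    obtain v where "h (vecmap k (stdvec j)) = vecmap n v" using lifted_linearD(1)[OF h] by (rule free_modE)
    then show ?thesis by (intro exI)
  qed
  then obtain v where v: "\<And>j. h (vecmap k (stdvec j)) = vecmap n (v j)" by metis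
  define H where "H = (\<lambda>x. \<Sum>j<k. x j \<star> v j)"
  have H: "lin k H" unfolding H_def by (rule linI_expand)
  have "H (stdvec j) = v j" if "j < k" for j
    unfolding H_def using that by (rule sum_stdvec)
  then have Hv: "h (vecmap k (stdvec j)) = vecmap n (H (stdvec j))" if "j < k" for j
    using that v by simp
  have "h (vecmap k x) = vecmap n (H x)" for x
    by (rule lifted_linear_ext[OF free_module h lifted_linear_vecmap[OF H] Hv])
  then show ?thesis using H by blast
qed

lemma finsum_vecmap:
  "finite A \<Longrightarrow> (\<Oplus>\<^bsub>free_mod R n\<^esub>j\<in>A. vecmap n (g j)) = vecmap n (\<Sum>j\<in>A. g j)"
proof (induction A rule: finite_induct)
  case empty
  interpret M: module R "free_mod R n" by (rule free_module)
  show ?case using vecmap_zero by simp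
next
  case (insert a A)
  interpret M: module R "free_mod R n" by (rule free_module)
  have "(\<Oplus>\<^bsub>free_mod R n\<^esub>j\<in>insert a A. vecmap n (g j))
      = vecmap n (g a) \<oplus>\<^bsub>free_mod R n\<^esub> (\<Oplus>\<^bsub>free_mod R n\<^esub>j\<in>A. vecmap n (g j))"
    using insert.hyps by (intro M.finsum_insert) auto
  then show ?case unfolding insert.IH vecmap_add[symmetric] sum.insert[OF insert.hyps] .
qed

end

section \<open>Lifting resolutions to vectors\<close>

locale local_presentation = ring_presentation R \<phi> + local_quotient J0 m
  for R :: "('b, 'y) ring_scheme" (structure) and \<phi> :: "'r::comm_ring_1 \<Rightarrow> 'b" and J0 m :: "'r set" +
  assumes J0_ker: "J0 \<subseteq> ker" and ker_m: "ker \<subseteq> m"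
begin

lemma phi_mem_iff: "\<phi> x \<in> \<phi> ` m \<longleftrightarrow> x \<in> m"
proof
  assume "\<phi> x \<in> \<phi> ` m"
  then obtain y where "y \<in> m" "\<phi> x = \<phi> y" by blast
  then have "x - y \<in> m" using phi_eq_iff ker_m by blast
  from ideal_add[OF m this \<open>y \<in> m\<close>] show "x \<in> m" by simp
qed simp

lemma unit_outside_max:
  assumes "a \<in> carrier R" "a \<notin> \<phi> ` m"
  shows "\<exists>b\<in>carrier R. a \<otimes> b = \<one>"
proof -
  obtain x where x: "a = \<phi> x" using assms(1) phi_surj by blast
  then have "x \<notin> m" using assms(2) by blast
  then obtain y where "x * y - 1 \<in> ker" using unit J0_ker by blast
  then have "\<phi> (x * y) = \<phi> 1" using phi_eq_iff by blast
  then show ?thesis using x by (intro bexI[of _ "\<phi> y"]) (simp_all add: phi_mult phi_one)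
qed

text \<open>Outside the image of \<open>m\<close> there are only units, so it contains every proper ideal.\<close>

lemma max_ideal_eq: "max_ideal R = \<phi> ` m"
proof -
  have I: "ideal (\<phi> ` m) R"
  proof (rule idealI)
    show "ring R" by (rule ring_axioms)
    show "subgroup (\<phi> ` m) (add_monoid R)"
    proof (rule add.subgroupI)
      show "\<phi> ` m \<subseteq> carrier R" by auto
      show "\<phi> ` m \<noteq> {}" using ideal_zero[OF m] by blast
      fix a assume "a \<in> \<phi> ` m"
      then obtain x where x: "a = \<phi> x" "x \<in> m" by blast
      have "\<phi> (- x) \<oplus> \<phi> x = \<zero>" using phi_add[of "- x" x] by simp
      then have "\<ominus> \<phi> x = \<phi> (- x)" by (intro minus_equality) auto
      then show "\<ominus> a \<in> \<phi> ` m" using x ideal_uminus[OF m] by blast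
      fix b assume "b \<in> \<phi> ` m"
      then obtain y where y: "b = \<phi> y" "y \<in> m" by blast
      show "a \<oplus> b \<in> \<phi> ` m"
        unfolding x y phi_add[symmetric] using ideal_add[OF m x(2) y(2)] by blast
    qed
    fix a x assume "a \<in> \<phi> ` m" "x \<in> carrier R"
    then obtain u v where u: "a = \<phi> u" "u \<in> m" "x = \<phi> v" using phi_surj by blast
    show "x \<otimes> a \<in> \<phi> ` m" unfolding u phi_mult[symmetric] using ideal_mult_left[OF m u(2)] by blast
    show "a \<otimes> x \<in> \<phi> ` m" unfolding u phi_mult[symmetric] using ideal_mult_right[OF m u(2)] by blast
  qed
  have one: "\<one> \<notin> \<phi> ` m" using one_m phi_mem_iff[of 1] by (simp add: phi_one)
  have carrier: "carrier R \<noteq> \<phi> ` m" using one one_closed by blast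
  have proper: "I' \<subseteq> \<phi> ` m" if I': "ideal I' R" "I' \<noteq> carrier R" for I'
  proof
    fix a assume a: "a \<in> I'"
    then have ac: "a \<in> carrier R" by (rule ideal.Icarr[OF I'(1)])
    show "a \<in> \<phi> ` m"
    proof (rule ccontr)
      assume "a \<notin> \<phi> ` m"
      then obtain b where "b \<in> carrier R" "a \<otimes> b = \<one>" using unit_outside_max[OF ac] by blast
      then have "\<one> \<in> I'" using ideal.I_r_closed[OF I'(1) a, of b] by simp
      then show False using ideal.one_imp_carrier[OF I'(1)] I'(2) by simp
    qed
  qed
  have max: "maximalideal (\<phi> ` m) R"
    using proper by (intro maximalidealI I carrier) blast
  show ?thesis
    unfolding max_ideal_def
  proof (rule the_equality)
    show "maximalideal (\<phi> ` m) R" by (rule max)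
    fix I' assume "maximalideal I' R"
    then interpret I': maximalideal I' R .
    have "I' \<subseteq> \<phi> ` m" using I'.I_notcarr by (intro proper I'.ideal_axioms) auto
    then show "I' = \<phi> ` m"
      using I'.I_maximal[OF I] carrier by auto
  qed
qed

lemma eqmod_ker: "eqmod n J0 x y \<Longrightarrow> eqmod n ker x y"
  using eqmod_mono J0_ker ker_ideal by blast

text \<open>A minimal free resolution of \<open>L\<close>, with all maps given on vectors over the ring type.\<close>

definition lifted_resolution ::
  "('b, 'l, 'z) module_scheme \<Rightarrow> (nat \<Rightarrow> nat) \<Rightarrow> (nat \<Rightarrow> (nat \<Rightarrow> 'r) \<Rightarrow> nat \<Rightarrow> 'r) \<Rightarrow> ((nat \<Rightarrow> 'r) \<Rightarrow> 'l) \<Rightarrow> bool" where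
  "lifted_resolution L n D \<epsilon> \<longleftrightarrow> lifted_linear L (n 0) \<epsilon> \<and> range \<epsilon> = carrier L \<and> minimal_exact ker n D \<and>
     (\<forall>x. \<epsilon> x = \<zero>\<^bsub>L\<^esub> \<longleftrightarrow> (\<exists>y. eqmod (n 0) ker x (D 0 y)))"

lemma lifted_resolutionD:
  assumes "lifted_resolution L n D \<epsilon>"
  shows "lifted_linear L (n 0) \<epsilon>" "range \<epsilon> = carrier L" "minimal_exact ker n D"
    "\<epsilon> x = \<zero>\<^bsub>L\<^esub> \<longleftrightarrow> (\<exists>y. eqmod (n 0) ker x (D 0 y))"
  using assms by (simp_all add: lifted_resolution_def)

lemma vecmap_zero_iff: "vecmap n x = \<zero>\<^bsub>free_mod R n\<^esub> \<longleftrightarrow> eqmod n ker x 0"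
  unfolding vecmap_zero[symmetric] by (rule vecmap_eq_iff)

lemma image_free_mod: "h ` carrier (free_mod R n) = range (\<lambda>x. h (vecmap n x))"
proof (intro equalityI subsetI)
  fix z assume "z \<in> h ` carrier (free_mod R n)"
  then obtain y where y: "y \<in> carrier (free_mod R n)" "z = h y" by (rule imageE)
  from y(1) obtain u where "y = vecmap n u" by (rule free_modE)
  then show "z \<in> range (\<lambda>x. h (vecmap n x))" using y(2) by simp
qed auto

lemma image_iff_lift:
  assumes "\<And>y. h (vecmap k y) = vecmap n (H y)"
  shows "vecmap n x \<in> h ` carrier (free_mod R k) \<longleftrightarrow> (\<exists>y. eqmod n ker x (H y))"
  unfolding image_free_mod assms image_iff vecmap_eq_iff by simp

lemma lift_resolution:
  assumes res: "minimal_free_resolution R n d e L"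
    and D: "\<And>i. lin (n (Suc i)) (D i)" "\<And>i x. d (Suc i) (vecmap (n (Suc i)) x) = vecmap (n i) (D i x)"
  shows "lifted_resolution L n D (\<lambda>x. e (vecmap (n 0) x))"
proof -
  have L: "module R L" and e: "e \<in> mod_hom R (free_mod R (n 0)) L"
    and es: "e ` carrier (free_mod R (n 0)) = carrier L"
    and k0: "hom_ker (free_mod R (n 0)) L e = d (Suc 0) ` carrier (free_mod R (n (Suc 0)))"
    and k: "\<And>i. hom_ker (free_mod R (n (Suc i))) (free_mod R (n i)) (d (Suc i))
        = d (Suc (Suc i)) ` carrier (free_mod R (n (Suc (Suc i))))"
    and min: "\<And>i x j. x \<in> carrier (free_mod R (n (Suc i))) \<Longrightarrow> j < n i \<Longrightarrow> d (Suc i) x j \<in> max_ideal R"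
    using res unfolding minimal_free_resolution_def resolution_def by simp_all
  have cl: "vecmap i x \<in> carrier (free_mod R i)" for i x by simp
  have ex: "eqmod (n i) ker (D i x) 0 \<longleftrightarrow> (\<exists>y. eqmod (n (Suc i)) ker x (D (Suc i) y))" for i x
  proof -
    have "eqmod (n i) ker (D i x) 0 \<longleftrightarrow>
        vecmap (n (Suc i)) x \<in> hom_ker (free_mod R (n (Suc i))) (free_mod R (n i)) (d (Suc i))"
      unfolding hom_ker_def mem_Collect_eq D(2) vecmap_zero_iff using cl by blast
    then show ?thesis unfolding k image_iff_lift[of "d (Suc (Suc i))", OF D(2)] .
  qed
  have "minimal_exact ker n D"
    unfolding minimal_exact_def
  proof (intro conjI allI impI)
    show "eqmod (n i) m (D i x) 0" for i x
    proof -
      have "D i x j \<in> m" if "j < n i" for j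
      proof -
        have "vecmap (n i) (D i x) j \<in> max_ideal R" unfolding D(2)[symmetric] by (rule min[OF cl that])
        then show ?thesis using that phi_mem_iff unfolding max_ideal_eq vecmap_def by simp
      qed
      then show ?thesis using m by (simp add: eqmod_def vec_apply)
    qed
    show "eqmod (n i) ker (D i (D (Suc i) x)) 0" for i x unfolding ex using eqmod_refl[OF ker_ideal] by blast
    show "\<exists>y. eqmod (n (Suc i)) ker x (D (Suc i) y)" if "eqmod (n i) ker (D i x) 0" for i x
      using that unfolding ex .
  qed (rule D(1))
  moreover have "e (vecmap (n 0) x) = \<zero>\<^bsub>L\<^esub> \<longleftrightarrow> (\<exists>y. eqmod (n 0) ker x (D 0 y))" for x
  proof -
    have "e (vecmap (n 0) x) = \<zero>\<^bsub>L\<^esub> \<longleftrightarrow> vecmap (n 0) x \<in> hom_ker (free_mod R (n 0)) L e"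
      unfolding hom_ker_def using cl by blast
    then show ?thesis unfolding k0 image_iff_lift[of "d (Suc 0)", OF D(2)] .
  qed
  moreover have "range (\<lambda>x. e (vecmap (n 0) x)) = carrier L" using es unfolding image_free_mod .
  ultimately show ?thesis unfolding lifted_resolution_def using hom_lifted_linear[OF L e] by blast
qed

lemma lifted_resolution_exists_of_resolution:
  assumes "minimal_free_resolution R n d e L"
  shows "\<exists>D \<epsilon>. lifted_resolution L n D \<epsilon>"
proof -
  have "\<exists>H. lin (n (Suc i)) H \<and> (\<forall>x. d (Suc i) (vecmap (n (Suc i)) x) = vecmap (n i) (H x))" for i
    by (rule hom_lin) (use assms in \<open>simp add: minimal_free_resolution_def resolution_def\<close>)
  then have "\<forall>i. \<exists>H. lin (n (Suc i)) H \<and> (\<forall>x. d (Suc i) (vecmap (n (Suc i)) x) = vecmap (n i) (H x))" ..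
  from choice[OF this] obtain D where
    D: "\<forall>i. lin (n (Suc i)) (D i) \<and> (\<forall>x. d (Suc i) (vecmap (n (Suc i)) x) = vecmap (n i) (D i x))" ..
  have "lifted_resolution L n D (\<lambda>x. e (vecmap (n 0) x))"
    by (rule lift_resolution[OF assms]) (use D in simp_all)
  then show ?thesis by (intro exI)
qed

lemma resolution_of_lifted:
  assumes L: "module R L" and t: "lifted_resolution L n D \<epsilon>"
  shows "\<exists>d e. minimal_free_resolution R n d e L"
proof -
  note E = lifted_resolutionD(3)[OF t]
  obtain e where e: "e \<in> mod_hom R (free_mod R (n 0)) L" and ev: "\<And>x. e (vecmap (n 0) x) = \<epsilon> x"
    using lifted_linear_hom[OF L lifted_resolutionD(1)[OF t]] by blast
  have "\<exists>h. h \<in> mod_hom R (free_mod R (n (Suc i))) (free_mod R (n i)) \<and>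
      (\<forall>x. h (vecmap (n (Suc i)) x) = vecmap (n i) (D i x))" for i
    using lifted_linear_hom[OF free_module lifted_linear_vecmap[OF minimal_exactD(1)[OF E], of "n i" i]] by blast
  then have "\<forall>i. \<exists>h. h \<in> mod_hom R (free_mod R (n (Suc i))) (free_mod R (n i)) \<and>
      (\<forall>x. h (vecmap (n (Suc i)) x) = vecmap (n i) (D i x))" ..
  from choice[OF this] obtain h where
    hh: "\<forall>i. h i \<in> mod_hom R (free_mod R (n (Suc i))) (free_mod R (n i)) \<and>
      (\<forall>x. h i (vecmap (n (Suc i)) x) = vecmap (n i) (D i x))" ..
  then have h: "h i \<in> mod_hom R (free_mod R (n (Suc i))) (free_mod R (n i))"
    and hv: "h i (vecmap (n (Suc i)) x) = vecmap (n i) (D i x)" for i x by simp_all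
  define d where "d i = h (i - 1)" for i
  have dS: "d (Suc i) = h i" for i by (simp add: d_def)
  have ker_h: "hom_ker (free_mod R (n (Suc i))) (free_mod R (n i)) (h i)
      = h (Suc i) ` carrier (free_mod R (n (Suc (Suc i))))" for i
  proof (intro equalityI subsetI)
    fix z assume "z \<in> hom_ker (free_mod R (n (Suc i))) (free_mod R (n i)) (h i)"
    then have z: "z \<in> carrier (free_mod R (n (Suc i)))" "h i z = \<zero>\<^bsub>free_mod R (n i)\<^esub>"
      unfolding hom_ker_def by blast+
    from z(1) obtain u where u: "z = vecmap (n (Suc i)) u" by (rule free_modE)
    have "eqmod (n i) ker (D i u) 0" using z(2) unfolding u hv vecmap_zero_iff .
    then show "z \<in> h (Suc i) ` carrier (free_mod R (n (Suc (Suc i))))"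
      unfolding u image_iff_lift[of "h (Suc i)", OF hv] by (rule minimal_exactD(4)[OF E])
  next
    fix z assume "z \<in> h (Suc i) ` carrier (free_mod R (n (Suc (Suc i))))"
    then obtain u where u: "z = vecmap (n (Suc i)) (D (Suc i) u)" unfolding image_free_mod hv by blast
    have "h i z = \<zero>\<^bsub>free_mod R (n i)\<^esub>" unfolding u hv vecmap_zero_iff by (rule minimal_exactD(3)[OF E])
    then show "z \<in> hom_ker (free_mod R (n (Suc i))) (free_mod R (n i)) (h i)"
      unfolding hom_ker_def u by simp
  qed
  have ker_e: "hom_ker (free_mod R (n 0)) L e = h 0 ` carrier (free_mod R (n (Suc 0)))"
  proof (intro equalityI subsetI)
    fix z assume "z \<in> hom_ker (free_mod R (n 0)) L e"
    then have z: "z \<in> carrier (free_mod R (n 0))" "e z = \<zero>\<^bsub>L\<^esub>" unfolding hom_ker_def by blast+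
    from z(1) obtain u where u: "z = vecmap (n 0) u" by (rule free_modE)
    show "z \<in> h 0 ` carrier (free_mod R (n (Suc 0)))"
      using z(2) unfolding u ev image_iff_lift[of "h 0", OF hv] lifted_resolutionD(4)[OF t] .
  next
    fix z assume "z \<in> h 0 ` carrier (free_mod R (n (Suc 0)))"
    then obtain u where u: "z = vecmap (n 0) (D 0 u)" unfolding image_free_mod hv by blast
    have "e z = \<zero>\<^bsub>L\<^esub>" unfolding u ev lifted_resolutionD(4)[OF t] using eqmod_refl[OF ker_ideal] by blast
    then show "z \<in> hom_ker (free_mod R (n 0)) L e" unfolding hom_ker_def u by simp
  qed
  have min: "h i x j \<in> max_ideal R" if x: "x \<in> carrier (free_mod R (n (Suc i)))" and j: "j < n i" for i x j
  proof -
    obtain u where u: "x = vecmap (n (Suc i)) u" using x by (rule free_modE)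
    have "D i u j \<in> m" using minimal_exactD(2)[OF E, of i u] j by (simp add: eqmod_def vec_apply)
    then show ?thesis unfolding u hv max_ideal_eq using j by (simp add: vecmap_def)
  qed
  have es: "e ` carrier (free_mod R (n 0)) = carrier L"
    unfolding image_free_mod ev by (rule lifted_resolutionD(2)[OF t])
  have "minimal_free_resolution R n d e L"
    unfolding minimal_free_resolution_def resolution_def One_nat_def dS
    by (intro conjI allI ballI impI L free_module h e es ker_e ker_h min)
  then show ?thesis by (intro exI)
qed

text \<open>The relation of representing the same element of \<open>L\<close> compares the two resolutions.\<close>

lemma lifted_resolution_unique:
  assumes L: "module R L" and t: "lifted_resolution L n D \<epsilon>" and t': "lifted_resolution L n' D' \<epsilon>'"
  shows "presentation_iso (n 0) {x. \<epsilon> x = \<zero>\<^bsub>L\<^esub>} (n' 0) {x. \<epsilon>' x = \<zero>\<^bsub>L\<^esub>}" and "n i = n' i"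
proof -
  note T = lifted_resolutionD[OF t] and T' = lifted_resolutionD[OF t']
  note e = lifted_linearD[OF T(1)] and e' = lifted_linearD[OF T'(1)]
  have min: "eqmod (n 0) m x 0" if x: "\<epsilon> x = \<zero>\<^bsub>L\<^esub>" for x
  proof -
    obtain y where "eqmod (n 0) ker x (D 0 y)" using x unfolding T(4) ..
    from eqmod_trans[OF eqmod_mono[OF this ker_m m] minimal_exactD(2)[OF T(3)]] show ?thesis .
  qed
  have min': "eqmod (n' 0) m x 0" if x: "\<epsilon>' x = \<zero>\<^bsub>L\<^esub>" for x
  proof -
    obtain y where "eqmod (n' 0) ker x (D' 0 y)" using x unfolding T'(4) ..
    from eqmod_trans[OF eqmod_mono[OF this ker_m m] minimal_exactD(2)[OF T'(3)]] show ?thesis .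
  qed
  have "presentation_iso (n 0) {x. \<epsilon> x = \<epsilon>' 0} (n' 0) {y. \<epsilon> 0 = \<epsilon>' y}"
  proof (rule minimal_presentations_iso)
    show "\<epsilon> (x + x') = \<epsilon>' (y + y')" if "\<epsilon> x = \<epsilon>' y" "\<epsilon> x' = \<epsilon>' y'" for x x' y y'
      unfolding e(2) e'(2) using that by simp
    show "\<epsilon> (c \<star> x) = \<epsilon>' (c \<star> y)" if "\<epsilon> x = \<epsilon>' y" for c x y
      unfolding e(3) e'(3) using that by simp
    show "\<epsilon> x = \<epsilon>' 0" if "eqmod (n 0) J0 x 0" for x
      using e(4)[OF eqmod_ker[OF that]] e'(5) by simp
    show "\<epsilon> 0 = \<epsilon>' y" if "eqmod (n' 0) J0 y 0" for y
      using e'(4)[OF eqmod_ker[OF that]] e(5) by simp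
    show "\<exists>y. \<epsilon> x = \<epsilon>' y" for x using e(1)[of x] unfolding T'(2)[symmetric] by blast
    show "\<exists>x. \<epsilon> x = \<epsilon>' y" for y using e'(1)[of y] unfolding T(2)[symmetric] by force
    show "eqmod (n 0) m x 0" if "\<epsilon> x = \<epsilon>' 0" for x by (rule min) (use that e'(5) in simp)
    show "eqmod (n' 0) m y 0" if "\<epsilon> 0 = \<epsilon>' y" for y by (rule min') (use that e(5) in simp)
  qed
  moreover have "{y. \<epsilon> 0 = \<epsilon>' y} = {x. \<epsilon>' x = \<zero>\<^bsub>L\<^esub>}" unfolding e(5) by auto
  ultimately show iso: "presentation_iso (n 0) {x. \<epsilon> x = \<zero>\<^bsub>L\<^esub>} (n' 0) {x. \<epsilon>' x = \<zero>\<^bsub>L\<^esub>}"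
    unfolding e'(5) by simp
  show "n i = n' i"
    by (rule minimal_resolution_ranks_unique[OF T(3) T'(3) ker_ideal J0_ker ker_m])
      (use iso in \<open>simp add: T(4) T'(4)\<close>)
qed

lemma betti_eq:
  assumes L: "module R L" and t: "lifted_resolution L n D \<epsilon>"
  shows "betti R L i = n i"
  unfolding betti_def
proof (rule the_equality)
  show "\<exists>n' d e. minimal_free_resolution R n' d e L \<and> n' i = n i"
    using resolution_of_lifted[OF assms] by blast
  fix b assume "\<exists>n' d e. minimal_free_resolution R n' d e L \<and> n' i = b"
  then obtain n' d e where res: "minimal_free_resolution R n' d e L" "n' i = b" by blast
  obtain D' \<epsilon>' where "lifted_resolution L n' D' \<epsilon>'" using lifted_resolution_exists_of_resolution[OF res(1)] by blast
  from lifted_resolution_unique(2)[OF L t this] show "b = n i" using res(2) by simp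
qed

lemma lifted_resolution_transport:
  assumes iso: "mod_iso R M L" and t: "lifted_resolution L n D \<epsilon>"
  shows "\<exists>\<epsilon>'. lifted_resolution M n D \<epsilon>' \<and> (\<forall>x. \<epsilon>' x = \<zero>\<^bsub>M\<^esub> \<longleftrightarrow> \<epsilon> x = \<zero>\<^bsub>L\<^esub>)"
proof -
  from iso obtain h where M: "module R M" and L: "module R L" and h: "h \<in> mod_hom R M L"
    and b: "bij_betw h (carrier M) (carrier L)" unfolding mod_iso_def by blast
  interpret M: module R M by (rule M)
  interpret L: module R L by (rule L)
  note e = lifted_linearD[OF lifted_resolutionD(1)[OF t]]
  have inj: "x = y" if "x \<in> carrier M" "y \<in> carrier M" "h x = h y" for x y
    using b that unfolding bij_betw_def inj_on_def by blast
  have ha: "h (x \<oplus>\<^bsub>M\<^esub> y) = h x \<oplus>\<^bsub>L\<^esub> h y" if "x \<in> carrier M" "y \<in> carrier M" for x y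
    using h that by (simp add: mod_hom_iff)
  have hs: "h (a \<odot>\<^bsub>M\<^esub> x) = a \<odot>\<^bsub>L\<^esub> h x" if "a \<in> carrier R" "x \<in> carrier M" for a x
    using h that by (simp add: mod_hom_iff)
  have hc: "h x \<in> carrier L" if "x \<in> carrier M" for x using h that by (simp add: mod_hom_iff)
  have h0: "h \<zero>\<^bsub>M\<^esub> = \<zero>\<^bsub>L\<^esub>"
  proof -
    have "h (\<zero> \<odot>\<^bsub>M\<^esub> \<zero>\<^bsub>M\<^esub>) = \<zero> \<odot>\<^bsub>L\<^esub> h \<zero>\<^bsub>M\<^esub>" by (rule hs) simp_all
    then show ?thesis using hc by (simp add: M.smult_l_null L.smult_l_null)
  qed
  define \<epsilon>' where "\<epsilon>' x = inv_into (carrier M) h (\<epsilon> x)" for x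
  have img: "h ` carrier M = carrier L" using b by (simp add: bij_betw_def)
  have c: "\<epsilon>' x \<in> carrier M" and he: "h (\<epsilon>' x) = \<epsilon> x" for x
    unfolding \<epsilon>'_def using e(1)[of x] img by (auto intro: inv_into_into f_inv_into_f)
  have zero: "\<epsilon>' x = \<zero>\<^bsub>M\<^esub> \<longleftrightarrow> \<epsilon> x = \<zero>\<^bsub>L\<^esub>" for x
    using inj[OF c M.zero_closed, of x] he h0 by metis
  have "lifted_linear M (n 0) \<epsilon>'"
    unfolding lifted_linear_def
  proof (intro conjI allI impI c)
    show "\<epsilon>' (x + y) = \<epsilon>' x \<oplus>\<^bsub>M\<^esub> \<epsilon>' y" for x y by (rule inj) (simp_all add: c ha he e(2))
    show "\<epsilon>' (k \<star> x) = \<phi> k \<odot>\<^bsub>M\<^esub> \<epsilon>' x" for k x by (rule inj) (simp_all add: c hs he e(3))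
    show "\<epsilon>' x = \<zero>\<^bsub>M\<^esub>" if "eqmod (n 0) ker x 0" for x using zero e(4)[OF that] by simp
  qed
  moreover have "range \<epsilon>' = carrier M"
  proof (intro equalityI subsetI)
    fix z assume z: "z \<in> carrier M"
    then obtain x where x: "h z = \<epsilon> x" using hc lifted_resolutionD(2)[OF t] by (metis rangeE)
    have "z = \<epsilon>' x" by (rule inj) (use z c he x in simp_all)
    then show "z \<in> range \<epsilon>'" by blast
  qed (use c in blast)
  ultimately have "lifted_resolution M n D \<epsilon>'"
    unfolding lifted_resolution_def zero using lifted_resolutionD(3,4)[OF t] by blast
  then show ?thesis using zero by blast
qed

section \<open>Quotients of a local ring by a regular sequence\<close>

text \<open>A syzygy module \<open>ker d\<close> inside a free module is resolved as soon as generators \<open>E\<close> of it are.\<close>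

lemma lifted_resolution_of_kernel:
  assumes E: "minimal_exact ker n D" and lE: "lin (n 0) E" and E0: "\<And>x. d (vecmap k x) = vecmap l (E0 x)"
    and cyc: "\<And>z. eqmod l ker (E0 z) 0 \<longleftrightarrow> (\<exists>x. eqmod k ker z (E x))"
    and kerE: "\<And>x. eqmod k ker (E x) 0 \<longleftrightarrow> (\<exists>y. eqmod (n 0) ker x (D 0 y))"
  shows "lifted_resolution ((free_mod R k)\<lparr>carrier := hom_ker (free_mod R k) (free_mod R l) d\<rparr>) n D (\<lambda>x. vecmap k (E x))"
proof -
  let ?M = "(free_mod R k)\<lparr>carrier := hom_ker (free_mod R k) (free_mod R l) d\<rparr>"
  have mem: "vecmap k z \<in> hom_ker (free_mod R k) (free_mod R l) d \<longleftrightarrow> eqmod l ker (E0 z) 0" for z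
    unfolding hom_ker_def mem_Collect_eq E0 vecmap_zero_iff by simp
  have Emem: "vecmap k (E x) \<in> hom_ker (free_mod R k) (free_mod R l) d" for x
    unfolding mem cyc using eqmod_refl[OF ker_ideal] by blast
  note T = lifted_linearD[OF lifted_linear_vecmap[OF lE, of k]]
  have "lifted_linear ?M (n 0) (\<lambda>x. vecmap k (E x))"
    unfolding lifted_linear_def using Emem T by simp
  moreover have "range (\<lambda>x. vecmap k (E x)) = carrier ?M"
  proof (intro equalityI subsetI)
    fix z assume "z \<in> carrier ?M"
    then have z: "z \<in> hom_ker (free_mod R k) (free_mod R l) d" by simp
    then have "z \<in> carrier (free_mod R k)" unfolding hom_ker_def by blast
    then obtain u where u: "z = vecmap k u" by (rule free_modE)
    obtain x where "eqmod k ker u (E x)" using z unfolding u mem cyc ..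
    then have "z = vecmap k (E x)" unfolding u vecmap_eq_iff .
    then show "z \<in> range (\<lambda>x. vecmap k (E x))" by blast
  qed (use Emem in auto)
  moreover have "vecmap k (E x) = \<zero>\<^bsub>?M\<^esub> \<longleftrightarrow> (\<exists>y. eqmod (n 0) ker x (D 0 y))" for x
    using vecmap_zero_iff[of k "E x"] kerE by simp
  ultimately show ?thesis unfolding lifted_resolution_def using E by blast
qed

end

text \<open>The objects of the preceding sections for the rings \<open>R\<^sub>p\<close>: presentations by the ring type \<open>uring\<close>, with kernels
  \<open>J p\<close>, and lifts \<open>F j\<close> of the members of the sequence.\<close>

locale local_regular_sequence = noetherian_local_ring S
  for S :: "('a, 'x) ring_scheme" (structure) and f :: "nat \<Rightarrow> 'a" and c :: nat +
  assumes reg: "regular_sequence S f c"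
begin

abbreviation mx where "mx \<equiv> max_ideal S"
abbreviation I where "I p \<equiv> seq_ideal S f p"
abbreviation R where "R p \<equiv> seq_quot S f p"

definition phi :: "nat \<Rightarrow> ('a, 'x) uring \<Rightarrow> 'a set" where "phi p x = quot_map S f p (ev S x)"
definition J0 :: "('a, 'x) uring set" where "J0 = {x. ev S x = \<zero>}"
definition J :: "nat \<Rightarrow> ('a, 'x) uring set" where "J p = {x. ev S x \<in> I p}"
definition m :: "('a, 'x) uring set" where "m = {x. ev S x \<in> mx}"
definition F :: "nat \<Rightarrow> ('a, 'x) uring" where "F j = uring (\<lambda>_. f j) 0"

lemma cring_S: "cring S" by (rule is_cring)

lemmas ev_simps = ev_ops[OF cring_S]

lemma ev_carrier [simp, intro]: "ev S x \<in> carrier S" by (rule ev_closed[OF cring_S])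

lemma ev_minus: "ev S (x - y) = ev S x \<ominus> ev S y"
  using ev_simps(3)[of x "- y"] by (simp add: ev_simps(5) a_minus_def)

lemma ev_onto: "a \<in> carrier S \<Longrightarrow> \<exists>x. ev S x = a"
  unfolding ev_surj[OF cring_S, symmetric] by auto

lemma f_carrier: "1 \<le> j \<Longrightarrow> j \<le> c \<Longrightarrow> f j \<in> carrier S"
  using reg unfolding regular_sequence_def by simp

lemma ev_F: "1 \<le> j \<Longrightarrow> j \<le> c \<Longrightarrow> ev S (F j) = f j"
  unfolding F_def by (simp add: ev_uring cring_S f_carrier)

lemma max: "maximalideal mx S"
  unfolding max_ideal_def by (rule theI'[OF unique_maximal])

text \<open>By the ascending chain condition a proper ideal lies in a maximal proper ideal containing it, which is \<open>mx\<close> by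
  uniqueness.\<close>

lemma proper_ideal_in_max:
  assumes K: "ideal K S" "K \<noteq> carrier S"
  shows "K \<subseteq> mx"
proof -
  define A where "A = {L. ideal L S \<and> L \<noteq> carrier S \<and> K \<subseteq> L}"
  have "\<exists>M\<in>A. \<forall>Z\<in>A. M \<subseteq> Z \<longrightarrow> Z = M"
  proof (rule subset_Zorn_nonempty)
    show "A \<noteq> {}" unfolding A_def using K by blast
    fix C assume C: "C \<noteq> {}" "subset.chain A C"
    then have CA: "C \<subseteq> A" unfolding pred_on.chain_def by blast
    have "subset.chain {I. ideal I S} C"
      using C(2) unfolding pred_on.chain_def A_def by blast
    from ideal_chain_is_trivial[OF C(1) this] show "\<Union>C \<in> A" using CA by blast
  qed
  then obtain M where MA: "M \<in> A" and top: "\<forall>Z\<in>A. M \<subseteq> Z \<longrightarrow> Z = M" ..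
  from MA have M: "ideal M S" "M \<noteq> carrier S" "K \<subseteq> M" unfolding A_def by blast+
  have "maximalideal M S"
  proof (rule maximalidealI)
    fix Z assume Z: "ideal Z S" "M \<subseteq> Z" "Z \<subseteq> carrier S"
    show "Z = M \<or> Z = carrier S"
    proof (cases "Z = carrier S")
      case False
      then have "Z \<in> A" unfolding A_def using Z(1,2) M(3) by blast
      then show ?thesis using top Z(2) by blast
    qed simp
  qed (use M in auto)
  then have "M = mx" using unique_maximal max by blast
  then show ?thesis using M(3) by simp
qed

lemma unit_outside_max:
  assumes "a \<in> carrier S" "a \<notin> mx"
  shows "\<exists>b\<in>carrier S. a \<otimes> b = \<one>"
proof -
  have "PIdl a = carrier S"
    using proper_ideal_in_max[OF cgenideal_ideal[OF assms(1)]] cgenideal_self[OF assms(1)] assms(2) by blast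
  then have "\<one> \<in> PIdl a" by simp
  then obtain b where "b \<in> carrier S" "\<one> = b \<otimes> a" unfolding cgenideal_def by blast
  then show ?thesis using assms(1) m_comm by metis
qed

lemma seq_ideal: "p \<le> c \<Longrightarrow> ideal (I p) S"
  unfolding seq_ideal_def using f_carrier by (intro genideal_ideal) auto

lemma seq_ideal_0: "I 0 = {\<zero>}"
proof -
  have "Idl {} \<subseteq> {\<zero>}" using zeroideal by (intro genideal_minimal) auto
  moreover have "\<zero> \<in> Idl {}" using genideal_ideal[of "{}"] additive_subgroup.zero_closed ideal.axioms(1) by blast
  ultimately show ?thesis unfolding seq_ideal_def by auto
qed

lemma J_0: "J 0 = J0" unfolding J_def J0_def seq_ideal_0 by simp

lemma seq_ideal_Suc:
  assumes p: "p < c"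
  shows "I (Suc p) = {x \<oplus> f (Suc p) \<otimes> y |x y. x \<in> I p \<and> y \<in> carrier S}" (is "_ = ?T")
proof
  have fS: "f (Suc p) \<in> carrier S" using p by (intro f_carrier) auto
  have Ip: "ideal (I p) S" using p by (intro seq_ideal) simp
  have PI: "ideal (PIdl (f (Suc p))) S" by (rule cgenideal_ideal[OF fS])
  have T: "?T = set_add S (I p) (PIdl (f (Suc p)))"
  proof (intro equalityI subsetI)
    fix z assume "z \<in> ?T"
    then obtain x y where z: "z = x \<oplus> f (Suc p) \<otimes> y" "x \<in> I p" "y \<in> carrier S" by blast
    then have "y \<otimes> f (Suc p) \<in> PIdl (f (Suc p))" unfolding cgenideal_def by blast
    then show "z \<in> set_add S (I p) (PIdl (f (Suc p)))"
      unfolding set_add_def' z(1) m_comm[OF fS z(3)] using z(2) by blast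
  next
    fix z assume "z \<in> set_add S (I p) (PIdl (f (Suc p)))"
    then obtain x w where z: "z = x \<oplus> w" "x \<in> I p" "w \<in> PIdl (f (Suc p))"
      unfolding set_add_def' by blast
    then obtain y where y: "w = y \<otimes> f (Suc p)" "y \<in> carrier S" unfolding cgenideal_def by blast
    then show "z \<in> ?T" unfolding z(1) y(1) m_comm[OF y(2) fS] using z(2) y(2) by blast
  qed
  have "f ` {1..Suc p} \<subseteq> ?T"
  proof
    fix a assume "a \<in> f ` {1..Suc p}"
    then obtain j where j: "a = f j" "1 \<le> j" "j \<le> Suc p" by auto
    show "a \<in> ?T"
    proof (cases "j = Suc p")
      case True
      have "a = \<zero> \<oplus> f (Suc p) \<otimes> \<one>" using True j fS by simp
      moreover have "\<zero> \<in> I p" using additive_subgroup.zero_closed ideal.axioms(1)[OF Ip] by blast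
      ultimately show ?thesis by blast
    next
      case False
      have "f ` {1..p} \<subseteq> carrier S" using f_carrier p by auto
      then have "f ` {1..p} \<subseteq> I p" unfolding seq_ideal_def by (rule genideal_self)
      then have "a \<in> I p" using j False by auto
      moreover have "a = a \<oplus> f (Suc p) \<otimes> \<zero>" using f_carrier[of j] j p fS by simp
      ultimately show ?thesis by blast
    qed
  qed
  then show "I (Suc p) \<subseteq> ?T"
    unfolding seq_ideal_def[of S f "Suc p"] using add_ideals[OF Ip PI] unfolding T[symmetric]
    by (intro genideal_minimal)
  have sub: "f ` {1..Suc p} \<subseteq> carrier S" using f_carrier p by auto
  have "I p \<subseteq> I (Suc p)"
    unfolding seq_ideal_def by (rule subset_Idl_subset[OF sub]) auto
  moreover have "f (Suc p) \<in> I (Suc p)" unfolding seq_ideal_def using genideal_self[OF sub] by auto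
  moreover have "ideal (I (Suc p)) S" using p by (intro seq_ideal) simp
  ultimately show "?T \<subseteq> I (Suc p)"
    by (auto intro!: additive_subgroup.a_closed[OF ideal.axioms(1)] ideal.I_r_closed)
qed

lemma quot_map_hom: "p \<le> c \<Longrightarrow> quot_map S f p \<in> Ring.ring_hom S (R p)"
  using ideal.rcos_ring_hom[OF seq_ideal] unfolding quot_map_def[abs_def] seq_quot_def by blast

lemma quot_cring: "p \<le> c \<Longrightarrow> cring (R p)"
  unfolding seq_quot_def by (rule ideal.quotient_is_cring[OF seq_ideal cring_S])

lemma quot_zero: "\<zero>\<^bsub>R p\<^esub> = I p"
  by (simp add: seq_quot_def FactRing_def)

lemma quot_map_zero_iff: "p \<le> c \<Longrightarrow> a \<in> carrier S \<Longrightarrow> quot_map S f p a = \<zero>\<^bsub>R p\<^esub> \<longleftrightarrow> a \<in> I p"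
  unfolding quot_zero quot_map_def
  using ideal.rcos_const_imp_mem[OF seq_ideal] a_rcos_zero[OF seq_ideal] by blast

lemma quot_map_to: "p < c \<Longrightarrow> a \<in> carrier S \<Longrightarrow> quot_map_to S f (Suc p) (quot_map S f p a) = quot_map S f (Suc p) a"
proof -
  assume p: "p < c" and a: "a \<in> carrier S"
  have I: "ideal (I p) S" "ideal (I (Suc p)) S" using p by (auto intro: seq_ideal)
  have c: "x \<in> carrier S" if "x \<in> I p \<or> x \<in> I (Suc p)" for x
    using that ideal.Icarr[OF I(1)] ideal.Icarr[OF I(2)] by blast
  have sub: "I p \<subseteq> I (Suc p)"
    unfolding seq_ideal_def using f_carrier p by (intro subset_Idl_subset) auto
  have "set_add S (I (Suc p)) (I p +> a) = I (Suc p) +> a"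
  proof
    show "set_add S (I (Suc p)) (I p +> a) \<subseteq> I (Suc p) +> a"
    proof
      fix z assume "z \<in> set_add S (I (Suc p)) (I p +> a)"
      then obtain x y where x: "z = x \<oplus> (y \<oplus> a)" "x \<in> I (Suc p)" "y \<in> I p"
        unfolding set_add_def' a_r_coset_def' by blast
      then have "z = (x \<oplus> y) \<oplus> a" using a c by (simp add: a_assoc)
      moreover have "x \<oplus> y \<in> I (Suc p)"
        using additive_subgroup.a_closed[OF ideal.axioms(1)[OF I(2)]] x sub by blast
      ultimately show "z \<in> I (Suc p) +> a" unfolding a_r_coset_def' by blast
    qed
    show "I (Suc p) +> a \<subseteq> set_add S (I (Suc p)) (I p +> a)"
    proof
      fix z assume "z \<in> I (Suc p) +> a"
      then obtain x where x: "z = x \<oplus> a" "x \<in> I (Suc p)" unfolding a_r_coset_def' by blast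
      have "z = x \<oplus> (\<zero> \<oplus> a)" using x a by simp
      moreover have "\<zero> \<in> I p" using additive_subgroup.zero_closed ideal.axioms(1)[OF I(1)] by blast
      ultimately show "z \<in> set_add S (I (Suc p)) (I p +> a)"
        using x(2) unfolding set_add_def' a_r_coset_def' by blast
    qed
  qed
  then show ?thesis unfolding quot_map_to_def quot_map_def .
qed

lemma presentation_S: "ring_presentation S (ev S)"
  by (intro ring_presentation.intro ring_presentation_axioms.intro cring_S ev_surj)
    (simp_all add: ev_simps)

lemma presentation_R: "p \<le> c \<Longrightarrow> ring_presentation (R p) (phi p)"
proof -
  assume p: "p \<le> c"
  note hom = quot_map_hom[OF p]
  have "range (phi p) = carrier (R p)"
  proof (intro equalityI subsetI)
    fix z assume "z \<in> carrier (R p)"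
    then obtain a where a: "a \<in> carrier S" "z = quot_map S f p a"
      unfolding seq_quot_def FactRing_def A_RCOSETS_def' quot_map_def by auto
    then show "z \<in> range (phi p)" using ev_onto unfolding phi_def by blast
  qed (use ring_hom_closed[OF hom] in \<open>auto simp: phi_def\<close>)
  then show ?thesis
    by (intro ring_presentation.intro ring_presentation_axioms.intro quot_cring[OF p])
      (simp_all add: phi_def ev_simps ring_hom_add[OF hom] ring_hom_mult[OF hom] ring_hom_one[OF hom])
qed

lemma ker_S: "ring_presentation.ker S (ev S) = J0"
  unfolding ring_presentation.ker_def[OF presentation_S] J0_def ..

lemma ker_R: "p \<le> c \<Longrightarrow> ring_presentation.ker (R p) (phi p) = J p"
  unfolding ring_presentation.ker_def[OF presentation_R] J_def phi_def by (simp add: quot_map_zero_iff)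

lemma seq_ideal_max: "p \<le> c \<Longrightarrow> I p \<subseteq> mx"
proof -
  assume p: "p \<le> c"
  have "I p \<subseteq> I c"
    unfolding seq_ideal_def using f_carrier p by (intro subset_Idl_subset) auto
  moreover have "I c \<subseteq> mx"
    using reg by (intro proper_ideal_in_max seq_ideal) (auto simp: regular_sequence_def)
  ultimately show ?thesis by blast
qed

lemma local_quotient: "local_quotient J0 m"
proof
  interpret M: maximalideal mx S by (rule max)
  show "is_ideal J0" unfolding is_ideal_def J0_def by (simp add: ev_simps)
  show "is_ideal m" unfolding is_ideal_def m_def by (simp add: ev_simps M.I_l_closed)
  show "J0 \<subseteq> m" unfolding J0_def m_def by auto
  show "1 \<notin> m" unfolding m_def using M.one_imp_carrier M.I_notcarr by (auto simp: ev_simps)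
  fix x assume "x \<notin> m"
  then obtain b where b: "b \<in> carrier S" "ev S x \<otimes> b = \<one>"
    using unit_outside_max[of "ev S x"] unfolding m_def by auto
  obtain y where "ev S y = b" using ev_onto[OF b(1)] by blast
  then have "x * y - 1 \<in> J0" using b unfolding J0_def by (simp add: ev_minus ev_simps)
  then show "\<exists>y. x * y - 1 \<in> J0" by blast
qed

text \<open>Ideals above \<open>J0\<close> correspond to ideals of \<open>S\<close>, and generators lift.\<close>

lemma noetherian_local_quotient: "noetherian_local_quotient J0 m"
proof (intro noetherian_local_quotient.intro noetherian_local_quotient_axioms.intro local_quotient)
  have J0_in: "x \<in> L" if "is_ideal L" "J0 \<subseteq> L" "y \<in> L" "ev S x = ev S y" for L x y
  proof -
    have "x - y \<in> L" using that(2,4) unfolding J0_def by (auto simp: ev_minus)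
    from ideal_add[OF that(1) this that(3)] show ?thesis by simp
  qed
  have img: "ideal (ev S ` L) S" if L: "is_ideal L" for L
  proof (rule idealI)
    show "subgroup (ev S ` L) (add_monoid S)"
    proof (rule add.subgroupI)
      show "ev S ` L \<noteq> {}" using ideal_zero[OF L] by blast
      fix a assume "a \<in> ev S ` L"
      then obtain x where x: "a = ev S x" "x \<in> L" by blast
      show "\<ominus> a \<in> ev S ` L" unfolding x ev_simps(5)[symmetric] using ideal_uminus[OF L x(2)] by blast
      fix b assume "b \<in> ev S ` L"
      then obtain y where y: "b = ev S y" "y \<in> L" by blast
      show "a \<oplus> b \<in> ev S ` L" unfolding x y ev_simps(3)[symmetric] using ideal_add[OF L x(2) y(2)] by blast
    qed auto
    fix a x assume "a \<in> ev S ` L" "x \<in> carrier S"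
    then obtain u v where u: "a = ev S u" "u \<in> L" "x = ev S v" using ev_onto by blast
    show "x \<otimes> a \<in> ev S ` L" unfolding u ev_simps(4)[symmetric] using ideal_mult_left[OF L u(2)] by blast
    show "a \<otimes> x \<in> ev S ` L" unfolding u ev_simps(4)[symmetric] using ideal_mult_right[OF L u(2)] by blast
  qed (rule ring_axioms)
  fix L :: "('a, 'x) uring set" assume L: "is_ideal L" "J0 \<subseteq> L"
  obtain A where A: "A \<subseteq> carrier S" "finite A" "ev S ` L = Idl A" using finetely_gen[OF img[OF L(1)]] by blast
  then have "A \<subseteq> ev S ` L" using genideal_self by blast
  then obtain G where G: "G \<subseteq> L" "finite G" "A = ev S ` G" using A(2) by (metis finite_subset_image)
  have "L \<subseteq> L'" if L': "is_ideal L'" "J0 \<subseteq> L'" "G \<subseteq> L'" for L'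
  proof
    fix x assume "x \<in> L"
    then have "ev S x \<in> Idl A" using A(3) by blast
    moreover have "Idl A \<subseteq> ev S ` L'" using G(3) L'(3) by (intro genideal_minimal img L'(1)) blast
    ultimately obtain y where "y \<in> L'" "ev S x = ev S y" by blast
    then show "x \<in> L'" using J0_in[OF L'(1,2)] by blast
  qed
  then show "\<exists>G. finite G \<and> G \<subseteq> L \<and> (\<forall>I'. is_ideal I' \<and> J0 \<subseteq> I' \<and> G \<subseteq> I' \<longrightarrow> L \<subseteq> I')"
    using G(1,2) by blast
qed

lemma local_presentation_S: "local_presentation S (ev S) J0 m"
  by (intro local_presentation.intro local_presentation_axioms.intro presentation_S local_quotient)
    (use local_quotient.J0_m[OF local_quotient] in \<open>simp_all add: ker_S\<close>)

lemma local_presentation_R: "p \<le> c \<Longrightarrow> local_presentation (R p) (phi p) J0 m"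
proof (intro local_presentation.intro local_presentation_axioms.intro presentation_R local_quotient)
  assume p: "p \<le> c"
  show "J0 \<subseteq> ring_presentation.ker (R p) (phi p)"
    unfolding ker_R[OF p] J0_def J_def using additive_subgroup.zero_closed[OF ideal.axioms(1)[OF seq_ideal[OF p]]] by auto
  show "ring_presentation.ker (R p) (phi p) \<subseteq> m"
    unfolding ker_R[OF p] m_def J_def using seq_ideal_max[OF p] by blast
qed

lemma ci_tower: "ci_tower J0 m J F c"
proof (intro ci_tower.intro ci_tower_axioms.intro local_quotient J_0)
  show "J c \<subseteq> m" unfolding J_def m_def using seq_ideal_max[of c] by blast
  fix p assume p: "p < c"
  then have evF: "ev S (F (Suc p)) = f (Suc p)" by (intro ev_F) auto
  show "J (Suc p) = {x + F (Suc p) * y |x y. x \<in> J p}"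
  proof (intro equalityI subsetI)
    fix z assume "z \<in> J (Suc p)"
    then obtain a b where ab: "ev S z = a \<oplus> f (Suc p) \<otimes> b" "a \<in> I p" "b \<in> carrier S"
      unfolding J_def seq_ideal_Suc[OF p] by blast
    obtain y where y: "ev S y = b" using ev_onto ab(3) by blast
    have ac: "a \<in> carrier S" using ideal.Icarr[OF seq_ideal, of p a] ab(2) p by simp
    have fb: "f (Suc p) \<otimes> b \<in> carrier S" using evF[symmetric] ab(3) by simp
    have "ev S (z - F (Suc p) * y) = a"
      using ac fb by (simp add: ev_minus ev_simps evF y ab(1) a_minus_def a_assoc r_neg)
    then have "z - F (Suc p) * y \<in> J p" using ab(2) unfolding J_def by simp
    then show "z \<in> {x + F (Suc p) * y |x y. x \<in> J p}"
      by (intro CollectI exI[of _ "z - F (Suc p) * y"] exI[of _ y]) simp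
  next
    fix z assume "z \<in> {x + F (Suc p) * y |x y. x \<in> J p}"
    then obtain x y where xy: "z = x + F (Suc p) * y" "x \<in> J p" by blast
    have "ev S z = ev S x \<oplus> f (Suc p) \<otimes> ev S y" unfolding xy(1) by (simp add: ev_simps evF)
    then show "z \<in> J (Suc p)" using xy(2) unfolding J_def seq_ideal_Suc[OF p] by blast
  qed
  fix x assume "F (Suc p) * x \<in> J p"
  then have "f (Suc p) \<otimes> ev S x \<in> I p" unfolding J_def by (simp add: ev_simps evF)
  then have "quot_map S f p (f (Suc p) \<otimes> ev S x) = \<zero>\<^bsub>R p\<^esub>"
    using p evF[symmetric] by (subst quot_map_zero_iff) auto
  then have "quot_map S f p (f (Suc p)) \<otimes>\<^bsub>R p\<^esub> quot_map S f p (ev S x) = \<zero>\<^bsub>R p\<^esub>"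
    using ring_hom_mult[OF quot_map_hom, of p "f (Suc p)" "ev S x"] p evF[symmetric] by simp
  moreover have "quot_map S f p (ev S x) \<in> carrier (R p)"
    using ring_hom_closed[OF quot_map_hom] p by simp
  ultimately have "quot_map S f p (ev S x) = \<zero>\<^bsub>R p\<^esub>"
    using reg p unfolding regular_sequence_def by blast
  then show "x \<in> J p" unfolding J_def using quot_map_zero_iff[of p "ev S x"] p by simp
qed

section \<open>Pre-stable syzygies\<close>

abbreviation vS where "vS \<equiv> ring_presentation.vecmap (ev S)"
abbreviation vR where "vR p \<equiv> ring_presentation.vecmap (phi p)"

lemma vR_vS: "vR p n x = (\<lambda>i\<in>{..<n}. quot_map S f p (vS n x i))" if "p \<le> c"
  unfolding ring_presentation.vecmap_def[OF presentation_R[OF that]]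
    ring_presentation.vecmap_def[OF presentation_S] phi_def
  by (intro restrict_ext) simp

text \<open>A map over \<open>S\<close> and its base change to \<open>R\<^sub>p\<close> have a common lift to the ring type.\<close>

lemma base_change_lift:
  assumes "p \<le> c" and bc: "base_change_map S (R p) (quot_map S f p) k l g h"
  shows "\<exists>H. lin k H \<and> (\<forall>x. g (vS k x) = vS l (H x)) \<and> (\<forall>x. h (vR p k x) = vR p l (H x))"
proof -
  interpret C: local_presentation S "ev S" J0 m by (rule local_presentation_S)
  have g: "g \<in> mod_hom S (free_mod S k) (free_mod S l)"
    and h: "\<And>x. x \<in> carrier (free_mod S k) \<Longrightarrow>
      h (\<lambda>i\<in>{..<k}. quot_map S f p (x i)) = (\<lambda>i\<in>{..<l}. quot_map S f p (g x i))"
    using bc unfolding base_change_map_def by blast+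
  obtain H where H: "lin k H \<and> (\<forall>x. g (vS k x) = vS l (H x))" using C.hom_lin[OF g] ..
  have "h (vR p k x) = vR p l (H x)" for x
    unfolding vR_vS[OF assms(1)] using h[of "vS k x"] H by simp
  then show ?thesis using H by blast
qed

text \<open>What the induction on the level establishes: a resolution over \<open>R\<^sub>p\<close> and an independent set of relations over
  \<open>S\<close>, with numbers subject to the recursion.\<close>

definition layered :: "nat \<Rightarrow> ('a set, 'l, 'z) module_scheme \<Rightarrow> bool" where
  "layered p M \<longleftrightarrow> module (R p) M \<and> (\<exists>n D \<epsilon> b G.
     local_presentation.lifted_resolution (R p) (phi p) m M n D \<epsilon> \<and> layers p n b \<and>
     local_quotient.independent_in J0 m (n 0) {x. \<epsilon> x = \<zero>\<^bsub>M\<^esub>} b G)"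

lemma layered_iso:
  assumes p: "p \<le> c" and iso: "mod_iso (R p) M N" and N: "layered p N"
  shows "layered p M"
proof -
  interpret A: local_presentation "R p" "phi p" J0 m by (rule local_presentation_R[OF p])
  obtain n D \<epsilon> b G where t: "A.lifted_resolution N n D \<epsilon>" and l: "layers p n b"
    and G: "A.independent_in (n 0) {x. \<epsilon> x = \<zero>\<^bsub>N\<^esub>} b G"
    using N unfolding layered_def by blast
  obtain \<epsilon>' where t': "A.lifted_resolution M n D \<epsilon>'" and z: "\<And>x. \<epsilon>' x = \<zero>\<^bsub>M\<^esub> \<longleftrightarrow> \<epsilon> x = \<zero>\<^bsub>N\<^esub>"
    using A.lifted_resolution_transport[OF iso t] by blast
  have "A.independent_in (n 0) {x. \<epsilon>' x = \<zero>\<^bsub>M\<^esub>} b G" unfolding z by (rule G)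
  moreover have "module (R p) M" using iso unfolding mod_iso_def by blast
  ultimately show ?thesis unfolding layered_def using t' l by blast
qed

lemma prestable_module: "prestable_syzygy_vec S f p M \<Longrightarrow> module (R p) M"
  by (cases p) (auto simp: Let_def mod_iso_def)

lemma layered_0:
  assumes "prestable_syzygy_vec S f 0 M"
  shows "layered 0 M"
proof -
  interpret A: local_presentation "R 0" "phi 0" J0 m by (rule local_presentation_R) simp
  have M: "module (R 0) M" and c: "carrier M = {\<zero>\<^bsub>M\<^esub>}" using assms by simp_all
  interpret M: module "R 0" M by (rule M)
  have z: "\<zero>\<^bsub>M\<^esub> \<oplus>\<^bsub>M\<^esub> \<zero>\<^bsub>M\<^esub> = \<zero>\<^bsub>M\<^esub>" "a \<in> carrier (R 0) \<Longrightarrow> a \<odot>\<^bsub>M\<^esub> \<zero>\<^bsub>M\<^esub> = \<zero>\<^bsub>M\<^esub>" for a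
    using M.smult_r_null by simp_all
  have "A.lifted_resolution M (\<lambda>_. 0) (\<lambda>_ _. 0) (\<lambda>_. \<zero>\<^bsub>M\<^esub>)"
    unfolding A.lifted_resolution_def A.lifted_linear_def A.minimal_exact_def
    using z c A.ker_ideal A.m by (auto simp: lin_const_zero eqmod_def)
  moreover have "A.independent_in 0 {x. \<zero>\<^bsub>M\<^esub> = \<zero>\<^bsub>M\<^esub>} 0 (\<lambda>_. 0)"
    unfolding A.independent_in_def using A.m by (auto simp: lin_const_zero eqmod_def)
  ultimately show ?thesis unfolding layered_def using M layers_0 by blast
qed

text \<open>The lift to the ring type of the differential over \<open>S\<close> serves for \<open>R\<^sub>p\<close> and \<open>R\<^sub>p\<^sub>+\<^sub>1\<close> at once. So the module
  below, which the definition attaches to any lifting of \<open>\<delta>\<^sub>1\<close>, can be taken for this one; it is resolved by the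
  kernel of the surjective operator, and its minimal presentation is the one of the induction hypothesis up to
  isomorphism.\<close>

lemma layered_Suc:
  fixes M :: "('a set, nat \<Rightarrow> 'a set) module"
  assumes p: "p < c" and pre: "prestable_syzygy_vec S f (Suc p) M"
    and IH: "\<And>M'. prestable_syzygy_vec S f p M' \<Longrightarrow> layered p M'"
  shows "layered (Suc p) M"
proof -
  have p': "p \<le> c" "Suc p \<le> c" using p by auto
  interpret A: local_presentation "R (Suc p)" "phi (Suc p)" J0 m by (rule local_presentation_R[OF p'(2)])
  interpret B: local_presentation "R p" "phi p" J0 m by (rule local_presentation_R[OF p'(1)])
  interpret C: local_presentation S "ev S" J0 m by (rule local_presentation_S)
  note kerA = ker_R[OF p'(2)] and kerB = ker_R[OF p'(1)]
  obtain n d e t and L :: "('a set, (nat \<Rightarrow> 'a set) set) module" where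
    res: "minimal_free_resolution (R (Suc p)) n d e L" and ci: "ci_operators S f (Suc p) n d t"
    and surj: "\<forall>i. t (Suc p) i ` carrier (free_mod (R (Suc p)) (n (i + 2))) = carrier (free_mod (R (Suc p)) (n i))"
    and iso: "mod_iso (R (Suc p)) M ((free_mod (R (Suc p)) (n 1))
        \<lparr>carrier := hom_ker (free_mod (R (Suc p)) (n 1)) (free_mod (R (Suc p)) (n 0)) (d 1)\<rparr>)"
    and rec: "\<forall>d\<^sub>1. base_change_map (R p) (R (Suc p)) (quot_map_to S f (Suc p)) (n 1) (n 0) d\<^sub>1 (d 1) \<longrightarrow>
        prestable_syzygy_vec S f p ((free_mod (R p) (n 1))
          \<lparr>carrier := hom_ker (free_mod (R p) (n 1)) (free_mod (R p) (n 0)) d\<^sub>1\<rparr>)"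
    using pre unfolding prestable_syzygy_vec.simps Let_def by blast
  obtain d' t' where
    d': "\<And>i. base_change_map S (R (Suc p)) (quot_map S f (Suc p)) (n (Suc i)) (n i) (d' (Suc i)) (d (Suc i))"
    and t': "\<And>j i. j \<in> {1..Suc p} \<Longrightarrow>
      base_change_map S (R (Suc p)) (quot_map S f (Suc p)) (n (i + 2)) (n i) (t' j i) (t j i)"
    and hom: "\<And>i x. x \<in> carrier (free_mod S (n (i + 2))) \<Longrightarrow> d' (i + 1) (d' (i + 2) x) =
       (\<Oplus>\<^bsub>free_mod S (n i)\<^esub>j\<in>{1..Suc p}. f j \<odot>\<^bsub>free_mod S (n i)\<^esub> t' j i x)"
    using ci unfolding ci_operators_def by blast
  have "\<forall>i. \<exists>H. lin (n (Suc i)) H \<and> (\<forall>x. d' (Suc i) (vS (n (Suc i)) x) = vS (n i) (H x)) \<and>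
      (\<forall>x. d (Suc i) (vR (Suc p) (n (Suc i)) x) = vR (Suc p) (n i) (H x))"
    using base_change_lift[OF p'(2) d'] by blast
  from choice[OF this] obtain D where DD: "\<forall>i. lin (n (Suc i)) (D i) \<and>
      (\<forall>x. d' (Suc i) (vS (n (Suc i)) x) = vS (n i) (D i x)) \<and>
      (\<forall>x. d (Suc i) (vR (Suc p) (n (Suc i)) x) = vR (Suc p) (n i) (D i x))" ..
  then have lD: "lin (n (Suc i)) (D i)" and Dd': "d' (Suc i) (vS (n (Suc i)) x) = vS (n i) (D i x)"
    and Dd: "d (Suc i) (vR (Suc p) (n (Suc i)) x) = vR (Suc p) (n i) (D i x)" for i x
    by simp_all
  have "\<forall>j. \<exists>H. \<forall>i. j \<in> {1..Suc p} \<longrightarrow> lin (n (i + 2)) (H i) \<and> (\<forall>x. t' j i (vS (n (i + 2)) x) = vS (n i) (H i x)) \<and>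
      (\<forall>x. t j i (vR (Suc p) (n (i + 2)) x) = vR (Suc p) (n i) (H i x))"
  proof
    fix j
    have "\<forall>i. \<exists>H. j \<in> {1..Suc p} \<longrightarrow> lin (n (i + 2)) H \<and> (\<forall>x. t' j i (vS (n (i + 2)) x) = vS (n i) (H x)) \<and>
      (\<forall>x. t j i (vR (Suc p) (n (i + 2)) x) = vR (Suc p) (n i) (H x))"
      using base_change_lift[OF p'(2) t'] by blast
    from choice[OF this] show "\<exists>H. \<forall>i. j \<in> {1..Suc p} \<longrightarrow> lin (n (i + 2)) (H i) \<and>
        (\<forall>x. t' j i (vS (n (i + 2)) x) = vS (n i) (H i x)) \<and>
        (\<forall>x. t j i (vR (Suc p) (n (i + 2)) x) = vR (Suc p) (n i) (H i x))" .
  qed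
  from choice[OF this] obtain T where TT: "\<forall>j i. j \<in> {1..Suc p} \<longrightarrow> lin (n (i + 2)) (T j i) \<and>
      (\<forall>x. t' j i (vS (n (i + 2)) x) = vS (n i) (T j i x)) \<and>
      (\<forall>x. t j i (vR (Suc p) (n (i + 2)) x) = vR (Suc p) (n i) (T j i x))" ..
  then have lT: "lin (n (Suc (Suc i))) (T j i)" and Tt': "t' j i (vS (n (Suc (Suc i))) x) = vS (n i) (T j i x)"
    and Tt: "t j i (vR (Suc p) (n (Suc (Suc i))) x) = vR (Suc p) (n i) (T j i x)"
    if "j \<in> {1..Suc p}" for i j x
    using that by simp_all
  have exact: "A.minimal_exact (J (Suc p)) n D"
    using A.lifted_resolutionD(3)[OF A.lift_resolution[OF res lD Dd]] unfolding kerA .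
  have homotopy: "eqmod (n i) J0 (D i (D (Suc i) x)) (\<Sum>j\<in>{1..Suc p}. F j \<star> T j i x)" for i x
  proof -
    let ?x = "vS (n (Suc (Suc i))) x"
    have "vS (n i) (D i (D (Suc i) x)) = d' (i + 1) (d' (i + 2) ?x)"
      using Dd'[of "Suc i" x] Dd'[of i "D (Suc i) x"] by simp
    also have "\<dots> = (\<Oplus>\<^bsub>free_mod S (n i)\<^esub>j\<in>{1..Suc p}. f j \<odot>\<^bsub>free_mod S (n i)\<^esub> t' j i ?x)"
      by (rule hom) simp
    also have "\<dots> = (\<Oplus>\<^bsub>free_mod S (n i)\<^esub>j\<in>{1..Suc p}. vS (n i) (F j \<star> T j i x))"
    proof (rule abelian_monoid.finsum_cong'[OF abelian_group.axioms(1)[OF module.axioms(2)[OF C.free_module]] refl])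
      fix j assume j: "j \<in> {1..Suc p}"
      show "f j \<odot>\<^bsub>free_mod S (n i)\<^esub> t' j i ?x = vS (n i) (F j \<star> T j i x)"
        unfolding C.vecmap_scl Tt'[OF j] using ev_F[of j] j p' by simp
    qed simp
    also have "\<dots> = vS (n i) (\<Sum>j\<in>{1..Suc p}. F j \<star> T j i x)" by (rule C.finsum_vecmap) simp
    finally show ?thesis unfolding C.vecmap_eq_iff ker_S .
  qed
  have surjT: "\<exists>x. eqmod (n i) (J (Suc p)) (T (Suc p) i x) y" for i y
  proof -
    have "vR (Suc p) (n i) y \<in> t (Suc p) i ` carrier (free_mod (R (Suc p)) (n (Suc (Suc i))))"
      using surj by simp
    then have "\<exists>x. eqmod (n i) (J (Suc p)) y (T (Suc p) i x)"
      using A.image_iff_lift[of "t (Suc p) i" "n (Suc (Suc i))" "n i" "T (Suc p) i" y] Tt[of "Suc p" i]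
      unfolding kerA by simp
    then show ?thesis using eqmod_sym by blast
  qed
  interpret K: ci_layer J0 m J F c p n D T
    by (intro ci_layer.intro ci_layer_axioms.intro ci_tower p exact lT homotopy surjT)
  have "\<forall>i. \<exists>w. case w of (r, s, P, q) \<Rightarrow> n (Suc (Suc i)) = r + n i \<and> lin (n i) s \<and> lin r P \<and>
     lin (n (Suc (Suc i))) q \<and>
     (\<forall>y. eqmod (n i) J0 (T (Suc p) i (s y)) y) \<and> (\<forall>y. eqmod r J0 (q (P y)) y) \<and>
     (\<forall>x. eqmod (n (Suc (Suc i))) J0 (P (q x) + s (T (Suc p) i x)) x) \<and>
     (\<forall>y. eqmod (n i) J0 (T (Suc p) i (P y)) 0) \<and> (\<forall>y. eqmod r J0 (q (s y)) 0)"
    using K.splitting_exists by simp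
  from choice[OF this] obtain w where w: "\<forall>i. case w i of (r, s, P, q) \<Rightarrow> n (Suc (Suc i)) = r + n i \<and>
     lin (n i) s \<and> lin r P \<and> lin (n (Suc (Suc i))) q \<and>
     (\<forall>y. eqmod (n i) J0 (T (Suc p) i (s y)) y) \<and> (\<forall>y. eqmod r J0 (q (P y)) y) \<and>
     (\<forall>x. eqmod (n (Suc (Suc i))) J0 (P (q x) + s (T (Suc p) i x)) x) \<and>
     (\<forall>y. eqmod (n i) J0 (T (Suc p) i (P y)) 0) \<and> (\<forall>y. eqmod r J0 (q (s y)) 0)" ..
  define r where "r i = fst (w i)" for i
  define s where "s i = fst (snd (w i))" for i
  define P where "P i = fst (snd (snd (w i)))" for i
  define q where "q i = snd (snd (snd (w i)))" for i
  interpret K: ci_layer_split J0 m J F c p n D T r s P q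
  proof
    fix i x y
    note wi = w[rule_format, of i, unfolded case_prod_beta, folded r_def s_def P_def q_def]
    show "n (Suc (Suc i)) = r i + n i" "lin (n i) (s i)" "lin (r i) (P i)" "lin (n (Suc (Suc i))) (q i)"
      "eqmod (n i) J0 (T (Suc p) i (s i y)) y" "eqmod (r i) J0 (q i (P i y)) y"
      "eqmod (n (Suc (Suc i))) J0 (P i (q i x) + s i (T (Suc p) i x)) x"
      "eqmod (n i) J0 (T (Suc p) i (P i y)) 0" "eqmod (r i) J0 (q i (s i y)) 0"
      using wi by (elim conjE; simp only:)+
  qed
  \<comment> \<open>The lifting of \<open>\<delta>\<^sub>1\<close> to \<open>R\<^sub>p\<close> induced by \<open>D 0\<close>, and the module below that it defines.\<close>
  obtain h where h: "h \<in> mod_hom (R p) (free_mod (R p) (n 1)) (free_mod (R p) (n 0))"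
    and hv: "\<And>x. h (vR p (n (Suc 0)) x) = vR p (n 0) (D 0 x)"
    using B.lifted_linear_hom[OF B.free_module B.lifted_linear_vecmap[OF lD[of 0]]] by auto
  let ?M' = "(free_mod (R p) (n (Suc 0)))\<lparr>carrier := hom_ker (free_mod (R p) (n (Suc 0))) (free_mod (R p) (n 0)) h\<rparr>"
  have vv: "(\<lambda>i\<in>{..<k}. quot_map_to S f (Suc p) (vR p k x i)) = vR (Suc p) k x" for k x
    unfolding A.vecmap_def B.vecmap_def phi_def using quot_map_to[OF p] by (intro restrict_ext) simp
  have "base_change_map (R p) (R (Suc p)) (quot_map_to S f (Suc p)) (n 1) (n 0) h (d 1)"
    unfolding base_change_map_def
  proof (intro conjI ballI h)
    show "d 1 \<in> mod_hom (R (Suc p)) (free_mod (R (Suc p)) (n 1)) (free_mod (R (Suc p)) (n 0))"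
      using d'[of 0] unfolding base_change_map_def by simp
    fix x assume "x \<in> carrier (free_mod (R p) (n 1))"
    then obtain u where u: "x = vR p (n 1) u" by (rule B.free_modE)
    show "d 1 (\<lambda>i\<in>{..<n 1}. quot_map_to S f (Suc p) (x i)) = (\<lambda>i\<in>{..<n 0}. quot_map_to S f (Suc p) (h x i))"
      unfolding u vv using Dd[of 0 u] hv[of u] by (simp add: vv)
  qed
  then have pre': "prestable_syzygy_vec S f p ?M'" using rec by simp
  have tM': "B.lifted_resolution ?M' r K.g (\<lambda>y. vR p (n (Suc 0)) (D (Suc 0) (P 0 y)))"
  proof (rule B.lifted_resolution_of_kernel[where ?E0.0 = "D 0"])
    show "h (vR p (n (Suc 0)) x) = vR p (n 0) (D 0 x)" for x by (rule hv)
    show "A.minimal_exact B.ker r K.g" unfolding kerB by (rule K.minimal_exact_g)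
    show "lin (r 0) (\<lambda>y. D (Suc 0) (P 0 y))" by (rule lin_comp[OF K.lin_P lD])
    show "eqmod (n 0) B.ker (D 0 z) 0 \<longleftrightarrow> (\<exists>x. eqmod (n (Suc 0)) B.ker z (D (Suc 0) (P 0 x)))" for z
      unfolding kerB
    proof
      assume "\<exists>x. eqmod (n (Suc 0)) (J p) z (D (Suc 0) (P 0 x))"
      then obtain x where "eqmod (n (Suc 0)) (J p) z (D (Suc 0) (P 0 x))" ..
      from eqmod_lin[OF lD this] show "eqmod (n 0) (J p) (D 0 z) 0" by (rule eqmod_trans[OF _ K.DDP])
    qed (rule K.lift_cycle)
    show "eqmod (n (Suc 0)) B.ker (D (Suc 0) (P 0 x)) 0 \<longleftrightarrow> (\<exists>y. eqmod (r 0) B.ker x (K.g 0 y))" for x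
      unfolding kerB by (rule K.DP_kernel)
  qed
  obtain n' D' \<epsilon>' b G where t': "B.lifted_resolution ?M' n' D' \<epsilon>'" and lay: "layers p n' b"
    and G: "A.independent_in (n' 0) {x. \<epsilon>' x = \<zero>\<^bsub>?M'\<^esub>} b G"
    using IH[OF pre'] unfolding layered_def by blast
  have nr: "n' = r" using B.lifted_resolution_unique(2)[OF prestable_module[OF pre'] t' tM'] by (intro ext)
  have zM': "vR p (n (Suc 0)) x = \<zero>\<^bsub>?M'\<^esub> \<longleftrightarrow> eqmod (n (Suc 0)) (J p) x 0" for x
    using B.vecmap_zero_iff[of "n (Suc 0)" x] unfolding kerB by simp
  obtain G' where "A.independent_in (r 0) {y. eqmod (n (Suc 0)) (J p) (D (Suc 0) (P 0 y)) 0} b G'"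
    using A.independent_in_iso[OF B.lifted_resolution_unique(1)[OF prestable_module[OF pre'] t' tM'] G]
    unfolding zM' by blast
  from K.independent_step[OF this] obtain G'' where
    G'': "A.independent_in (n (Suc (Suc 0))) {x. eqmod (n (Suc 0)) (J (Suc p)) (D (Suc 0) x) 0}
      (b + n (Suc 0) + p * n 0) G''" ..
  let ?N = "(free_mod (R (Suc p)) (n (Suc 0)))
    \<lparr>carrier := hom_ker (free_mod (R (Suc p)) (n (Suc 0))) (free_mod (R (Suc p)) (n 0)) (d (Suc 0))\<rparr>"
  have tN: "A.lifted_resolution ?N (\<lambda>i. n (i + 2)) (\<lambda>i. D (i + 2)) (\<lambda>x. vR (Suc p) (n (Suc 0)) (D (Suc 0) x))"
  proof (rule A.lifted_resolution_of_kernel[where ?E0.0 = "D 0"])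
    show "d (Suc 0) (vR (Suc p) (n (Suc 0)) x) = vR (Suc p) (n 0) (D 0 x)" for x by (rule Dd)
    show "A.minimal_exact A.ker (\<lambda>i. n (i + 2)) (\<lambda>i. D (i + 2))"
      unfolding kerA by (rule A.minimal_exact_shift[OF exact])
    show "lin (n (0 + 2)) (D (Suc 0))" using lD[of "Suc 0"] by simp
    show "eqmod (n 0) A.ker (D 0 z) 0 \<longleftrightarrow> (\<exists>x. eqmod (n (Suc 0)) A.ker z (D (Suc 0) x))" for z
      unfolding kerA by (rule A.minimal_exact_kernel[OF exact])
    show "eqmod (n (Suc 0)) A.ker (D (Suc 0) x) 0 \<longleftrightarrow> (\<exists>y. eqmod (n (0 + 2)) A.ker x (D (0 + 2) y))" for x
      using A.minimal_exact_kernel[OF exact, of "Suc 0" x] unfolding kerA by simp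
  qed
  have zN: "vR (Suc p) (n (Suc 0)) x = \<zero>\<^bsub>?N\<^esub> \<longleftrightarrow> eqmod (n (Suc 0)) (J (Suc p)) x 0" for x
    using A.vecmap_zero_iff[of "n (Suc 0)" x] unfolding kerA by simp
  have "layers (Suc p) (\<lambda>i. n (i + 2)) (b + n (Suc 0) + p * n 0)"
  proof (rule layers_Suc[OF lay[unfolded nr] K.rank_le])
    show "n 0 < n (Suc 0)" if "r 0 \<noteq> 0"
      using that K.rank_le K.rank_eq by (metis le_neq_implies_less)
    show "n (Suc 0) = 0 \<and> r 0 = 0" if "n 0 = 0"
      using K.rank_zero[of 0] K.rank_zero[of "Suc 0"] K.rank[of 0] that by simp
  qed (simp_all add: K.rank)
  moreover have "module (R (Suc p)) ?N" using iso unfolding mod_iso_def by simp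
  moreover have "A.independent_in (n (0 + 2)) {x. vR (Suc p) (n (Suc 0)) (D (Suc 0) x) = \<zero>\<^bsub>?N\<^esub>}
      (b + n (Suc 0) + p * n 0) G''"
    unfolding zN using G'' by (simp add: numeral_2_eq_2)
  ultimately have "layered (Suc p) ?N" unfolding layered_def using tN by (intro conjI exI)
  then show ?thesis using layered_iso[OF p'(2)] iso by simp
qed

lemma prestable_layered:
  fixes M :: "('a set, nat \<Rightarrow> 'a set) module"
  shows "p \<le> c \<Longrightarrow> prestable_syzygy_vec S f p M \<Longrightarrow> layered p M"
proof (induction p arbitrary: M)
  case (Suc p)
  then show ?case using layered_Suc[of p M] by simp
qed (rule layered_0)

lemma restrict_scalars_module:
  assumes p: "p \<le> c" and M: "module (R p) M"
  shows "module S (restrict_scalars (quot_map S f p) M)"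
proof -
  interpret M: module "R p" M by (rule M)
  note hom = quot_map_hom[OF p]
  show ?thesis
  proof (rule moduleI)
    show "abelian_group (restrict_scalars (quot_map S f p) M)"
      by (rule abelian_groupI)
        (auto simp: restrict_scalars_def M.a_ac intro: M.l_neg)
  qed (simp_all add: restrict_scalars_def cring_S ring_hom_closed[OF hom] ring_hom_add[OF hom]
      ring_hom_mult[OF hom] ring_hom_one[OF hom] M.smult_l_distr M.smult_r_distr M.smult_assoc1)
qed

end

theorem corollary9p15:
  fixes S :: "('a, 'x) ring_scheme"
    and f :: "nat \<Rightarrow> 'a"
    and c :: nat
    and M :: "('a set, 'm, 'y) module_scheme"
    and \<zeta> :: enat
    and b :: "nat \<Rightarrow> nat"
  assumes "noetherian_local_ring S"
    and "regular_sequence S f c"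
    and "prestable_syzygy S f c M"
    and "\<zeta> = complexity (seq_quot S f c) M"
    and "\<And>i. b i = betti S (restrict_scalars (quot_map S f c) M) i"
  shows "enat (b 0) \<ge> \<zeta> \<and>
    real (b 1) \<ge> (real c - real (the_enat \<zeta>) + 1) * real (b 0)
      + real (the_enat \<zeta>) * (real (the_enat \<zeta>) + 1) / 2 - 1"
proof -
  interpret X: local_regular_sequence S f c
    by (intro local_regular_sequence.intro local_regular_sequence_axioms.intro assms(1,2))
  interpret A: local_presentation "seq_quot S f c" "X.phi c" X.J0 X.m
    by (rule X.local_presentation_R) simp
  interpret C: local_presentation S "ev S" X.J0 X.m by (rule X.local_presentation_S)
  interpret N: noetherian_local_quotient X.J0 X.m by (rule X.noetherian_local_quotient)
  obtain K where K: "prestable_syzygy_vec S f c K" "mod_iso (seq_quot S f c) M K"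
    using assms(3) unfolding prestable_syzygy_def by blast
  have lay: "X.layered c M" by (rule X.layered_iso[OF le_refl K(2) X.prestable_layered[OF le_refl K(1)]])
  then have M: "module (seq_quot S f c) M" unfolding X.layered_def by blast
  obtain n D \<epsilon> B G where t: "A.lifted_resolution M n D \<epsilon>" and layers: "layers c n B"
    and G: "A.independent_in (n 0) {x. \<epsilon> x = \<zero>\<^bsub>M\<^esub>} B G"
    using lay unfolding X.layered_def by blast
  obtain z where z: "z \<le> c" "growth z n" "z \<le> n 0"
    and bound: "z = 0 \<or> 2 * (c - z + 1) * n 0 + z * (z + 1) \<le> 2 * (B + 1)"
    using layers_bounds[OF layers] by blast
  have \<zeta>: "\<zeta> = enat z"
    unfolding assms(4) complexity_def A.betti_eq[OF M t] by (rule growth_exponent[OF z(2)])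
  \<comment> \<open>The same generators present \<open>M\<close> minimally over \<open>S\<close>, with the same relation submodule \<open>L\<close>.\<close>
  let ?MS = "restrict_scalars (quot_map S f c) M"
  interpret MM: module "seq_quot S f c" M by (rule M)
  note e = A.lifted_linearD[OF A.lifted_resolutionD(1)[OF t]]
  define L where "L = {x. \<epsilon> x = \<zero>\<^bsub>M\<^esub>}"
  have L: "submod L"
    unfolding submod_def L_def using e(5) MM.smult_r_null A.phi_closed by (simp add: e(2,3))
  have L0: "x \<in> L" if "eqmod (n 0) X.J0 x 0" for x
    unfolding L_def using e(4)[OF A.eqmod_ker[OF that]] by simp
  have Lm: "eqmod (n 0) X.m x 0" if x: "x \<in> L" for x
  proof -
    obtain y where "eqmod (n 0) A.ker x (D 0 y)" using x unfolding L_def mem_Collect_eq A.lifted_resolutionD(4)[OF t] ..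
    from eqmod_trans[OF eqmod_mono[OF this A.ker_m A.m] A.minimal_exactD(2)[OF A.lifted_resolutionD(3)[OF t]]]
    show ?thesis .
  qed
  obtain n' D' where n': "n' 0 = n 0" and D': "A.minimal_exact X.J0 n' D'"
    and LD: "\<And>x. x \<in> L \<longleftrightarrow> (\<exists>y. eqmod (n 0) X.J0 x (D' 0 y))"
    using N.minimal_resolution_exists[OF L L0 Lm] by blast
  have MS: "carrier ?MS = carrier M" "\<zero>\<^bsub>?MS\<^esub> = \<zero>\<^bsub>M\<^esub>" "x \<oplus>\<^bsub>?MS\<^esub> y = x \<oplus>\<^bsub>M\<^esub> y"
    "a \<odot>\<^bsub>?MS\<^esub> x = quot_map S f c a \<odot>\<^bsub>M\<^esub> x" for x y a
    by (simp_all add: restrict_scalars_def)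
  have tl: "C.lifted_linear ?MS (n 0) \<epsilon>"
    unfolding C.lifted_linear_def X.ker_S MS using e A.eqmod_ker by (simp add: X.phi_def)
  have tS: "C.lifted_resolution ?MS n' D' \<epsilon>"
    unfolding C.lifted_resolution_def X.ker_S MS n'
    using tl A.lifted_resolutionD(2)[OF t] D' LD unfolding L_def by simp
  have MSm: "module S ?MS" by (rule X.restrict_scalars_module[OF le_refl M])
  have b: "b i = n' i" for i unfolding assms(5) by (rule C.betti_eq[OF MSm tS])
  have "B \<le> n' (Suc 0)"
  proof (rule A.independent_rank_le[OF G A.minimal_exactD(1)[OF D']])
    show "D' 0 y \<in> {x. \<epsilon> x = \<zero>\<^bsub>M\<^esub>}" for y
      using LD[of "D' 0 y"] eqmod_refl[OF A.J0] unfolding L_def by blast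
    show "\<exists>y. eqmod (n 0) X.J0 x (D' 0 y)" if "x \<in> {x. \<epsilon> x = \<zero>\<^bsub>M\<^esub>}" for x
      using that LD unfolding L_def by blast
  qed
  then have B: "B \<le> b 1" unfolding b by simp
  have b0: "b 0 = n 0" unfolding b n' ..
  have "(real c - real z + 1) * real (b 0) + real z * (real z + 1) / 2 - 1 \<le> real (b 1)"
  proof (cases "z = 0")
    case True
    then have "b 0 = 0" using growth_zero_iff[OF z(2)] b0 by simp
    then show ?thesis using True by simp
  next
    case False
    then have "2 * (c - z + 1) * n 0 + z * (z + 1) \<le> 2 * (B + 1)" using bound by blast
    also have "\<dots> \<le> 2 * (b 1 + 1)" using B by simp
    finally have "2 * (c - z + 1) * b 0 + z * (z + 1) \<le> 2 * (b 1 + 1)" unfolding b0 .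
    then have "real (2 * (c - z + 1) * b 0 + z * (z + 1)) \<le> real (2 * (b 1 + 1))" by (simp only: of_nat_le_iff)
    moreover obtain k where "c = z + k" using z(1) le_Suc_ex by blast
    ultimately show ?thesis by (simp add: field_simps)
  qed
  then show ?thesis unfolding \<zeta> using z(3) b0 by simp
qed

end
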